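(* There exists a constant $C>0$, depending only on $\Omega$ and the mesh regularity constant $c_0$ (in particular not on the mesh $\mathcal T_h$ or on $h$), such that for every admissible mesh and all $\mathbf v_h\in\mathbf P_0$, $\mathbf w_h\in\mathbf P_0$, $\mathbf u_h\in\mathbf P_0\cap\mathbf{RT_0}$ satisfying $\mathrm{div}\,\mathbf u_h=0$, $$|\mathrm b_h(\mathbf u_h,\mathbf v_h,\mathbf w_h)|\le C\,|\mathbf u_h|\,\|\mathbf v_h\|_h\,\|\mathbf w_h\|_h .$$
   Context: $\Omega\subset\mathbb R^2$ is a bounded polygonal domain; $|\cdot|$ is the norm of $(L^2(\Omega))^2$ (also used for the absolute value, the Euclidean norm, lengths and areas). Mesh. $\mathcal T_h$ is a conforming triangular mesh of $\Omega$ all of whose triangles have all interior angles less than $\pi/2$. For $K\in\mathcal T_h$, $\mathbf x_K$ and $h_K$ are the center and the diameter of the circumscribed circle of $K$; $h=\max_K h_K$; $\mathcal E_K$ is the set of edges of $K$; $\mathbf n_{K,\sigma}$ is the unit normal to $\sigma\in\mathcal E_K$ pointing outward from $K$. $\mathcal E_h$ is the set of all edges, $\mathcal E_h^{int}$ (resp. $\mathcal E_h^{ext}$) those inside $\Omega$ (resp. on $\partial\Omega$). $\mathbf x_\sigma$ and $|\sigma|$ are the midpoint and length of $\sigma$. For $\sigma\in\mathcal E_h^{int}$, $K_\sigma,L_\sigma$ are the two triangles sharing $\sigma$ and $d_\sigma=d(\mathbf x_{K_\sigma},\mathbf x_{L_\sigma})$ (when a triangle $K$ having $\sigma$ as an edge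 is singled out, $L_\sigma$ is the other one); for $\sigma\in\mathcal E_h^{ext}$, $K_\sigma$ is the triangle having $\sigma$ as an edge and $d_\sigma=d(\mathbf x_{K_\sigma},\mathbf x_\sigma)$. $\tau_\sigma=|\sigma|/d_\sigma$. The mesh is admissible if, for a fixed constant $c_0>0$ common to all meshes, $d_\sigma\ge c_0|\sigma|$ and $|\sigma|\ge c_0h$ for all $\sigma\in\mathcal E_h$. Spaces. $\mathbf P_0$: $\mathbb R^2$-valued functions constant on each $K\in\mathcal T_h$, with $\mathbf v_K=\mathbf v_h|_K$ and norm $$\|\mathbf v_h\|_h=\Big(\sum_{\sigma\in\mathcal E_h^{int}}\tau_\sigma|\mathbf v_{L_\sigma}-\mathbf v_{K_\sigma}|^2+\sum_{\sigma\in\mathcal E_h^{ext}}\tau_\sigma|\mathbf v_{K_\sigma}|^2\Big)^{1/2}.$$ $\mathbf{RT_0}$: vector fields $\mathbf v_h$, affine on each triangle, such that $\mathbf v_h|_K\cdot\mathbf n_{K,\sigma}$ is constant on $\sigma$ for all $K$ and $\sigma\in\mathcal E_K$, $\mathbf v_h\cdot\mathbf n=0$ on $\partial\Omega$, and $\mathbf v_h|_{K_\sigma}\cdot\mathbf n_{K_\sigma,\sigma}=\mathbf v_h|_{L_\sigma}\cdot\mathbf n_{K_\sigma,\sigma}$ on every $\sigma\in\mathcal E_h^{int}$; one writes $(\mathbf v_h\cdot\mathbf n_{K,\sigma})_\sigma=\mathbf v_h|_K\cdot\mathbf n_{K,\sigma}$. With $a^+=\max(a,0)$, $a^-=\min(a,0)$,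 $\tilde{\mathbf b}_h:\mathbf{RT_0}\times\mathbf P_0\to\mathbf P_0$ is $$\tilde{\mathbf b}_h(\mathbf u_h,\mathbf v_h)|_K=\frac1{|K|}\sum_{\sigma\in\mathcal E_K\cap\mathcal E_h^{int}}|\sigma|\big((\mathbf u_h\cdot\mathbf n_{K,\sigma})_\sigma^+\mathbf v_K+(\mathbf u_h\cdot\mathbf n_{K,\sigma})_\sigma^-\mathbf v_{L_\sigma}\big),$$ and $\mathrm b_h:\mathbf{RT_0}\times\mathbf P_0\times\mathbf P_0\to\mathbb R$ is $\mathrm b_h(\mathbf u_h,\mathbf v_h,\mathbf w_h)=\sum_{K\in\mathcal T_h}|K|\,\mathbf w_K\cdot\tilde{\mathbf b}_h(\mathbf u_h,\mathbf v_h)|_K$. *)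

theory Defs
  imports "HOL-Analysis.Analysis"
begin

type_synonym point = "real^2"

section \<open>Domain and geometry of triangles\<close>

text \<open>
  The last condition says that the domain lies on one side of its boundary: it excludes
  slits, where an edge contained in the boundary could have a triangle on both sides.
  Holes, and non-convex or even touching corners, are allowed.
\<close>

definition polygonal_domain :: "point set \<Rightarrow> bool" where
  "polygonal_domain \<Omega> \<longleftrightarrow>
     open \<Omega> \<and> connected \<Omega> \<and> bounded \<Omega> \<and> \<Omega> \<noteq> {} \<and>
     (\<exists>S. finite S \<and> (\<forall>s\<in>S. \<exists>a b. s = closed_segment a b) \<and> frontier \<Omega> = \<Union>S) \<and>
     interior (closure \<Omega>) = \<Omega>"

definition vertices :: "point set \<Rightarrow> point set" where
  "vertices K = {p. p extreme_point_of K}"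

definition edges :: "point set \<Rightarrow> point set set" where
  "edges K = {\<sigma>. \<sigma> edge_of K}"

definition angle_at :: "point \<Rightarrow> point \<Rightarrow> point \<Rightarrow> real" where
  "angle_at a b c = arccos (((b - a) \<bullet> (c - a)) / (norm (b - a) * norm (c - a)))"

definition acute :: "point set \<Rightarrow> bool" where
  "acute K \<longleftrightarrow>
     (\<forall>a\<in>vertices K. \<forall>b\<in>vertices K. \<forall>c\<in>vertices K.
        distinct [a, b, c] \<longrightarrow> angle_at a b c < pi / 2)"

definition circumcenter :: "point set \<Rightarrow> point" where
  "circumcenter K = (THE x. \<exists>r. vertices K \<subseteq> sphere x r)"

definition circumradius :: "point set \<Rightarrow> real" where
  "circumradius K = (THE r. vertices K \<subseteq> sphere (circumcenter K) r)"

definition circumdiameter :: "point set \<Rightarrow> real" where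
  "circumdiameter K = 2 * circumradius K"

definition area :: "point set \<Rightarrow> real" where
  "area K = measure lebesgue K"

definition edge_length :: "point set \<Rightarrow> real" where
  "edge_length \<sigma> = (THE l. \<exists>a b. \<sigma> = closed_segment a b \<and> l = dist a b)"

definition edge_midpoint :: "point set \<Rightarrow> point" where
  "edge_midpoint \<sigma> = (THE m. \<exists>a b. \<sigma> = closed_segment a b \<and> m = midpoint a b)"

definition outer_normal :: "point set \<Rightarrow> point set \<Rightarrow> point" where
  "outer_normal K \<sigma> =
     (THE n. norm n = 1 \<and> (\<forall>x\<in>\<sigma>. \<forall>y\<in>\<sigma>. n \<bullet> (x - y) = 0) \<and> (\<forall>x\<in>K. \<forall>y\<in>\<sigma>. n \<bullet> (x - y) \<le> 0))"

section \<open>Meshes\<close>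

text \<open>
  Triangles are closed; conformity is the face-to-face condition contained in
  \<^const>\<open>triangulation\<close>.
\<close>

definition acute_mesh :: "point set \<Rightarrow> point set set \<Rightarrow> bool" where
  "acute_mesh \<Omega> T \<longleftrightarrow>
     triangulation T \<and> \<Union>T = closure \<Omega> \<and> (\<forall>K\<in>T. 2 simplex K \<and> acute K)"

definition mesh_size :: "point set set \<Rightarrow> real" where
  "mesh_size T = Max (circumdiameter ` T)"

definition mesh_edges :: "point set set \<Rightarrow> point set set" where
  "mesh_edges T = (\<Union>K\<in>T. edges K)"

text \<open>An edge inside the domain may have its end points on the boundary.\<close>

definition int_edges :: "point set \<Rightarrow> point set set \<Rightarrow> point set set" where
  "int_edges \<Omega> T = {\<sigma> \<in> mesh_edges T. rel_interior \<sigma> \<subseteq> \<Omega>}"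

definition ext_edges :: "point set \<Rightarrow> point set set \<Rightarrow> point set set" where
  "ext_edges \<Omega> T = {\<sigma> \<in> mesh_edges T. \<sigma> \<subseteq> frontier \<Omega>}"

text \<open>
  Of the two triangles sharing an interior edge, an arbitrary one is chosen as \<open>K\<^sub>\<sigma>\<close>;
  \<open>opposite_tri T K \<sigma>\<close> is the other triangle when \<open>K\<close> is singled out.
\<close>

definition edge_tri :: "point set set \<Rightarrow> point set \<Rightarrow> point set" where
  "edge_tri T \<sigma> = (SOME K. K \<in> T \<and> \<sigma> \<in> edges K)"

definition opposite_tri :: "point set set \<Rightarrow> point set \<Rightarrow> point set \<Rightarrow> point set" where
  "opposite_tri T K \<sigma> = (THE L. L \<in> T \<and> L \<noteq> K \<and> \<sigma> \<in> edges L)"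

definition edge_tri2 :: "point set set \<Rightarrow> point set \<Rightarrow> point set" where
  "edge_tri2 T \<sigma> = opposite_tri T (edge_tri T \<sigma>) \<sigma>"

definition edge_dist :: "point set \<Rightarrow> point set set \<Rightarrow> point set \<Rightarrow> real" where
  "edge_dist \<Omega> T \<sigma> =
     (if \<sigma> \<in> int_edges \<Omega> T
      then dist (circumcenter (edge_tri T \<sigma>)) (circumcenter (edge_tri2 T \<sigma>))
      else dist (circumcenter (edge_tri T \<sigma>)) (edge_midpoint \<sigma>))"

definition transmissivity :: "point set \<Rightarrow> point set set \<Rightarrow> point set \<Rightarrow> real" where
  "transmissivity \<Omega> T \<sigma> = edge_length \<sigma> / edge_dist \<Omega> T \<sigma>"

definition admissible_mesh :: "point set \<Rightarrow> real \<Rightarrow> point set set \<Rightarrow> bool" where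
  "admissible_mesh \<Omega> c\<^sub>0 T \<longleftrightarrow>
     acute_mesh \<Omega> T \<and>
     (\<forall>\<sigma>\<in>mesh_edges T. edge_dist \<Omega> T \<sigma> \<ge> c\<^sub>0 * edge_length \<sigma> \<and> edge_length \<sigma> \<ge> c\<^sub>0 * mesh_size T)"

section \<open>Discrete spaces\<close>

text \<open>
  Piecewise constant or affine fields are functions on the plane of which only the values in the
  interiors of the triangles matter; their restriction to a closed triangle \<open>K\<close> is the
  affine extension (\<open>affine_piece\<close>) of their values in the interior of \<open>K\<close>.
\<close>

definition P0 :: "point set set \<Rightarrow> (point \<Rightarrow> real^2) set" where
  "P0 T = {v. \<forall>K\<in>T. v constant_on interior K}"

definition cell_value :: "(point \<Rightarrow> real^2) \<Rightarrow> point set \<Rightarrow> real^2" where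
  "cell_value v K = (THE c. \<forall>x\<in>interior K. v x = c)"

definition h_norm :: "point set \<Rightarrow> point set set \<Rightarrow> (point \<Rightarrow> real^2) \<Rightarrow> real" where
  "h_norm \<Omega> T v = sqrt (
     (\<Sum>\<sigma>\<in>int_edges \<Omega> T. transmissivity \<Omega> T \<sigma> *
        (norm (cell_value v (edge_tri2 T \<sigma>) - cell_value v (edge_tri T \<sigma>)))\<^sup>2) +
     (\<Sum>\<sigma>\<in>ext_edges \<Omega> T. transmissivity \<Omega> T \<sigma> * (norm (cell_value v (edge_tri T \<sigma>)))\<^sup>2))"

definition L2_norm_on :: "point set \<Rightarrow> (point \<Rightarrow> real^2) \<Rightarrow> real" where
  "L2_norm_on \<Omega> v = sqrt (LINT x:\<Omega>|lebesgue. (norm (v x))\<^sup>2)"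

definition affine_map :: "(point \<Rightarrow> real^2) \<Rightarrow> bool" where
  "affine_map g \<longleftrightarrow> (\<exists>A b. linear A \<and> g = (\<lambda>x. A x + b))"

definition affine_piece :: "(point \<Rightarrow> real^2) \<Rightarrow> point set \<Rightarrow> point \<Rightarrow> real^2" where
  "affine_piece v K = (THE g. affine_map g \<and> (\<forall>x\<in>interior K. g x = v x))"

definition RT0 :: "point set \<Rightarrow> point set set \<Rightarrow> (point \<Rightarrow> real^2) set" where
  "RT0 \<Omega> T = {v.
     (\<forall>K\<in>T. \<exists>g. affine_map g \<and> (\<forall>x\<in>interior K. v x = g x)) \<and>
     (\<forall>K\<in>T. \<forall>\<sigma>\<in>edges K. (\<lambda>x. affine_piece v K x \<bullet> outer_normal K \<sigma>) constant_on \<sigma>) \<and>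
     (\<forall>\<sigma>\<in>ext_edges \<Omega> T. \<forall>x\<in>\<sigma>.
        affine_piece v (edge_tri T \<sigma>) x \<bullet> outer_normal (edge_tri T \<sigma>) \<sigma> = 0) \<and>
     (\<forall>\<sigma>\<in>int_edges \<Omega> T. \<forall>x\<in>\<sigma>.
        affine_piece v (edge_tri T \<sigma>) x \<bullet> outer_normal (edge_tri T \<sigma>) \<sigma> =
        affine_piece v (edge_tri2 T \<sigma>) x \<bullet> outer_normal (edge_tri T \<sigma>) \<sigma>)}"

definition normal_flux :: "(point \<Rightarrow> real^2) \<Rightarrow> point set \<Rightarrow> point set \<Rightarrow> real" where
  "normal_flux u K \<sigma> = (THE c. \<forall>x\<in>\<sigma>. affine_piece u K x \<bullet> outer_normal K \<sigma> = c)"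

text \<open>
  Normal components of Raviart-Thomas fields are continuous across edges, so their distributional
  divergence is the function computed triangle by triangle.
\<close>

definition divergence :: "(point \<Rightarrow> real^2) \<Rightarrow> point \<Rightarrow> real" where
  "divergence u x = trace (jacobian u (at x))"

definition divergence_free :: "point set set \<Rightarrow> (point \<Rightarrow> real^2) \<Rightarrow> bool" where
  "divergence_free T u \<longleftrightarrow> (\<forall>K\<in>T. \<forall>x\<in>interior K. divergence u x = 0)"

section \<open>Upwind convection\<close>

text \<open>The piecewise constant field \<open>b_tilde \<Omega> T u v\<close> is given by its value on each triangle.\<close>

definition b_tilde ::
    "point set \<Rightarrow> point set set \<Rightarrow> (point \<Rightarrow> real^2) \<Rightarrow> (point \<Rightarrow> real^2) \<Rightarrow> point set \<Rightarrow> real^2" where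
  "b_tilde \<Omega> T u v K = (1 / area K) *\<^sub>R
     (\<Sum>\<sigma>\<in>edges K \<inter> int_edges \<Omega> T. edge_length \<sigma> *\<^sub>R
        (max (normal_flux u K \<sigma>) 0 *\<^sub>R cell_value v K +
         min (normal_flux u K \<sigma>) 0 *\<^sub>R cell_value v (opposite_tri T K \<sigma>)))"

definition b_form ::
    "point set \<Rightarrow> point set set \<Rightarrow> (point \<Rightarrow> real^2) \<Rightarrow> (point \<Rightarrow> real^2) \<Rightarrow> (point \<Rightarrow> real^2) \<Rightarrow> real" where
  "b_form \<Omega> T u v w = (\<Sum>K\<in>T. area K * (cell_value w K \<bullet> b_tilde \<Omega> T u v K))"

end

theory Submission
  imports Defs
begin

text \<open>
  Since \<open>u\<close> is constant on each triangle, its fluxes \<open>q K L\<close> through the edges are antisymmetric and sum to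
  zero around each triangle, and \<open>b\<close> splits into scalar upwind forms. What has to be gained over Hoelder's
  inequality is the missing embedding of \<open>H\<^sup>1\<close> into \<open>L\<^sup>\<infinity>\<close> in dimension two, and this is the div-curl
  phenomenon behind Wente's inequality: for fixed \<open>u\<close> and \<open>v\<close> the linear form \<open>l = b(u, v, _)\<close> is bounded
  by \<open>A sup |g|\<close> with \<open>A\<close> a multiple of \<open>|u| \<parallel>v\<parallel>\<close>, and it is moreover bounded by \<open>A\<close> on truncated
  logarithms, although their energy is unbounded: a logarithm is a sum of bumps, one for each dyadic
  annulus, and on an annulus conservation allows to subtract from \<open>v\<close> its mean, which Poincare's
  inequality controls. A near-minimiser \<open>\<phi>\<close> of the energy minus \<open>2 l\<close> represents \<open>l\<close> in the Dirichlet inner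
  product, so its value at a point is nearly \<open>l\<close> of the logarithm centred there, whence \<open>sup |\<phi>|\<close> is
  bounded by \<open>A\<close> up to a small error, and \<open>\<parallel>\<phi>\<parallel>\<^sup>2 \<approx> l \<phi> \<le> A sup |\<phi>|\<close> bounds the norm of \<open>l\<close>.
  All this is done on a square grid of mesh width \<open>h\<close>, on which the functions of the triangulation are
  sampled; the mesh regularity bounds the sampling errors by the energy carried by nearby edges.
\<close>

section \<open>Poincare inequalities on grid annuli\<close>

text \<open>What makes the logarithm work is scale invariance in dimension two: a bump on the
  annulus of radius e^k has gradient of size e^-k, the Poincare constant there is of size e^k, and
  the two cancel. So the share of \<open>l\<close> that belongs to this annulus is at most a
  constant times the norm of \<open>u\<close> times that of \<open>v\<close>, both restricted to the
  annulus. Since the annuli overlap boundedly, Cauchy-Schwarz over the annuli gives back one product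
  of global norms, however many annuli there are; this rests on having two square summable factors.
  A triangulation has no explicit Green function and no translations, hence the passage to the grid:
  there the Laplacian of the logarithm has a closed form, is positive and decays fast, and the Green
  functions of all points are translates of one. Discrete functions are extended by zero to the
  plane, so the Green function is that of the plane. The constants of the grid part are absolute;
  \<open>c\<^sub>0\<close> enters through the number of cells near a grid point, the areas and the
  transmissivities.\<close>

definition gsq :: "(int \<times> int \<Rightarrow> real) \<Rightarrow> int \<times> int \<Rightarrow> real" where
  "gsq f z = (f (fst z + 1, snd z) - f z)\<^sup>2 + (f (fst z, snd z + 1) - f z)\<^sup>2"

lemma gsq_nonneg [simp]: "0 \<le> gsq f z"
  by (simp add: gsq_def)

lemma diff_square_le_sum:
  fixes f :: "int \<Rightarrow> real"
  assumes "a \<le> b"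
  shows "(f b - f a)\<^sup>2 \<le> of_int (b - a) * (\<Sum>k\<in>{a..<b}. (f (k + 1) - f k)\<^sup>2)"
proof -
  have "f b - f a = (\<Sum>k\<in>{a..<b}. f (k + 1) - f k)"
    using assms
  proof (induction b rule: int_ge_induct)
    case (step i)
    then have "{a..<i + 1} = insert i {a..<i}" by auto
    with step show ?case by simp
  qed simp
  then show ?thesis
    using sum_squared_le_sum_of_squares[of "\<lambda>k. f (k + 1) - f k" "{a..<b}"] assms
    by (simp add: mult.commute)
qed

text \<open>The increment at \<open>q\<close> leaves the interval; it only enlarges the right side,
  and it makes the sum match that of \<open>gsq\<close> over the same range.\<close>

lemma diff_square_le_sum_interval:
  fixes f :: "int \<Rightarrow> real"
  assumes "i \<in> {p..q}" "i' \<in> {p..q}"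
  shows "(f i - f i')\<^sup>2 \<le> of_int \<bar>i - i'\<bar> * (\<Sum>k\<in>{p..q}. (f (k + 1) - f k)\<^sup>2)"
proof -
  have *: "(f b - f a)\<^sup>2 \<le> of_int (b - a) * (\<Sum>k\<in>{p..q}. (f (k + 1) - f k)\<^sup>2)"
    if "a \<le> b" "a \<in> {p..q}" "b \<in> {p..q}" for a b
  proof -
    have "(\<Sum>k\<in>{a..<b}. (f (k + 1) - f k)\<^sup>2) \<le> (\<Sum>k\<in>{p..q}. (f (k + 1) - f k)\<^sup>2)"
      using that by (intro sum_mono2) auto
    then show ?thesis
      using diff_square_le_sum[OF that(1), of f] that(1)
      by (smt (verit) mult_left_mono of_int_0_le_iff)
  qed
  show ?thesis
    using *[of i i'] *[of i' i] assms by (cases "i \<le> i'") (auto simp: power2_commute)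
qed

lemma rectangle_row_le:
  fixes f :: "int \<times> int \<Rightarrow> real"
  assumes "i \<in> {p..q}" "i' \<in> {p..q}" "j \<in> {r..s}" "q - p + 1 \<le> n"
  shows "(f (i, j) - f (i', j))\<^sup>2 \<le> of_int n * (\<Sum>k\<in>{p..q}. (f (k + 1, j) - f (k, j))\<^sup>2)"
proof -
  have "(f (i, j) - f (i', j))\<^sup>2 \<le> of_int \<bar>i - i'\<bar> * (\<Sum>k\<in>{p..q}. (f (k + 1, j) - f (k, j))\<^sup>2)"
    using diff_square_le_sum_interval[of i p q i' "\<lambda>k. f (k, j)"] assms by simp
  also have "\<dots> \<le> of_int n * (\<Sum>k\<in>{p..q}. (f (k + 1, j) - f (k, j))\<^sup>2)"
    using assms by (intro mult_right_mono sum_nonneg) auto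
  finally show ?thesis .
qed

lemma rectangle_column_le:
  fixes f :: "int \<times> int \<Rightarrow> real"
  assumes "j \<in> {r..s}" "j' \<in> {r..s}" "s - r + 1 \<le> n"
  shows "(f (i, j) - f (i, j'))\<^sup>2 \<le> of_int n * (\<Sum>k\<in>{r..s}. (f (i, k + 1) - f (i, k))\<^sup>2)"
proof -
  have "(f (i, j) - f (i, j'))\<^sup>2 \<le> of_int \<bar>j - j'\<bar> * (\<Sum>k\<in>{r..s}. (f (i, k + 1) - f (i, k))\<^sup>2)"
    using diff_square_le_sum_interval[of j r s j' "\<lambda>k. f (i, k)"] assms by simp
  also have "\<dots> \<le> of_int n * (\<Sum>k\<in>{r..s}. (f (i, k + 1) - f (i, k))\<^sup>2)"
    using assms by (intro mult_right_mono sum_nonneg) auto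
  finally show ?thesis .
qed

text \<open>Two points are joined along a row and then a column. Summing over all pairs bounds the
  average over \<open>y\<close> of the sums of \<open>(f z - f y)\<^sup>2\<close>, so some
  \<open>y\<close> does no worse than the average and \<open>c = f y\<close> serves in place of the
  mean.\<close>

lemma rectangle_poincare:
  fixes f :: "int \<times> int \<Rightarrow> real"
  assumes "p \<le> q" "r \<le> s" "q - p + 1 \<le> n" "s - r + 1 \<le> n"
  shows "\<exists>c. (\<Sum>z\<in>{p..q}\<times>{r..s}. (f z - c)\<^sup>2) \<le> 2 * (of_int n)\<^sup>2 * (\<Sum>z\<in>{p..q}\<times>{r..s}. gsq f z)"
proof -
  define I where "I = {p..q}"
  define J where "J = {r..s}"
  define N where "N = (of_int n :: real)"
  define X where "X = (\<Sum>i\<in>I. \<Sum>j\<in>J. (f (i + 1, j) - f (i, j))\<^sup>2)"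
  define Y where "Y = (\<Sum>i\<in>I. \<Sum>j\<in>J. (f (i, j + 1) - f (i, j))\<^sup>2)"
  have fin: "finite I" "finite J" by (auto simp: I_def J_def)
  have ne: "card I > 0" "card J > 0" using assms by (auto simp: I_def J_def)
  have cI: "real (card I) \<le> N" "real (card J) \<le> N" "0 \<le> N"
    using assms by (auto simp: I_def J_def N_def)
  have XY: "X \<ge> 0" "Y \<ge> 0" by (auto simp: X_def Y_def intro!: sum_nonneg)
  have E: "(\<Sum>z\<in>I\<times>J. gsq f z) = X + Y"
    by (simp add: gsq_def X_def Y_def sum.cartesian_product' sum.distrib)
  have pt: "(f (i, j) - f (i', j'))\<^sup>2 \<le>
      2 * (N * (\<Sum>k\<in>I. (f (k + 1, j) - f (k, j))\<^sup>2)) + 2 * (N * (\<Sum>k\<in>J. (f (i', k + 1) - f (i', k))\<^sup>2))"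
    if "i \<in> I" "j \<in> J" "i' \<in> I" "j' \<in> J" for i j i' j'
  proof -
    have "(f (i, j) - f (i', j'))\<^sup>2 \<le> 2 * (f (i, j) - f (i', j))\<^sup>2 + 2 * (f (i', j) - f (i', j'))\<^sup>2"
      using zero_le_power2[of "(f (i, j) - f (i', j)) - (f (i', j) - f (i', j'))"]
      by (simp add: power2_eq_square algebra_simps)
    then show ?thesis
      using rectangle_row_le[of i p q i' j r s n f] rectangle_column_le[of j r s j' n f i'] that assms
      unfolding I_def J_def N_def by fastforce
  qed
  have "(\<Sum>i'\<in>I. \<Sum>j'\<in>J. \<Sum>i\<in>I. \<Sum>j\<in>J. (f (i, j) - f (i', j'))\<^sup>2) \<le>
     (\<Sum>i'\<in>I. \<Sum>j'\<in>J. \<Sum>i\<in>I. \<Sum>j\<in>J.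
      2 * (N * (\<Sum>k\<in>I. (f (k + 1, j) - f (k, j))\<^sup>2)) + 2 * (N * (\<Sum>k\<in>J. (f (i', k + 1) - f (i', k))\<^sup>2)))"
    by (intro sum_mono pt) auto
  also have "\<dots> = 2 * N * card I * (card I * card J) * X + 2 * N * card J * (card I * card J) * Y"
  proof -
    have X': "X = (\<Sum>j\<in>J. \<Sum>i\<in>I. (f (i + 1, j) - f (i, j))\<^sup>2)"
      unfolding X_def by (rule sum.swap)
    show ?thesis
      unfolding X' Y_def by (simp add: sum.distrib sum_distrib_left sum_distrib_right algebra_simps)
  qed
  also have "\<dots> \<le> 2 * N * N * (card I * card J) * X + 2 * N * N * (card I * card J) * Y"
    using cI XY by (intro add_mono mult_right_mono mult_left_mono) auto
  also have "\<dots> = (card I * card J) * (2 * N\<^sup>2 * (X + Y))"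
    by (simp add: power2_eq_square algebra_simps)
  finally have tot: "(\<Sum>y\<in>I\<times>J. \<Sum>z\<in>I\<times>J. (f z - f y)\<^sup>2) \<le> (card I * card J) * (2 * N\<^sup>2 * (X + Y))"
    by (simp add: sum.cartesian_product')
  have "\<exists>y\<in>I\<times>J. (\<Sum>z\<in>I\<times>J. (f z - f y)\<^sup>2) \<le> 2 * N\<^sup>2 * (X + Y)"
  proof (rule ccontr)
    assume "\<not> ?thesis"
    then have "(\<Sum>y\<in>I\<times>J. 2 * N\<^sup>2 * (X + Y)) < (\<Sum>y\<in>I\<times>J. \<Sum>z\<in>I\<times>J. (f z - f y)\<^sup>2)"
      using ne fin by (intro sum_strict_mono) (auto simp: card_gt_0_iff not_le)
    with tot show False by (simp add: card_cartesian_product)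
  qed
  then show ?thesis
    using E unfolding I_def J_def N_def by auto
qed

text \<open>The constants \<open>c\<close> and \<open>d\<close> are compared on the overlap, where
  both are good: \<open>card (S \<inter> T) * (c - d)\<^sup>2 \<le> 2 * P + 2 * Q\<close>. Replacing
  \<open>d\<close> by \<open>c\<close> on all of \<open>T\<close> multiplies this by at most 2 * 4,
  which gives 16 * P + 18 * Q on \<open>T\<close>.\<close>

lemma poincare_union:
  fixes f :: "'a \<Rightarrow> real"
  assumes "finite S" "finite T"
    and S: "(\<Sum>z\<in>S. (f z - c)\<^sup>2) \<le> P" and T: "(\<Sum>z\<in>T. (f z - d)\<^sup>2) \<le> Q"
    and card: "real (card T) \<le> 4 * real (card (S \<inter> T))"
  shows "(\<Sum>z\<in>S \<union> T. (f z - c)\<^sup>2) \<le> 17 * P + 18 * Q"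
proof -
  have sq: "(x - c)\<^sup>2 \<le> 2 * (x - d)\<^sup>2 + 2 * (c - d)\<^sup>2" "(c - d)\<^sup>2 \<le> 2 * (x - c)\<^sup>2 + 2 * (x - d)\<^sup>2" for x
    using zero_le_power2[of "(x - d) + (c - d)"] zero_le_power2[of "(x - c) + (x - d)"]
    by (simp_all add: power2_eq_square algebra_simps)
  have "card (S \<inter> T) * (c - d)\<^sup>2 = (\<Sum>z\<in>S \<inter> T. (c - d)\<^sup>2)" by simp
  also have "\<dots> \<le> (\<Sum>z\<in>S \<inter> T. 2 * (f z - c)\<^sup>2 + 2 * (f z - d)\<^sup>2)"
    by (intro sum_mono sq)
  also have "\<dots> = 2 * (\<Sum>z\<in>S \<inter> T. (f z - c)\<^sup>2) + 2 * (\<Sum>z\<in>S \<inter> T. (f z - d)\<^sup>2)"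
    by (simp add: sum.distrib sum_distrib_left)
  also have "\<dots> \<le> 2 * (\<Sum>z\<in>S. (f z - c)\<^sup>2) + 2 * (\<Sum>z\<in>T. (f z - d)\<^sup>2)"
    using assms by (intro add_mono mult_left_mono sum_mono2) auto
  finally have cd: "card (S \<inter> T) * (c - d)\<^sup>2 \<le> 2 * P + 2 * Q" using S T by linarith
  have "(\<Sum>z\<in>T. (f z - c)\<^sup>2) \<le> (\<Sum>z\<in>T. 2 * (f z - d)\<^sup>2 + 2 * (c - d)\<^sup>2)"
    by (intro sum_mono sq)
  also have "\<dots> = 2 * (\<Sum>z\<in>T. (f z - d)\<^sup>2) + 2 * (card T * (c - d)\<^sup>2)"
    by (simp add: sum.distrib sum_distrib_left)
  also have "card T * (c - d)\<^sup>2 \<le> 4 * card (S \<inter> T) * (c - d)\<^sup>2"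
    using card by (intro mult_right_mono) auto
  also have "2 * (\<Sum>z\<in>T. (f z - d)\<^sup>2) + 2 * (4 * card (S \<inter> T) * (c - d)\<^sup>2) \<le> 2 * Q + 8 * (2 * P + 2 * Q)"
    using T cd by simp
  finally have "(\<Sum>z\<in>T. (f z - c)\<^sup>2) \<le> 16 * P + 18 * Q" by simp
  moreover have "(\<Sum>z\<in>S \<union> T. (f z - c)\<^sup>2) \<le> (\<Sum>z\<in>S. (f z - c)\<^sup>2) + (\<Sum>z\<in>T. (f z - c)\<^sup>2)"
    using assms by (simp add: sum_nonneg sum_Un)
  ultimately show ?thesis using S by linarith
qed

text \<open>The maximum norm makes an annulus a union of four rectangles. For \<open>a = 0\<close>
  it is a full square.\<close>

definition annulus :: "int \<Rightarrow> int \<Rightarrow> (int \<times> int) set" where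
  "annulus a b = {z. a \<le> max \<bar>fst z\<bar> \<bar>snd z\<bar> \<and> max \<bar>fst z\<bar> \<bar>snd z\<bar> \<le> b}"

lemma finite_annulus [simp]: "finite (annulus a b)"
  by (rule finite_subset[of _ "{-b..b} \<times> {-b..b}"]) (auto simp: annulus_def)

text \<open>Four overlapping rectangles go around the annulus; \<open>poincare_union\<close> glues
  them one after the other across the corner squares.\<close>

lemma annulus_poincare:
  fixes f :: "int \<times> int \<Rightarrow> real"
  assumes "0 \<le> a" "2 * a \<le> b"
  shows "\<exists>c. (\<Sum>z\<in>annulus a b. (f z - c)\<^sup>2) \<le> 90000 * (of_int (b + 1))\<^sup>2 * (\<Sum>z\<in>annulus a b. gsq f z)"
proof -
  define R1 where "R1 = {a..b} \<times> {-b..b}"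
  define R2 where "R2 = {-b..b} \<times> {a..b}"
  define R3 where "R3 = {-b..-a} \<times> {-b..b}"
  define R4 where "R4 = {-b..b} \<times> {-b..-a}"
  define E where "E = (\<Sum>z\<in>annulus a b. gsq f z)"
  define n where "n = 2 * b + 1"
  define P where "P = 2 * (of_int n)\<^sup>2 * E"
  have P: "P \<ge> 0" by (simp add: P_def E_def sum_nonneg)
  have un: "annulus a b = R1 \<union> R2 \<union> R3 \<union> R4"
  proof (rule set_eqI)
    fix z :: "int \<times> int"
    obtain i j where z: "z = (i, j)" by (cases z)
    have "(a \<le> \<bar>i\<bar> \<or> a \<le> \<bar>j\<bar>) \<and> \<bar>i\<bar> \<le> b \<and> \<bar>j\<bar> \<le> b \<longleftrightarrow>
      (-b \<le> i \<and> i \<le> b \<and> -b \<le> j \<and> j \<le> b) \<and> (a \<le> i \<or> a \<le> j \<or> i \<le> -a \<or> j \<le> -a)"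
      using assms unfolding abs_le_iff le_minus_iff abs_if by auto
    then show "z \<in> annulus a b \<longleftrightarrow> z \<in> R1 \<union> R2 \<union> R3 \<union> R4"
      using assms unfolding z annulus_def R1_def R2_def R3_def R4_def by (auto simp: le_max_iff_disj)
  qed
  have sub: "\<And>R. R \<subseteq> annulus a b \<Longrightarrow> 2 * (of_int n)\<^sup>2 * (\<Sum>z\<in>R. gsq f z) \<le> P"
    unfolding P_def E_def by (intro mult_left_mono sum_mono2) auto
  have rect: "\<exists>c. (\<Sum>z\<in>R. (f z - c)\<^sup>2) \<le> P"
    if "R = {p..q} \<times> {r..s}" "p \<le> q" "r \<le> s" "q - p + 1 \<le> n" "s - r + 1 \<le> n" "R \<subseteq> annulus a b"
    for R p q r s
    using rectangle_poincare[OF that(2-5), of f] sub[OF that(6)] order_trans unfolding that(1) by blast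
  obtain c1 where c1: "(\<Sum>z\<in>R1. (f z - c1)\<^sup>2) \<le> P"
    using rect[OF R1_def] assms un n_def by auto
  obtain c2 where c2: "(\<Sum>z\<in>R2. (f z - c2)\<^sup>2) \<le> P"
    using rect[OF R2_def] assms un n_def by auto
  obtain c3 where c3: "(\<Sum>z\<in>R3. (f z - c3)\<^sup>2) \<le> P"
    using rect[OF R3_def] assms un n_def by auto
  obtain c4 where c4: "(\<Sum>z\<in>R4. (f z - c4)\<^sup>2) \<le> P"
    using rect[OF R4_def] assms un n_def by auto
  have fin: "finite R1" "finite R2" "finite R3" "finite R4"
    by (auto simp: R1_def R2_def R3_def R4_def)
  \<comment> \<open>The side of the corner squares. By \<open>2 * a \<le> b\<close> it is at least a
    quarter of \<open>n\<close>, the ratio that \<open>poincare_union\<close> asks for.\<close>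
  define l where "l = real_of_int (b - a + 1)"
  have l: "l > 0" "real_of_int n \<le> 4 * l"
    using assms by (auto simp: l_def n_def)
  have cR: "real (card R2) = of_int n * l" "real (card R3) = of_int n * l" "real (card R4) = of_int n * l"
    using assms by (auto simp: R2_def R3_def R4_def card_cartesian_product n_def l_def)
  have sq: "real (card ({p..q} \<times> {r..s})) = l * l" if "q - p = b - a" "s - r = b - a" for p q r s :: int
    using that assms by (simp add: card_cartesian_product l_def)
  have inter: "l * l \<le> card (R1 \<inter> R2)" "l * l \<le> card ((R1 \<union> R2) \<inter> R3)" "l * l \<le> card ((R1 \<union> R2 \<union> R3) \<inter> R4)"
  proof -
    have "card ({a..b} \<times> {a..b}) \<le> card (R1 \<inter> R2)"
      by (rule card_mono) (use fin assms in \<open>auto simp: R1_def R2_def\<close>)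
    then show "l * l \<le> card (R1 \<inter> R2)" using sq[of b a b a] by (metis diff_minus_eq_add minus_diff_eq uminus_add_conv_diff add.commute of_nat_mono)
    have "card ({-b..-a} \<times> {a..b}) \<le> card ((R1 \<union> R2) \<inter> R3)"
      by (rule card_mono) (use fin assms in \<open>auto simp: R2_def R3_def\<close>)
    then show "l * l \<le> card ((R1 \<union> R2) \<inter> R3)" using sq[of "-a" "-b" b a] by (metis diff_minus_eq_add minus_diff_eq uminus_add_conv_diff add.commute of_nat_mono)
    have "card ({-b..-a} \<times> {-b..-a}) \<le> card ((R1 \<union> R2 \<union> R3) \<inter> R4)"
      by (rule card_mono) (use fin assms in \<open>auto simp: R3_def R4_def\<close>)
    then show "l * l \<le> card ((R1 \<union> R2 \<union> R3) \<inter> R4)" using sq[of "-a" "-b" "-a" "-b"] by (metis diff_minus_eq_add minus_diff_eq uminus_add_conv_diff add.commute of_nat_mono)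
  qed
  have nl: "of_int n * l \<le> 4 * (l * l)" using l by (simp add: mult_right_mono mult.assoc[symmetric])
  have "(\<Sum>z\<in>R1 \<union> R2. (f z - c1)\<^sup>2) \<le> 17 * P + 18 * P"
    by (rule poincare_union) (use fin c1 c2 inter cR nl in auto)
  then have "(\<Sum>z\<in>R1 \<union> R2 \<union> R3. (f z - c1)\<^sup>2) \<le> 17 * (17 * P + 18 * P) + 18 * P"
    by (rule poincare_union[rotated 2]) (use fin c3 inter cR nl in auto)
  then have "(\<Sum>z\<in>R1 \<union> R2 \<union> R3 \<union> R4. (f z - c1)\<^sup>2) \<le> 17 * (17 * (17 * P + 18 * P) + 18 * P) + 18 * P"
    by (rule poincare_union[rotated 2]) (use fin c4 inter cR nl in auto)
  \<comment> \<open>17 * (17 * 35 + 18) + 18 = 10439, doubled by the factor 2 in \<open>P\<close>;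
    passing from \<open>n\<close> to \<open>2 * (b + 1)\<close> below multiplies by 4.\<close>
  also have "\<dots> = 20878 * ((of_int n)\<^sup>2 * E)" by (simp add: P_def)
  also have "(of_int n :: real)\<^sup>2 * E \<le> (2 * of_int (b + 1))\<^sup>2 * E"
    using assms by (intro mult_right_mono power_mono) (auto simp: n_def E_def sum_nonneg)
  also have "20878 * ((2 * of_int (b + 1))\<^sup>2 * E) \<le> 90000 * (of_int (b + 1))\<^sup>2 * E"
    by (simp only: power_mult_distrib, simp add: E_def sum_nonneg mult_right_mono algebra_simps)
  finally show ?thesis unfolding un[symmetric] E_def by auto
qed

section \<open>The logarithm on the grid and duality\<close>

definition gip :: "(int \<times> int \<Rightarrow> real) \<Rightarrow> (int \<times> int \<Rightarrow> real) \<Rightarrow> int \<times> int \<Rightarrow> real" where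
  "gip f g z = (f (fst z + 1, snd z) - f z) * (g (fst z + 1, snd z) - g z) +
     (f (fst z, snd z + 1) - f z) * (g (fst z, snd z + 1) - g z)"

definition lap :: "(int \<times> int \<Rightarrow> real) \<Rightarrow> int \<times> int \<Rightarrow> real" where
  "lap f z = f (fst z + 1, snd z) + f (fst z - 1, snd z) + f (fst z, snd z + 1) + f (fst z, snd z - 1) - 4 * f z"

definition gbox :: "int \<Rightarrow> (int \<times> int) set" where
  "gbox n = {-n..n} \<times> {-n..n}"

text \<open>The summand 1 removes the singularity: \<open>lam\<close> is nonnegative, vanishes at
  the origin, and away from it differs from the logarithm of the Euclidean norm by a bounded
  amount.\<close>

definition ssq :: "int \<times> int \<Rightarrow> real" where
  "ssq z = 1 + (of_int (fst z))\<^sup>2 + (of_int (snd z))\<^sup>2"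

definition lam :: "int \<times> int \<Rightarrow> real" where
  "lam z = ln (ssq z) / 2"

section \<open>Dirichlet form of the grid and summation by parts\<close>

lemma finite_gbox [simp]: "finite (gbox n)"
  by (simp add: gbox_def)

lemma gip_self: "gip f f z = gsq f z"
  by (simp add: gip_def gsq_def power2_eq_square)

lemma gip_le: "\<bar>gip f g z\<bar> \<le> sqrt (gsq f z) * sqrt (gsq g z)"
proof -
  have "(a * c + b * d)\<^sup>2 \<le> (a\<^sup>2 + b\<^sup>2) * (c\<^sup>2 + d\<^sup>2)" for a b c d :: real
    using zero_le_power2[of "a * d - b * c"] by (simp add: power2_eq_square algebra_simps)
  then have "(gip f g z)\<^sup>2 \<le> gsq f z * gsq g z"
    unfolding gip_def gsq_def .
  then show ?thesis by (metis real_sqrt_abs real_sqrt_le_mono real_sqrt_mult)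
qed

lemma sum_sqrt_mult_le:
  assumes "\<And>x. x \<in> A \<Longrightarrow> 0 \<le> f x" "\<And>x. x \<in> A \<Longrightarrow> 0 \<le> g x"
  shows "(\<Sum>x\<in>A. sqrt (f x) * sqrt (g x)) \<le> sqrt (\<Sum>x\<in>A. f x) * sqrt (\<Sum>x\<in>A. g x)"
proof -
  have "(\<Sum>x\<in>A. \<bar>sqrt (f x)\<bar> * \<bar>sqrt (g x)\<bar>) \<le> L2_set (\<lambda>x. sqrt (f x)) A * L2_set (\<lambda>x. sqrt (g x)) A"
    by (rule L2_set_mult_ineq)
  moreover have "(\<Sum>x\<in>A. \<bar>sqrt (f x)\<bar> * \<bar>sqrt (g x)\<bar>) = (\<Sum>x\<in>A. sqrt (f x) * sqrt (g x))"
    "(\<Sum>x\<in>A. (sqrt (f x))\<^sup>2) = (\<Sum>x\<in>A. f x)" "(\<Sum>x\<in>A. (sqrt (g x))\<^sup>2) = (\<Sum>x\<in>A. g x)"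
    using assms by (auto intro!: sum.cong)
  ultimately show ?thesis by (simp add: L2_set_def)
qed

lemma sum_gip_le: "\<bar>\<Sum>z\<in>X. gip f g z\<bar> \<le> sqrt (\<Sum>z\<in>X. gsq f z) * sqrt (\<Sum>z\<in>X. gsq g z)"
proof -
  have "\<bar>\<Sum>z\<in>X. gip f g z\<bar> \<le> (\<Sum>z\<in>X. sqrt (gsq f z) * sqrt (gsq g z))"
    by (rule order_trans[OF sum_abs]) (intro sum_mono gip_le)
  also have "\<dots> \<le> sqrt (\<Sum>z\<in>X. gsq f z) * sqrt (\<Sum>z\<in>X. gsq g z)"
    by (rule sum_sqrt_mult_le) auto
  finally show ?thesis .
qed

lemma sum_shift_int:
  fixes H :: "int \<Rightarrow> real"
  assumes "H (- N) = 0" "H (N + 1) = 0"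
  shows "(\<Sum>k\<in>{-N..N}. H (k + 1)) = (\<Sum>k\<in>{-N..N}. H k)"
proof -
  have "(\<Sum>k\<in>{-N..N}. H (k + 1)) = (\<Sum>k\<in>{-N+1..N+1}. H k)"
    by (rule sum.reindex_bij_witness[of _ "\<lambda>k. k - 1" "\<lambda>k. k + 1"]) auto
  also have "\<dots> = (\<Sum>k\<in>{-N+1..N}. H k)"
    by (rule sum.mono_neutral_right) (use assms in \<open>auto simp: order_le_less\<close>)
  also have "\<dots> = (\<Sum>k\<in>{-N..N}. H k)"
    by (rule sum.mono_neutral_left) (use assms in \<open>auto simp: order_le_less\<close>)
  finally show ?thesis .
qed

lemma summation_by_parts:
  fixes f g :: "int \<Rightarrow> real"
  assumes "f (- N) = 0" "f (N + 1) = 0"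
  shows "(\<Sum>k\<in>{-N..N}. (f (k + 1) - f k) * (g (k + 1) - g k)) = - (\<Sum>k\<in>{-N..N}. f k * (g (k + 1) + g (k - 1) - 2 * g k))"
  using sum_shift_int[of "\<lambda>k. f k * (g k - g (k - 1))" N] assms
  by (simp add: algebra_simps sum.distrib sum_subtractf sum_negf sum_distrib_left)

text \<open>The box is larger by one on account of the forward differences at
  \<open>- M - 1\<close>, which already see \<open>f\<close> at \<open>- M\<close>; beyond it every
  summand vanishes.\<close>

lemma sum_gip_eq_lap:
  assumes "\<And>z. z \<notin> gbox M \<Longrightarrow> f z = 0" "M \<ge> 0"
  shows "(\<Sum>z\<in>gbox (M + 1). gip f g z) = - (\<Sum>z\<in>gbox (M + 1). f z * lap g z)"
proof -
  define N where "N = M + 1"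
  define I where "I = {-N..N}"
  have z: "f (-N, j) = 0" "f (N + 1, j) = 0" "f (j, -N) = 0" "f (j, N + 1) = 0" for j
    using assms by (auto simp: N_def gbox_def)
  define p q where "p i j = f (i, j) * (g (i + 1, j) + g (i - 1, j) - 2 * g (i, j))"
    and "q i j = f (i, j) * (g (i, j + 1) + g (i, j - 1) - 2 * g (i, j))" for i j
  have 1: "(\<Sum>i\<in>I. (f (i + 1, j) - f (i, j)) * (g (i + 1, j) - g (i, j))) = - (\<Sum>i\<in>I. p i j)" for j
    using summation_by_parts[of "\<lambda>i. f (i, j)" N "\<lambda>i. g (i, j)"] z by (simp add: I_def p_def)
  have 2: "(\<Sum>j\<in>I. (f (i, j + 1) - f (i, j)) * (g (i, j + 1) - g (i, j))) = - (\<Sum>j\<in>I. q i j)" for i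
    using summation_by_parts[of "\<lambda>j. f (i, j)" N "\<lambda>j. g (i, j)"] z by (simp add: I_def q_def)
  have "(\<Sum>z\<in>gbox N. gip f g z) =
      (\<Sum>i\<in>I. \<Sum>j\<in>I. (f (i + 1, j) - f (i, j)) * (g (i + 1, j) - g (i, j))) +
      (\<Sum>i\<in>I. \<Sum>j\<in>I. (f (i, j + 1) - f (i, j)) * (g (i, j + 1) - g (i, j)))"
    unfolding gip_def gbox_def I_def[symmetric] sum.cartesian_product' sum.distrib by simp
  also have "(\<Sum>i\<in>I. \<Sum>j\<in>I. (f (i + 1, j) - f (i, j)) * (g (i + 1, j) - g (i, j))) =
      (\<Sum>j\<in>I. \<Sum>i\<in>I. (f (i + 1, j) - f (i, j)) * (g (i + 1, j) - g (i, j)))"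
    by (rule sum.swap)
  also have "\<dots> = - (\<Sum>j\<in>I. \<Sum>i\<in>I. p i j)" by (simp only: 1 sum_negf)
  also have "(\<Sum>j\<in>I. \<Sum>i\<in>I. p i j) = (\<Sum>i\<in>I. \<Sum>j\<in>I. p i j)" by (rule sum.swap)
  also have "- (\<Sum>i\<in>I. \<Sum>j\<in>I. p i j) +
      (\<Sum>i\<in>I. \<Sum>j\<in>I. (f (i, j + 1) - f (i, j)) * (g (i, j + 1) - g (i, j))) =
      - (\<Sum>i\<in>I. \<Sum>j\<in>I. p i j + q i j)"
    by (simp only: 2 sum_negf sum.distrib)
  also have "\<dots> = - (\<Sum>z\<in>gbox N. f z * lap g z)"
    unfolding gbox_def I_def[symmetric] sum.cartesian_product'
    by (simp add: lap_def p_def q_def algebra_simps)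
  finally show ?thesis by (simp add: N_def)
qed

text \<open>One-dimensional Cauchy-Schwarz along a row and a column. The bound grows with the
  distance, as the energy alone gives no uniform one in dimension two, but it will be summed against
  \<open>lap lam\<close>, which decays like the fourth power of the distance.\<close>

lemma grid_diff_le:
  assumes "z \<in> gbox N" "z' \<in> gbox N"
  shows "\<bar>f z - f z'\<bar> \<le> (sqrt \<bar>of_int (fst z - fst z')\<bar> + sqrt \<bar>of_int (snd z - snd z')\<bar>) * sqrt (\<Sum>z\<in>gbox N. gsq f z)"
proof -
  obtain i j i' j' where z: "z = (i, j)" "z' = (i', j')" by (cases z, cases z')
  have ij: "i \<in> {-N..N}" "j \<in> {-N..N}" "i' \<in> {-N..N}" "j' \<in> {-N..N}"
    using assms by (auto simp: z gbox_def)
  define E where "E = (\<Sum>z\<in>gbox N. gsq f z)"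
  have "(\<Sum>k\<in>{-N..N}. (f (k + 1, j) - f (k, j))\<^sup>2) \<le> (\<Sum>k\<in>{-N..N}. gsq f (k, j))"
    by (intro sum_mono) (simp add: gsq_def)
  also have "\<dots> = (\<Sum>z\<in>(\<lambda>k. (k, j)) ` {-N..N}. gsq f z)"
    by (subst sum.reindex) (auto simp: inj_on_def)
  also have "\<dots> \<le> E" unfolding E_def
    using ij by (intro sum_mono2) (auto simp: gbox_def)
  finally have 1: "(\<Sum>k\<in>{-N..N}. (f (k + 1, j) - f (k, j))\<^sup>2) \<le> E" .
  have "(\<Sum>k\<in>{-N..N}. (f (i', k + 1) - f (i', k))\<^sup>2) \<le> (\<Sum>k\<in>{-N..N}. gsq f (i', k))"
    by (intro sum_mono) (simp add: gsq_def)
  also have "\<dots> = (\<Sum>z\<in>(\<lambda>k. (i', k)) ` {-N..N}. gsq f z)"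
    by (subst sum.reindex) (auto simp: inj_on_def)
  also have "\<dots> \<le> E" unfolding E_def
    using ij by (intro sum_mono2) (auto simp: gbox_def)
  finally have 2: "(\<Sum>k\<in>{-N..N}. (f (i', k + 1) - f (i', k))\<^sup>2) \<le> E" .
  have "(f (i, j) - f (i', j))\<^sup>2 \<le> of_int \<bar>i - i'\<bar> * (\<Sum>k\<in>{-N..N}. (f (k + 1, j) - f (k, j))\<^sup>2)"
    using diff_square_le_sum_interval[of i "-N" N i' "\<lambda>k. f (k, j)"] ij by simp
  also have "\<dots> \<le> \<bar>of_int (i - i')\<bar> * E" using 1 by (simp add: mult_left_mono)
  finally have a: "\<bar>f (i, j) - f (i', j)\<bar> \<le> sqrt \<bar>of_int (i - i')\<bar> * sqrt E"
    by (metis real_sqrt_abs real_sqrt_le_mono real_sqrt_mult)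
  have "(f (i', j) - f (i', j'))\<^sup>2 \<le> of_int \<bar>j - j'\<bar> * (\<Sum>k\<in>{-N..N}. (f (i', k + 1) - f (i', k))\<^sup>2)"
    using diff_square_le_sum_interval[of j "-N" N j' "\<lambda>k. f (i', k)"] ij by simp
  also have "\<dots> \<le> \<bar>of_int (j - j')\<bar> * E" using 2 by (simp add: mult_left_mono)
  finally have b: "\<bar>f (i', j) - f (i', j')\<bar> \<le> sqrt \<bar>of_int (j - j')\<bar> * sqrt E"
    by (metis real_sqrt_abs real_sqrt_le_mono real_sqrt_mult)
  from a b show ?thesis unfolding z E_def[symmetric] fst_conv snd_conv distrib_right
    by linarith
qed

section \<open>The regularised logarithm\<close>

lemma ssq_ge_1: "ssq z \<ge> 1"
  by (simp add: ssq_def)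

lemma ssq_pos [simp]: "ssq z > 0"
  using ssq_ge_1[of z] by linarith

lemma lam_nonneg [simp]: "lam z \<ge> 0"
  using ssq_ge_1[of z] by (simp add: lam_def)

lemma exp_lam: "exp (lam z) = sqrt (ssq z)"
proof -
  have "(exp (lam z))\<^sup>2 = ssq z"
    by (simp add: lam_def power2_eq_square mult_exp_exp)
  then show ?thesis by (metis exp_ge_zero real_sqrt_unique)
qed

text \<open>The values of \<open>ssq\<close> at the four neighbours are s + 1 + 2a, s + 1 - 2a, s +
  1 + 2b and s + 1 - 2b. In their product the cubic terms in s cancel, which reflects the
  harmonicity of the logarithm, and the rest is of order s^-2 relative to s^4.\<close>

lemma lap_lam:
  fixes z
  defines "a \<equiv> of_int (fst z)" and "b \<equiv> of_int (snd z)" and "s \<equiv> ssq z"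
  shows "lap lam z = ln (1 + (2 * s\<^sup>2 + 8 * s + 5 + 16 * a\<^sup>2 * b\<^sup>2) / s ^ 4) / 2"
proof -
  have s: "s = 1 + a\<^sup>2 + b\<^sup>2" by (simp add: s_def a_def b_def ssq_def)
  have spos: "s > 0" by (simp add: s_def)
  have e: "ssq (fst z + 1, snd z) = s + 1 + 2 * a" "ssq (fst z - 1, snd z) = s + 1 - 2 * a"
    "ssq (fst z, snd z + 1) = s + 1 + 2 * b" "ssq (fst z, snd z - 1) = s + 1 - 2 * b"
    by (simp_all add: ssq_def s a_def b_def power2_eq_square algebra_simps)
  note p = ssq_pos[of "(fst z + 1, snd z)", unfolded e] ssq_pos[of "(fst z - 1, snd z)", unfolded e]
    ssq_pos[of "(fst z, snd z + 1)", unfolded e] ssq_pos[of "(fst z, snd z - 1)", unfolded e]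
  have id: "(s + 1 + 2 * a) * (s + 1 - 2 * a) * ((s + 1 + 2 * b) * (s + 1 - 2 * b)) =
      s ^ 4 * (1 + (2 * s\<^sup>2 + 8 * s + 5 + 16 * a\<^sup>2 * b\<^sup>2) / s ^ 4)"
  proof -
    have "(s + 1 + 2 * a) * (s + 1 - 2 * a) * ((s + 1 + 2 * b) * (s + 1 - 2 * b)) =
      s ^ 4 + (2 * s\<^sup>2 + 8 * s + 5 + 16 * a\<^sup>2 * b\<^sup>2)"
      unfolding s by algebra
    then show ?thesis using spos by (simp add: field_simps)
  qed
  have pos: "1 + (2 * s\<^sup>2 + 8 * s + 5 + 16 * a\<^sup>2 * b\<^sup>2) / s ^ 4 > 0"
    using spos by (intro add_pos_nonneg divide_nonneg_pos) auto
  have "ln (s + 1 + 2 * a) + ln (s + 1 - 2 * a) + (ln (s + 1 + 2 * b) + ln (s + 1 - 2 * b)) =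
      ln ((s + 1 + 2 * a) * (s + 1 - 2 * a) * ((s + 1 + 2 * b) * (s + 1 - 2 * b)))"
    using p by (simp add: ln_mult_pos)
  also have "\<dots> = 4 * ln s + ln (1 + (2 * s\<^sup>2 + 8 * s + 5 + 16 * a\<^sup>2 * b\<^sup>2) / s ^ 4)"
    unfolding id using pos spos by (simp add: ln_mult_pos ln_realpow)
  finally show ?thesis
    unfolding lap_def lam_def e s_def[symmetric] by (simp add: field_simps)
qed

lemma lap_lam_nonneg: "lap lam z \<ge> 0"
proof -
  have "0 \<le> (2 * (ssq z)\<^sup>2 + 8 * ssq z + 5 + 16 * (of_int (fst z))\<^sup>2 * (of_int (snd z))\<^sup>2) / ssq z ^ 4"
    using ssq_ge_1[of z] by simp
  then show ?thesis unfolding lap_lam by simp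
qed

lemma lap_lam_le: "lap lam z \<le> 8 / (ssq z)\<^sup>2"
proof -
  define a b s where "a = real_of_int (fst z)" and "b = real_of_int (snd z)" and "s = ssq z"
  have s1: "s \<ge> 1" by (simp add: s_def ssq_ge_1)
  have "4 * (a\<^sup>2 * b\<^sup>2) \<le> (a\<^sup>2 + b\<^sup>2)\<^sup>2"
    using zero_le_power2[of "a\<^sup>2 - b\<^sup>2"] by (simp add: power2_eq_square algebra_simps)
  also have "a\<^sup>2 + b\<^sup>2 = s - 1" by (simp add: s_def ssq_def a_def b_def)
  finally have ab: "16 * a\<^sup>2 * b\<^sup>2 \<le> 4 * (s - 1)\<^sup>2" by simp
  have s2: "s\<^sup>2 \<ge> 1" using s1 by simp
  have "ln (1 + (2 * s\<^sup>2 + 8 * s + 5 + 16 * a\<^sup>2 * b\<^sup>2) / s ^ 4) \<le> (2 * s\<^sup>2 + 8 * s + 5 + 16 * a\<^sup>2 * b\<^sup>2) / s ^ 4"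
    using s1 by (intro ln_add_one_self_le_self divide_nonneg_pos) auto
  also have "\<dots> \<le> 16 * s\<^sup>2 / s ^ 4"
    using ab s1 s2 by (intro divide_right_mono) (auto simp: power2_eq_square algebra_simps)
  also have "\<dots> = 16 / s\<^sup>2"
    using s1 by (simp add: power4_eq_xxxx power2_eq_square)
  finally show ?thesis unfolding lap_lam a_def[symmetric] b_def[symmetric] s_def[symmetric] by simp
qed

text \<open>At the origin s = 1 and the formula gives ln 16 / 2. With \<open>lap_lam_nonneg\<close>,
  the total mass of \<open>lap lam\<close> over any set containing the origin is at least one, which
  normalises the point evaluation in \<open>green_point_bound\<close>.\<close>

lemma lap_lam_zero: "lap lam (0, 0) \<ge> 1"
proof -
  have "exp (2 :: real) \<le> 16"
  proof -
    have "exp (2::real) = exp 1 * exp 1" by (simp add: mult_exp_exp)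
    also have "\<dots> \<le> 3 * 3" using exp_le by (intro mult_mono) auto
    finally show ?thesis by simp
  qed
  then have "2 \<le> ln (16 :: real)" by (simp add: ln_ge_iff)
  then show ?thesis unfolding lap_lam by (simp add: ssq_def)
qed

text \<open>Three is the largest offset per coordinate between the grid points of adjacent cells,
  see \<open>grid_near\<close>.\<close>

lemma ssq_shift_le:
  assumes "\<bar>fst z - fst z'\<bar> \<le> 3" "\<bar>snd z - snd z'\<bar> \<le> 3"
  shows "ssq z' \<le> 37 * ssq z" "ssq z' - ssq z \<le> 27 * sqrt (ssq z)"
proof -
  obtain a b c d :: real where e: "of_int (fst z) = a" "of_int (snd z) = b" "of_int (fst z') = c" "of_int (snd z') = d"
    by blast
  have ac: "\<bar>c - a\<bar> \<le> 3" "\<bar>d - b\<bar> \<le> 3"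
    using assms unfolding e[symmetric] by linarith+
  have sq: "(c - a)\<^sup>2 \<le> 9" "(d - b)\<^sup>2 \<le> 9"
    using ac by (simp_all add: abs_le_square_iff[of _ 3, simplified])
  have c2: "c\<^sup>2 = a\<^sup>2 + 2 * (a * (c - a)) + (c - a)\<^sup>2" "d\<^sup>2 = b\<^sup>2 + 2 * (b * (d - b)) + (d - b)\<^sup>2"
    by (simp_all add: power2_eq_square algebra_simps)
  have "a * (c - a) \<le> \<bar>a\<bar> * 3" "b * (d - b) \<le> \<bar>b\<bar> * 3"
    using mult_left_mono[OF ac(1), of "\<bar>a\<bar>"] mult_left_mono[OF ac(2), of "\<bar>b\<bar>"]
      abs_ge_self[of "a * (c - a)"] abs_ge_self[of "b * (d - b)"]
    unfolding abs_mult by auto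
  then have *: "ssq z' - ssq z \<le> 6 * \<bar>a\<bar> + 6 * \<bar>b\<bar> + 18"
    using c2 sq unfolding ssq_def e by linarith
  \<comment> \<open>This turns 6 * |a| + 6 * |b| into at most 9 times the root; with 18 it makes
    27.\<close>
  have "2 / 3 * \<bar>a\<bar> + 2 / 3 * \<bar>b\<bar> \<le> sqrt (ssq z)"
  proof (rule real_le_rsqrt)
    have "2 * (\<bar>a\<bar> * \<bar>b\<bar>) \<le> a\<^sup>2 + b\<^sup>2"
      using zero_le_power2[of "\<bar>a\<bar> - \<bar>b\<bar>"] by (simp add: power2_eq_square algebra_simps)
    moreover have "(2 / 3 * \<bar>a\<bar> + 2 / 3 * \<bar>b\<bar>)\<^sup>2 = 4 / 9 * a\<^sup>2 + 4 / 9 * b\<^sup>2 + 8 / 9 * (\<bar>a\<bar> * \<bar>b\<bar>)"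
      by (simp add: power2_sum power_mult_distrib power_divide algebra_simps)
    ultimately show "(2 / 3 * \<bar>a\<bar> + 2 / 3 * \<bar>b\<bar>)\<^sup>2 \<le> ssq z"
      unfolding ssq_def e using zero_le_power2[of a] zero_le_power2[of b] by linarith
  qed
  moreover have "sqrt (ssq z) \<ge> 1" using ssq_ge_1 by simp
  ultimately show d: "ssq z' - ssq z \<le> 27 * sqrt (ssq z)"
    using * by linarith
  have "sqrt (ssq z) \<le> ssq z"
    using ssq_ge_1[of z] by (intro real_le_lsqrt) (auto simp: power2_eq_square)
  with d ssq_ge_1[of z] show "ssq z' \<le> 37 * ssq z" by linarith
qed

text \<open>The second bound is the decay of the gradient. The one-sided estimate has the root at
  the point of departure; moving it to the other point costs a factor sqrt 37, and 83 exceeds 13.5 *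
  sqrt 37.\<close>

lemma lam_diff_le:
  assumes "\<bar>fst z - fst z'\<bar> \<le> 3" "\<bar>snd z - snd z'\<bar> \<le> 3"
  shows "\<bar>lam z - lam z'\<bar> \<le> 2" "\<bar>lam z - lam z'\<bar> \<le> 83 / sqrt (ssq z)"
proof -
  have assms': "\<bar>fst z' - fst z\<bar> \<le> 3" "\<bar>snd z' - snd z\<bar> \<le> 3" using assms by auto
  have e4: "37 \<le> exp (4 :: real)"
  proof -
    have "(37::real) \<le> 2.5 * 2.5 * (2.5 * 2.5)" by simp
    also have "\<dots> \<le> exp 1 * exp 1 * (exp 1 * exp 1)"
    proof -
      have "exp (1::real) \<ge> 2.5" using exp_lower_Taylor_quadratic[of 1] by simp
      then show ?thesis by (intro mult_mono) auto
    qed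
    also have "\<dots> = exp 4" by (simp add: mult_exp_exp)
    finally show ?thesis .
  qed
  have one: "lam y - lam x \<le> 2 \<and> lam y - lam x \<le> 13.5 / sqrt (ssq x)"
    if xy: "\<bar>fst x - fst y\<bar> \<le> 3" "\<bar>snd x - snd y\<bar> \<le> 3" for x y
  proof
    have "ssq y \<le> exp 4 * ssq x"
      using ssq_shift_le(1)[OF xy] e4 by (meson mult_right_mono order.trans less_imp_le ssq_pos)
    then have "ln (ssq y) \<le> 4 + ln (ssq x)"
      by (subst (asm) ln_le_cancel_iff[symmetric]) (auto simp: ln_mult_pos)
    then show "lam y - lam x \<le> 2" by (simp add: lam_def)
    have "ln (ssq y) - ln (ssq x) = ln (ssq y / ssq x)"
      by (simp add: ln_divide_pos)
    also have "\<dots> \<le> ssq y / ssq x - 1"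
      by (rule ln_le_minus_one) simp
    also have "\<dots> = (ssq y - ssq x) / ssq x"
      using ssq_pos[of x] by (simp add: diff_divide_distrib less_imp_neq[THEN not_sym])
    also have "\<dots> \<le> 27 * sqrt (ssq x) / ssq x"
      using ssq_shift_le(2)[OF xy] by (intro divide_right_mono) (auto intro: less_imp_le)
    also have "\<dots> = 27 / sqrt (ssq x)"
      using ssq_pos[of x] real_sqrt_mult_self[of "ssq x"]
      by (simp add: frac_eq_eq less_imp_neq[THEN not_sym] abs_of_pos)
    finally show "lam y - lam x \<le> 13.5 / sqrt (ssq x)" by (simp add: lam_def)
  qed
  show "\<bar>lam z - lam z'\<bar> \<le> 2"
    using one[OF assms] one[OF assms'] by linarith
  have "sqrt (ssq z) \<le> sqrt (37 * ssq z')"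
    using ssq_shift_le(1)[OF assms'] by simp
  also have "\<dots> \<le> 83 / 13.5 * sqrt (ssq z')"
    unfolding real_sqrt_mult by (intro mult_right_mono real_le_lsqrt) (auto simp: power2_eq_square less_imp_le)
  finally have "13.5 / sqrt (ssq z') \<le> 83 / sqrt (ssq z)"
    using ssq_pos[of z] ssq_pos[of z'] by (simp add: field_simps)
  moreover have "13.5 / sqrt (ssq z) \<le> 83 / sqrt (ssq z)"
    using ssq_pos[of z] by (intro divide_right_mono) (auto intro: less_imp_le)
  ultimately show "\<bar>lam z - lam z'\<bar> \<le> 83 / sqrt (ssq z)"
    using one[OF assms] one[OF assms'] by linarith
qed

text \<open>The exponent leaves room to separate the variables:
  \<open>(1 + i\<^sup>2) * (1 + j\<^sup>2) \<le> (ssq z)\<^sup>2\<close>, so the weight is at most a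
  product of two terms decaying like the power -3/2, and the double sum is at most the square of a
  convergent series.\<close>

lemma ssq_weight_sum:
  "\<exists>C>0. \<forall>F. finite F \<longrightarrow> (\<Sum>z\<in>F. ssq z powr (-3/2)) \<le> C"
proof -
  define t where "t k = (1 + (real_of_int k)\<^sup>2) powr (-3/4)" for k :: int
  have tn: "t k \<ge> 0" for k by (simp add: t_def)
  have "summable (\<lambda>n. of_nat n powr (-3/2) :: real)"
    by (simp add: summable_real_powr_iff)
  then have S: "summable (\<lambda>n. t (int n))"
  proof (rule summable_comparison_test_ev[rotated])
    show "\<forall>\<^sub>F n in sequentially. norm (t (int n)) \<le> of_nat n powr (-3/2)"
      using eventually_gt_at_top[of 0]
    proof eventually_elim
      case (elim n)
      have "t (int n) \<le> (real n ^ 2) powr (-3/4)"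
        unfolding t_def using elim by (intro powr_mono2') auto
      also have "\<dots> = (real n powr 2) powr (-3/4)"
        using elim by (subst powr_numeral) auto
      also have "\<dots> = real n powr (-3/2)"
        by (simp only: powr_powr) simp
      finally show ?case using tn by simp
    qed
  qed
  define D where "D = 2 * (\<Sum>n. t (int n))"
  have tsym: "t (- k) = t k" for k by (simp add: t_def)
  have sum1: "(\<Sum>k\<in>{-int n..int n}. t k) \<le> D" for n
  proof -
    have "(\<Sum>k\<in>{-int n..int n}. t k) \<le> (\<Sum>k\<in>int ` {..n} \<union> (\<lambda>k. - int k) ` {..n}. t k)"
    proof (intro sum_mono2)
      show "{-int n..int n} \<subseteq> int ` {..n} \<union> (\<lambda>k. - int k) ` {..n}"
      proof
        fix k assume "k \<in> {-int n..int n}"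
        then show "k \<in> int ` {..n} \<union> (\<lambda>k. - int k) ` {..n}"
          using image_eqI[of k int "nat k" "{..n}"] image_eqI[of k "\<lambda>k. - int k" "nat (- k)" "{..n}"]
          by (cases "k \<ge> 0") auto
      qed
    qed (auto simp: tn)
    also have "\<dots> \<le> (\<Sum>k\<in>int ` {..n}. t k) + (\<Sum>k\<in>(\<lambda>k. - int k) ` {..n}. t k)"
      by (simp add: sum_Un sum_nonneg tn)
    also have "\<dots> = 2 * (\<Sum>k\<le>n. t (int k))"
      by (simp add: sum.reindex inj_on_def tsym)
    also have "\<dots> \<le> D"
      unfolding D_def by (intro mult_left_mono sum_le_suminf S) (auto simp: tn)
    finally show ?thesis .
  qed
  have D0: "D \<ge> 0" using sum1[of 0] tn[of 0] by simp
  have "(\<Sum>z\<in>F. ssq z powr (-3/2)) \<le> D * D" if F: "finite F" for F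
  proof -
    have "\<exists>n. F \<subseteq> {-int n..int n} \<times> {-int n..int n}"
    proof -
      define n where "n = (\<Sum>z\<in>F. nat \<bar>fst z\<bar> + nat \<bar>snd z\<bar>)"
      have "nat \<bar>fst z\<bar> + nat \<bar>snd z\<bar> \<le> n" if "z \<in> F" for z
        unfolding n_def using member_le_sum[OF that, of "\<lambda>z. nat \<bar>fst z\<bar> + nat \<bar>snd z\<bar>"] F by auto
      then have "F \<subseteq> {-int n..int n} \<times> {-int n..int n}" by fastforce
      then show ?thesis by blast
    qed
    then obtain n where n: "F \<subseteq> {-int n..int n} \<times> {-int n..int n}" by blast
    have pt: "ssq z powr (-3/2) \<le> t (fst z) * t (snd z)" for z
    proof -
      define x y where "x = 1 + (real_of_int (fst z))\<^sup>2" and "y = 1 + (real_of_int (snd z))\<^sup>2"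
      have xy: "x \<ge> 1" "y \<ge> 1" "x + y = ssq z + 1" by (auto simp: x_def y_def ssq_def)
      have "x * y \<le> (ssq z)\<^sup>2"
      proof -
        have "x \<le> ssq z" "y \<le> ssq z" using xy by linarith+
        then show ?thesis using xy unfolding power2_eq_square by (intro mult_mono) auto
      qed
      then have "((ssq z)\<^sup>2) powr (-3/4) \<le> (x * y) powr (-3/4)"
        using xy by (intro powr_mono2') auto
      moreover have "((ssq z)\<^sup>2) powr (-3/4) = ssq z powr (-3/2)"
      proof -
        have "((ssq z)\<^sup>2) powr (-3/4) = (ssq z powr 2) powr (-3/4)"
          by (subst powr_numeral) (auto intro: less_imp_le)
        also have "\<dots> = ssq z powr (-3/2)"
          by (simp only: powr_powr) simp
        finally show ?thesis .
      qed
      ultimately show ?thesis using xy by (simp add: t_def x_def y_def powr_mult)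
    qed
    have "(\<Sum>z\<in>F. ssq z powr (-3/2)) \<le> (\<Sum>z\<in>{-int n..int n} \<times> {-int n..int n}. t (fst z) * t (snd z))"
      by (rule order_trans[OF sum_mono[OF pt]]) (use n F in \<open>auto intro!: sum_mono2 simp: tn\<close>)
    also have "\<dots> = (\<Sum>k\<in>{-int n..int n}. t k) * (\<Sum>k\<in>{-int n..int n}. t k)"
      by (simp add: sum.cartesian_product' sum_product)
    also have "\<dots> \<le> D * D"
      using sum1[of n] D0 tn by (intro mult_mono sum_nonneg)
    finally show ?thesis .
  qed
  moreover have "D * D + 1 > 0" using D0 by (simp add: add_nonneg_pos)
  ultimately show ?thesis by (intro exI[of _ "D * D + 1"]) force
qed

text \<open>A representer up to \<open>\<epsilon>\<close> spares completeness: it is a near-minimiser of the quadratic functional \<open>J\<close>.\<close>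

lemma approx_riesz:
  fixes B :: "('a \<Rightarrow> real) \<Rightarrow> ('a \<Rightarrow> real) \<Rightarrow> real" and l :: "('a \<Rightarrow> real) \<Rightarrow> real"
  assumes V0: "(\<lambda>_. 0) \<in> V" and V: "\<And>f g t. f \<in> V \<Longrightarrow> g \<in> V \<Longrightarrow> (\<lambda>x. f x + t * g x) \<in> V"
    and l: "\<And>f g t. f \<in> V \<Longrightarrow> g \<in> V \<Longrightarrow> l (\<lambda>x. f x + t * g x) = l f + t * l g"
    and B: "\<And>f g t. B (\<lambda>x. f x + t * g x) (\<lambda>x. f x + t * g x) = B f f + 2 * t * B f g + t\<^sup>2 * B g g"
    and Bn: "\<And>g. B g g \<ge> 0"
    and bd: "\<And>g. g \<in> V \<Longrightarrow> \<bar>l g\<bar> \<le> m * sqrt (B g g)"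
    and \<epsilon>: "\<epsilon> > 0"
  shows "\<exists>\<phi>\<in>V. \<forall>g\<in>V. \<bar>B \<phi> g - l g\<bar> \<le> \<epsilon> * sqrt (B g g)"
proof -
  define J where "J f = B f f - 2 * l f" for f
  have lower: "- m\<^sup>2 \<le> J f" if "f \<in> V" for f
  proof -
    have "0 \<le> (sqrt (B f f) - m)\<^sup>2" by simp
    also have "\<dots> = B f f - 2 * (m * sqrt (B f f)) + m\<^sup>2"
      using Bn[of f] by (simp add: power2_diff algebra_simps)
    finally show ?thesis using bd[OF that] unfolding J_def by linarith
  qed
  have bdd: "bdd_below (J ` V)" using lower by (intro bdd_belowI2)
  have "Inf (J ` V) < Inf (J ` V) + \<epsilon>\<^sup>2" using \<epsilon> by simp
  then have "\<exists>y\<in>J ` V. y < Inf (J ` V) + \<epsilon>\<^sup>2"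
    using V0 bdd by (subst (asm) cInf_less_iff) auto
  then obtain \<phi> where \<phi>: "\<phi> \<in> V" "J \<phi> < Inf (J ` V) + \<epsilon>\<^sup>2" by auto
  have "\<bar>B \<phi> g - l g\<bar> \<le> \<epsilon> * sqrt (B g g)" if g: "g \<in> V" for g
  proof -
    define d b where "d = B \<phi> g - l g" and "b = B g g"
    have b: "b \<ge> 0" using Bn by (simp add: b_def)
    \<comment> \<open>Near-minimality along the line through \<open>\<phi>\<close> in the direction
      \<open>g\<close>. Below, \<open>t\<close> is the minimiser of this quadratic polynomial or, if
      \<open>b = 0\<close> and \<open>d\<close> is not zero, a value that violates the
      bound.\<close>
    have t: "2 * t * d + t\<^sup>2 * b > - \<epsilon>\<^sup>2" for t
    proof -
      have "Inf (J ` V) \<le> J (\<lambda>x. \<phi> x + t * g x)"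
        by (rule cInf_lower[OF _ bdd]) (use V \<phi> g in auto)
      then have "J \<phi> < J (\<lambda>x. \<phi> x + t * g x) + \<epsilon>\<^sup>2" using \<phi> by linarith
      then show ?thesis unfolding J_def B l[OF \<phi>(1) g] d_def b_def by (simp add: algebra_simps)
    qed
    have "d\<^sup>2 \<le> \<epsilon>\<^sup>2 * b"
    proof (cases "b = 0")
      case True
      have "d = 0"
      proof (rule ccontr)
        assume "d \<noteq> 0"
        with t[of "- \<epsilon>\<^sup>2 / d"] True \<epsilon> show False by (simp add: field_simps)
      qed
      then show ?thesis using b by simp
    next
      case False
      have "2 * (- d / b) * d + (- d / b)\<^sup>2 * b = - (d\<^sup>2 / b)"
        using False by (simp add: power2_eq_square field_simps)
      with t[of "- d / b"] have "d\<^sup>2 / b < \<epsilon>\<^sup>2" by linarith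
      then show ?thesis using b False by (simp add: field_simps)
    qed
    then have "sqrt (d\<^sup>2) \<le> sqrt (\<epsilon>\<^sup>2 * b)" by (rule real_sqrt_le_mono)
    then show ?thesis using \<epsilon> by (simp add: real_sqrt_mult d_def b_def)
  qed
  with \<phi>(1) show ?thesis by blast
qed

text \<open>Truncated logarithm, an approximate Green function of the five-point Laplacian.\<close>

definition green :: "nat \<Rightarrow> int \<times> int \<Rightarrow> int \<times> int \<Rightarrow> real" where
  "green m z\<^sub>0 z = max 0 (real m - lam (z - z\<^sub>0))"

lemma lap_shift: "lap (\<lambda>z. f (z - z\<^sub>0)) z = lap f (z - z\<^sub>0)"
  by (simp add: lap_def diff_add_eq algebra_simps) (simp add: prod_eq_iff minus_prod_def algebra_simps)

text \<open>Summation by parts moves the Laplacian onto the logarithm, where it is a positive weight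
  concentrated near \<open>z\<^sub>0\<close>. Both errors, the spread of this weight and the
  truncation, are multiples of the norm of \<open>\<phi>\<close> with constants that depend neither
  on \<open>m\<close> nor on the box. That norm is absorbed in \<open>grid_duality\<close>.\<close>

lemma green_point_bound:
  "\<exists>C>0. \<forall>m M \<phi> z\<^sub>0. of_int (M - 1) \<le> 2 * exp (real m) \<longrightarrow> 0 \<le> M \<longrightarrow> z\<^sub>0 \<in> gbox M \<longrightarrow>
     (\<forall>z. z \<notin> gbox M \<longrightarrow> \<phi> z = 0) \<longrightarrow>
     \<bar>\<phi> z\<^sub>0\<bar> \<le> \<bar>\<Sum>z\<in>gbox (M + 1). gip \<phi> (green m z\<^sub>0) z\<bar> + C * sqrt (\<Sum>z\<in>gbox (M + 1). gsq \<phi> z)"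
proof -
  obtain C1 where C1: "C1 > 0" "\<And>F. finite F \<Longrightarrow> (\<Sum>z\<in>F. ssq z powr (-3/2)) \<le> C1"
    using ssq_weight_sum by blast
  define D where "D = sqrt (2 * (83 * exp 2)\<^sup>2 * 121)"
  have "\<bar>\<phi> z\<^sub>0\<bar> \<le> \<bar>\<Sum>z\<in>gbox (M + 1). gip \<phi> (green m z\<^sub>0) z\<bar> + (16 * C1 + D) * sqrt (\<Sum>z\<in>gbox (M + 1). gsq \<phi> z)"
    if M: "of_int (M - 1) \<le> 2 * exp (real m)" "0 \<le> M" and z0: "z\<^sub>0 \<in> gbox M" and \<phi>: "\<And>z. z \<notin> gbox M \<Longrightarrow> \<phi> z = 0"
    for m M \<phi> z\<^sub>0
  proof -
    define X where "X = gbox (M + 1)"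
    define E where "E = (\<Sum>z\<in>X. gsq \<phi> z)"
    define \<Lambda> where "\<Lambda> z = lam (z - z\<^sub>0)" for z
    define \<zeta> where "\<zeta> z = max 0 (\<Lambda> z - m)" for z
    have fX: "finite X" by (simp add: X_def)
    have E0: "E \<ge> 0" by (simp add: E_def sum_nonneg)
    have z0X: "z\<^sub>0 \<in> X" using z0 by (auto simp: X_def gbox_def)
    have "green m z\<^sub>0 z = (m - \<Lambda> z) + \<zeta> z" for z
      by (simp add: green_def \<Lambda>_def \<zeta>_def)
    then have "green m z\<^sub>0 = (\<lambda>z. (m - \<Lambda> z) + \<zeta> z)" by blast
    then have "gip \<phi> (green m z\<^sub>0) z = gip \<phi> \<zeta> z - gip \<phi> \<Lambda> z" for z
      by (simp add: gip_def algebra_simps)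
    then have split: "(\<Sum>z\<in>X. gip \<phi> (green m z\<^sub>0) z) = (\<Sum>z\<in>X. gip \<phi> \<zeta> z) + (\<Sum>z\<in>X. \<phi> z * lap \<Lambda> z)"
      using sum_gip_eq_lap[of M \<phi> \<Lambda>] \<phi> M by (simp add: X_def sum_subtractf)
    have lap\<Lambda>: "lap \<Lambda> z = lap lam (z - z\<^sub>0)" for z
      unfolding lap_shift[symmetric] by (simp add: \<Lambda>_def[abs_def])
    have lapn: "0 \<le> lap \<Lambda> z" "lap \<Lambda> z \<le> 8 / (ssq (z - z\<^sub>0))\<^sup>2" for z
      unfolding lap\<Lambda> by (rule lap_lam_nonneg lap_lam_le)+
    have "lap \<Lambda> z\<^sub>0 \<ge> 1"
      using lap_lam_zero by (simp add: lap\<Lambda> zero_prod_def)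
    also have "lap \<Lambda> z\<^sub>0 \<le> (\<Sum>z\<in>X. lap \<Lambda> z)"
      using fX z0X lapn by (intro member_le_sum) auto
    finally have ge1: "1 \<le> (\<Sum>z\<in>X. lap \<Lambda> z)" .
    have "\<bar>\<phi> z\<^sub>0\<bar> \<le> \<bar>\<phi> z\<^sub>0\<bar> * (\<Sum>z\<in>X. lap \<Lambda> z)"
      using ge1 by (simp add: mult_le_cancel_left1)
    also have "\<dots> = \<bar>\<Sum>z\<in>X. \<phi> z\<^sub>0 * lap \<Lambda> z\<bar>"
      using lapn by (simp add: sum_distrib_left[symmetric] abs_mult abs_of_nonneg sum_nonneg)
    also have "(\<Sum>z\<in>X. \<phi> z\<^sub>0 * lap \<Lambda> z) = (\<Sum>z\<in>X. gip \<phi> (green m z\<^sub>0) z) - (\<Sum>z\<in>X. gip \<phi> \<zeta> z) - (\<Sum>z\<in>X. (\<phi> z - \<phi> z\<^sub>0) * lap \<Lambda> z)"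
      unfolding split by (simp add: algebra_simps sum_subtractf)
    finally have main: "\<bar>\<phi> z\<^sub>0\<bar> \<le> \<bar>\<Sum>z\<in>X. gip \<phi> (green m z\<^sub>0) z\<bar> + \<bar>\<Sum>z\<in>X. gip \<phi> \<zeta> z\<bar> + \<bar>\<Sum>z\<in>X. (\<phi> z - \<phi> z\<^sub>0) * lap \<Lambda> z\<bar>"
      by linarith
    have "\<bar>\<Sum>z\<in>X. (\<phi> z - \<phi> z\<^sub>0) * lap \<Lambda> z\<bar> \<le> (\<Sum>z\<in>X. 16 * sqrt E * ssq (z - z\<^sub>0) powr (-3/2))"
    proof (rule order_trans[OF sum_abs], rule sum_mono)
      fix z assume z: "z \<in> X"
      define s where "s = ssq (z - z\<^sub>0)"
      have s1: "s \<ge> 1" by (simp add: s_def ssq_ge_1)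
      have rt: "sqrt \<bar>of_int i\<bar> \<le> sqrt s" if "(real_of_int i)\<^sup>2 \<le> s" for i
      proof -
        have "\<bar>real_of_int i\<bar> \<le> (real_of_int i)\<^sup>2"
        proof -
          have "\<bar>i\<bar> * (\<bar>i\<bar> - 1) \<ge> 0"
            by (cases "i = 0") auto
          then have "\<bar>i\<bar> \<le> i\<^sup>2" by (simp add: power2_eq_square algebra_simps)
          then have "real_of_int \<bar>i\<bar> \<le> real_of_int (i\<^sup>2)" by (simp only: of_int_le_iff)
          then show ?thesis by simp
        qed
        with that show ?thesis by simp
      qed
      have "\<bar>\<phi> z - \<phi> z\<^sub>0\<bar> \<le> (sqrt \<bar>of_int (fst z - fst z\<^sub>0)\<bar> + sqrt \<bar>of_int (snd z - snd z\<^sub>0)\<bar>) * sqrt E"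
        using grid_diff_le z z0X unfolding X_def E_def by blast
      also have "\<dots> \<le> (sqrt s + sqrt s) * sqrt E"
        using E0 by (intro mult_right_mono add_mono rt) (auto simp: s_def ssq_def)
      finally have d: "\<bar>\<phi> z - \<phi> z\<^sub>0\<bar> \<le> 2 * sqrt s * sqrt E" by simp
      have "\<bar>(\<phi> z - \<phi> z\<^sub>0) * lap \<Lambda> z\<bar> = \<bar>\<phi> z - \<phi> z\<^sub>0\<bar> * lap \<Lambda> z"
        using lapn[of z] by (simp add: abs_mult)
      also have "\<dots> \<le> (2 * sqrt s * sqrt E) * (8 / s\<^sup>2)"
        using d lapn[of z] E0 s1 by (intro mult_mono) (auto simp: s_def)
      also have "\<dots> = 16 * sqrt E * (sqrt s / s\<^sup>2)" by simp
      also have "sqrt s / s\<^sup>2 = s powr (1/2) / s powr 2"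
        using s1 by (simp add: powr_half_sqrt)
      also have "\<dots> = s powr (-3/2)"
        by (simp flip: powr_diff)
      finally show "\<bar>(\<phi> z - \<phi> z\<^sub>0) * lap \<Lambda> z\<bar> \<le> 16 * sqrt E * ssq (z - z\<^sub>0) powr (-3/2)"
        by (simp add: s_def)
    qed
    also have "\<dots> = 16 * sqrt E * (\<Sum>z\<in>(\<lambda>z. z - z\<^sub>0) ` X. ssq z powr (-3/2))"
      by (subst sum.reindex) (auto simp: inj_on_def sum_distrib_left)
    also have "\<dots> \<le> 16 * sqrt E * C1"
      using fX E0 by (intro mult_left_mono C1) auto
    finally have e1: "\<bar>\<Sum>z\<in>X. (\<phi> z - \<phi> z\<^sub>0) * lap \<Lambda> z\<bar> \<le> 16 * C1 * sqrt E" by (simp only: ac_simps)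
    \<comment> \<open>Where \<open>\<Lambda>\<close> is below \<open>m - 2\<close>,
      \<open>\<zeta>\<close> vanishes at the point and its neighbours. Elsewhere the gradient is of
      order exp (- m), while the box has of order exp (2 * m) points, so the energy of
      \<open>\<zeta>\<close> is bounded.\<close>
    have "(\<Sum>z\<in>X. gsq \<zeta> z) \<le> (\<Sum>z\<in>X. 2 * (83 * exp 2 / exp m)\<^sup>2)"
    proof (rule sum_mono)
      fix z
      have step: "(\<zeta> z' - \<zeta> z)\<^sup>2 \<le> (83 * exp 2 / exp m)\<^sup>2"
        if "\<bar>fst z' - fst z\<bar> \<le> 1" "\<bar>snd z' - snd z\<bar> \<le> 1" for z'
      proof -
        have L: "\<bar>\<Lambda> z - \<Lambda> z'\<bar> \<le> 2" "\<bar>\<Lambda> z - \<Lambda> z'\<bar> \<le> 83 / sqrt (ssq (z - z\<^sub>0))"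
          unfolding \<Lambda>_def using that by (intro lam_diff_le; simp)+
        have "\<bar>\<zeta> z' - \<zeta> z\<bar> \<le> 83 * exp 2 / exp m"
        proof (cases "\<Lambda> z \<ge> real m - 2")
          case True
          have "\<bar>\<zeta> z' - \<zeta> z\<bar> \<le> \<bar>\<Lambda> z - \<Lambda> z'\<bar>"
            unfolding \<zeta>_def by linarith
          also have "\<dots> \<le> 83 / exp (\<Lambda> z)" using L(2) by (simp add: \<Lambda>_def exp_lam)
          also have "\<dots> \<le> 83 / exp (real m - 2)"
            using True by (intro divide_left_mono) auto
          also have "\<dots> = 83 * exp 2 / exp m" by (simp add: exp_diff)
          finally show ?thesis .
        next
          case False
          then have "\<Lambda> z' - m \<le> 0" "\<Lambda> z - m \<le> 0" using L(1) by linarith+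
          then have "\<zeta> z' = 0" "\<zeta> z = 0" unfolding \<zeta>_def by simp_all
          then show ?thesis by simp
        qed
        then show ?thesis using power_mono[of "\<bar>\<zeta> z' - \<zeta> z\<bar>" _ 2] by simp
      qed
      show "gsq \<zeta> z \<le> 2 * (83 * exp 2 / exp m)\<^sup>2"
        using step[of "(fst z + 1, snd z)"] step[of "(fst z, snd z + 1)"] by (simp add: gsq_def)
    qed
    also have "\<dots> = real (card X) * (2 * (83 * exp 2 / exp m)\<^sup>2)" by simp
    also have "real (card X) \<le> 121 * (exp m)\<^sup>2"
    proof -
      have "real (card X) = (2 * of_int M + 3)\<^sup>2"
        using M by (simp add: X_def gbox_def card_cartesian_product power2_eq_square algebra_simps)
      also have "\<dots> \<le> (11 * exp m)\<^sup>2"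
        using M one_le_exp_iff[of "real m"] by (intro power_mono) (auto simp del: one_le_exp_iff)
      finally show ?thesis by (simp add: power_mult_distrib)
    qed
    also have "121 * (exp m)\<^sup>2 * (2 * (83 * exp 2 / exp m)\<^sup>2) = 2 * (83 * exp 2)\<^sup>2 * 121"
      by (simp add: power_divide)
    finally have "sqrt (\<Sum>z\<in>X. gsq \<zeta> z) \<le> D"
      unfolding D_def by (simp add: mult_right_mono)
    then have "sqrt E * sqrt (\<Sum>z\<in>X. gsq \<zeta> z) \<le> sqrt E * D"
      using E0 by (intro mult_left_mono) auto
    moreover have "\<bar>\<Sum>z\<in>X. gip \<phi> \<zeta> z\<bar> \<le> sqrt E * sqrt (\<Sum>z\<in>X. gsq \<zeta> z)"
      unfolding E_def by (rule sum_gip_le)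
    ultimately have e2: "\<bar>\<Sum>z\<in>X. gip \<phi> \<zeta> z\<bar> \<le> D * sqrt E"
      by (simp add: mult.commute)
    show ?thesis
      using main e1 e2 unfolding X_def[symmetric] E_def[symmetric] distrib_right by linarith
  qed
  note key = this
  have "16 * C1 + D > 0" using C1 by (simp add: D_def add_pos_nonneg)
  then show ?thesis using key by (intro exI[of _ "16 * C1 + D"] conjI allI impI) auto
qed

lemma green_support:
  assumes "real_of_int \<bar>fst z\<^sub>0\<bar> \<le> exp m" "real_of_int \<bar>snd z\<^sub>0\<bar> \<le> exp m" "2 * exp m \<le> of_int M" "z \<notin> gbox M"
  shows "green m z\<^sub>0 z = 0"
proof (rule ccontr)
  assume "green m z\<^sub>0 z \<noteq> 0"
  then have "lam (z - z\<^sub>0) < m" by (auto simp: green_def max_def split: if_splits)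
  then have "sqrt (ssq (z - z\<^sub>0)) < exp m" by (simp flip: exp_lam)
  then have s: "ssq (z - z\<^sub>0) < (exp m)\<^sup>2"
    using real_sqrt_less_iff[of "ssq (z - z\<^sub>0)" "(exp m)\<^sup>2"] by simp
  have "\<bar>real_of_int (fst z - fst z\<^sub>0)\<bar> < exp m" "\<bar>real_of_int (snd z - snd z\<^sub>0)\<bar> < exp m"
  proof -
    have "(real_of_int (fst z - fst z\<^sub>0))\<^sup>2 < (exp m)\<^sup>2" "(real_of_int (snd z - snd z\<^sub>0))\<^sup>2 < (exp m)\<^sup>2"
      using s zero_le_power2[of "real_of_int (fst z - fst z\<^sub>0)"] zero_le_power2[of "real_of_int (snd z - snd z\<^sub>0)"]
      unfolding ssq_def fst_diff snd_diff by linarith+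
    then show "\<bar>real_of_int (fst z - fst z\<^sub>0)\<bar> < exp m" "\<bar>real_of_int (snd z - snd z\<^sub>0)\<bar> < exp m"
      by (auto intro!: power2_less_imp_less[of "\<bar>_\<bar>"])
  qed
  then have "\<bar>real_of_int (fst z)\<bar> \<le> M" "\<bar>real_of_int (snd z)\<bar> \<le> M"
    using assms by linarith+
  then have "z \<in> gbox M" by (cases z) (auto simp: gbox_def)
  with assms show False by simp
qed

text \<open>\<open>P\<close> is the set of grid points at which \<open>l\<close> looks at its
  argument. The radius of the box is about \<open>2 * exp m\<close>, so that Green functions centred
  in \<open>P\<close> vanish outside it and are admissible test functions. For the representer
  \<open>\<phi>\<close>, of norm r, the hypotheses give r^2 \<le> A * (2 * A + C0 * r) + A * r,
  whence r is at most a multiple of \<open>A\<close>: the error of \<open>green_point_bound\<close>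
  is linear in r and the square absorbs it.\<close>

lemma grid_duality:
  "\<exists>C>0. \<forall>m M P l A.
     2 * exp (real m) \<le> of_int M \<longrightarrow> of_int (M - 1) \<le> 2 * exp (real m) \<longrightarrow>
     (\<forall>z\<in>P. real_of_int \<bar>fst z\<bar> \<le> exp m \<and> real_of_int \<bar>snd z\<bar> \<le> exp m) \<longrightarrow>
     (\<forall>f g t. l (\<lambda>x. f x + t * g x) = l f + t * l g) \<longrightarrow>
     (\<forall>g W. (\<forall>z\<in>P. \<bar>g z\<bar> \<le> W) \<longrightarrow> \<bar>l g\<bar> \<le> A * W) \<longrightarrow>
     (\<forall>z\<^sub>0\<in>P. \<bar>l (green m z\<^sub>0)\<bar> \<le> A) \<longrightarrow> A \<ge> 0 \<longrightarrow>
     (\<forall>g. (\<forall>z. z \<notin> gbox M \<longrightarrow> g z = 0) \<longrightarrow> \<bar>l g\<bar> \<le> C * A * sqrt (\<Sum>z\<in>gbox (M + 1). gsq g z))"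
proof -
  obtain C0 where C0: "C0 > 0" and point: "\<And>m M \<phi> z\<^sub>0. of_int (M - 1) \<le> 2 * exp (real m) \<Longrightarrow> 0 \<le> M \<Longrightarrow> z\<^sub>0 \<in> gbox M \<Longrightarrow>
     (\<forall>z. z \<notin> gbox M \<longrightarrow> \<phi> z = 0) \<Longrightarrow>
     \<bar>\<phi> z\<^sub>0\<bar> \<le> \<bar>\<Sum>z\<in>gbox (M + 1). gip \<phi> (green m z\<^sub>0) z\<bar> + C0 * sqrt (\<Sum>z\<in>gbox (M + 1). gsq \<phi> z)"
    using green_point_bound by blast
  have "\<bar>l g\<bar> \<le> (C0 + 4) * A * sqrt (\<Sum>z\<in>gbox (M + 1). gsq g z)"
    if M: "2 * exp (real m) \<le> of_int M" "of_int (M - 1) \<le> 2 * exp (real m)"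
      and P: "\<And>z. z \<in> P \<Longrightarrow> real_of_int \<bar>fst z\<bar> \<le> exp m \<and> real_of_int \<bar>snd z\<bar> \<le> exp m"
      and lin: "\<And>f g t. l (\<lambda>x. f x + t * g x) = l f + t * l g"
      and sup: "\<And>g W. (\<And>z. z \<in> P \<Longrightarrow> \<bar>g z\<bar> \<le> W) \<Longrightarrow> \<bar>l g\<bar> \<le> A * W"
      and green: "\<And>z\<^sub>0. z\<^sub>0 \<in> P \<Longrightarrow> \<bar>l (green m z\<^sub>0)\<bar> \<le> A" and A: "A \<ge> 0"
      and g: "\<And>z. z \<notin> gbox M \<Longrightarrow> g z = 0"
    for m M P l A g
  proof -
    define X where "X = gbox (M + 1)"
    define V where "V = {f :: int \<times> int \<Rightarrow> real. \<forall>z. z \<notin> gbox M \<longrightarrow> f z = 0}"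
    define B where "B f g = (\<Sum>z\<in>X. gip f g z)" for f g
    define nm where "nm f = sqrt (B f f)" for f
    have Bsq: "B f f = (\<Sum>z\<in>X. gsq f z)" for f by (simp add: B_def gip_self)
    have B0: "B f f \<ge> 0" for f by (simp add: Bsq sum_nonneg)
    have nm0: "nm f \<ge> 0" for f by (simp add: nm_def B0)
    have M0: "M \<ge> 0" using M(1) exp_gt_zero[of "real m"] by (metis less_le_trans mult_pos_pos zero_less_numeral of_int_0_less_iff less_imp_le)
    have PM: "z \<in> gbox M" if "z \<in> P" for z
    proof -
      have "real_of_int \<bar>fst z\<bar> \<le> of_int M" "real_of_int \<bar>snd z\<bar> \<le> of_int M"
        using P[OF that] M(1) exp_gt_zero[of "real m"] by linarith+
      then show ?thesis unfolding of_int_le_iff by (cases z) (auto simp: gbox_def)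
    qed
    have gV: "green m z \<in> V" if "z \<in> P" for z
      using green_support[of z m M] P[OF that] M(1) by (auto simp: V_def)
    have fP: "finite P" by (rule finite_subset[of P "gbox M"]) (use PM in auto)
    show ?thesis
    \<comment> \<open>The tolerance \<open>\<epsilon>\<close> is proportional to \<open>A\<close>
      and must be positive. For \<open>A = 0\<close> the supremum bound alone makes \<open>l\<close>
      vanish.\<close>
    proof (cases "A = 0")
      case True
      have "\<bar>l g\<bar> \<le> A * (\<Sum>z\<in>P. \<bar>g z\<bar>)"
        by (rule sup) (use fP in \<open>auto intro: member_le_sum\<close>)
      with True show ?thesis by simp
    next
      case False
      then have Apos: "A > 0" using A by simp
      define \<Gamma> where "\<Gamma> = (\<Sum>z\<in>P. nm (green m z))"
      have \<Gamma>: "nm (green m z) \<le> \<Gamma>" if "z \<in> P" for z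
        unfolding \<Gamma>_def using fP that nm0 by (intro member_le_sum) auto
      have \<Gamma>0: "\<Gamma> \<ge> 0" unfolding \<Gamma>_def by (simp add: nm0 sum_nonneg)
      \<comment> \<open>The norms of the Green functions are not bounded uniformly in
        \<open>m\<close>; dividing by their finite sum keeps the representation error at each of
        them below \<open>A\<close>.\<close>
      define \<epsilon> where "\<epsilon> = A / (1 + \<Gamma>)"
      have \<epsilon>: "\<epsilon> > 0" "\<epsilon> \<le> A" "\<epsilon> * \<Gamma> \<le> A"
        using Apos \<Gamma>0 by (auto simp: \<epsilon>_def field_simps)
      \<comment> \<open>A crude embedding constant that depends on the box. It only supplies the
        continuity of \<open>l\<close> asked for by \<open>approx_riesz\<close> and is absent from
        the final bound.\<close>
      define H where "H = 2 * (sqrt (of_int (2 * M + 2)))"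
      have supV: "\<bar>f z\<bar> \<le> H * nm f" if "f \<in> V" "z \<in> P" for f z
      proof -
        \<comment> \<open>The comparison point lies in the same row as \<open>z\<close>, just
          outside the support of \<open>f\<close>.\<close>
        have "\<bar>f z - f (M + 1, snd z)\<bar> \<le> (sqrt \<bar>of_int (fst z - fst (M + 1, snd z))\<bar> + sqrt \<bar>of_int (snd z - snd (M + 1, snd z))\<bar>) * sqrt (\<Sum>z\<in>X. gsq f z)"
          unfolding X_def by (rule grid_diff_le) (use PM[OF that(2)] in \<open>auto simp: gbox_def\<close>)
        also have "\<dots> \<le> H * nm f"
        proof -
          have "\<bar>fst z - (M + 1)\<bar> \<le> 2 * M + 2" using PM[OF that(2)] M0 by (auto simp: gbox_def)
          then have "real_of_int \<bar>fst z - (M + 1)\<bar> \<le> real_of_int (2 * M + 2)" by (simp only: of_int_le_iff)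
          then have "sqrt \<bar>of_int (fst z - (M + 1))\<bar> \<le> sqrt (of_int (2 * M + 2))"
            by (intro real_sqrt_le_mono) simp
          moreover have "sqrt (real_of_int (2 * M + 2)) \<ge> 0" using M0 by simp
          moreover have "sqrt \<bar>real_of_int (snd z - snd z)\<bar> = 0" by simp
          ultimately have "sqrt \<bar>of_int (fst z - (M + 1))\<bar> + sqrt \<bar>of_int (snd z - snd z)\<bar> \<le> H"
            unfolding H_def by linarith
          then show ?thesis
            unfolding nm_def Bsq fst_conv snd_conv by (intro mult_right_mono) (auto simp: sum_nonneg)
        qed
        finally show ?thesis using that(1) by (simp add: V_def gbox_def)
      qed
      have "\<exists>\<phi>\<in>V. \<forall>g\<in>V. \<bar>B \<phi> g - l g\<bar> \<le> \<epsilon> * sqrt (B g g)"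
      proof (rule approx_riesz)
        show "B (\<lambda>x. f x + t * g x) (\<lambda>x. f x + t * g x) = B f f + 2 * t * B f g + t\<^sup>2 * B g g" for f g t
          unfolding B_def gip_def sum_distrib_left sum.distrib[symmetric]
          by (intro sum.cong refl) (simp add: power2_eq_square algebra_simps)
        show "\<bar>l g\<bar> \<le> (A * H) * sqrt (B g g)" if "g \<in> V" for g
          using sup[of g "H * nm g"] supV[OF that] by (simp add: nm_def mult.assoc)
      qed (auto simp: V_def lin B0 \<epsilon>)
      then obtain \<phi> where \<phi>: "\<phi> \<in> V" and near: "\<And>g. g \<in> V \<Longrightarrow> \<bar>B \<phi> g - l g\<bar> \<le> \<epsilon> * nm g"
        unfolding nm_def by blast
      have "\<bar>\<phi> z\<bar> \<le> 2 * A + C0 * nm \<phi>" if z: "z \<in> P" for z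
      proof -
        have "\<bar>\<phi> z\<bar> \<le> \<bar>B \<phi> (green m z)\<bar> + C0 * nm \<phi>"
          unfolding nm_def Bsq unfolding B_def X_def
          by (rule point) (use M M0 PM[OF z] \<phi> in \<open>auto simp: V_def\<close>)
        moreover have "\<epsilon> * nm (green m z) \<le> \<epsilon> * \<Gamma>"
          using \<epsilon> \<Gamma>[OF z] by (intro mult_left_mono) auto
        ultimately show ?thesis
          using near[OF gV[OF z]] green[OF z] \<epsilon>(3) by linarith
      qed
      then have "\<bar>l \<phi>\<bar> \<le> A * (2 * A + C0 * nm \<phi>)" by (rule sup)
      moreover have "\<epsilon> * nm \<phi> \<le> A * nm \<phi>" using \<epsilon> nm0 by (intro mult_right_mono) auto
      moreover have "B \<phi> \<phi> = nm \<phi> * nm \<phi>" by (simp add: nm_def B0)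
      ultimately have quad: "nm \<phi> * nm \<phi> \<le> A * (2 * A + C0 * nm \<phi>) + A * nm \<phi>"
        using near[OF \<phi>] by linarith
      have bound: "nm \<phi> \<le> (C0 + 3) * A"
      proof (rule ccontr)
        assume "\<not> ?thesis"
        then have big: "nm \<phi> > (C0 + 3) * A" by simp
        have "(C0 + 3) * A \<ge> 3 * A" using C0 Apos by simp
        then have nA: "nm \<phi> > A" using big Apos by linarith
        have "(C0 + 1) * A * nm \<phi> + 2 * A * A < (C0 + 1) * A * nm \<phi> + 2 * A * nm \<phi>"
          using nA Apos by simp
        also have "\<dots> = (C0 + 3) * A * nm \<phi>" by (simp add: algebra_simps)
        also have "\<dots> \<le> nm \<phi> * nm \<phi>" using big nm0 by (intro mult_right_mono) auto
        finally show False using quad by (simp add: algebra_simps)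
      qed
      have gV': "g \<in> V" using g by (simp add: V_def)
      have "\<bar>B \<phi> g\<bar> \<le> nm \<phi> * nm g"
        unfolding nm_def Bsq unfolding B_def by (rule sum_gip_le)
      also have "\<dots> \<le> (C0 + 3) * A * nm g" using bound nm0 by (intro mult_right_mono) auto
      finally have "\<bar>B \<phi> g\<bar> \<le> (C0 + 3) * A * nm g" .
      moreover have "\<epsilon> * nm g \<le> A * nm g" using \<epsilon> nm0 by (intro mult_right_mono) auto
      ultimately have "\<bar>l g\<bar> \<le> (C0 + 3) * A * nm g + A * nm g" using near[OF gV'] by linarith
      then show ?thesis by (simp add: nm_def Bsq X_def algebra_simps)
    qed
  qed
  note key = this
  show ?thesis
  proof (intro exI[of _ "C0 + 4"] conjI allI impI)
    fix m M P A and l :: "(int \<times> int \<Rightarrow> real) \<Rightarrow> real" and g :: "int \<times> int \<Rightarrow> real"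
    assume a: "2 * exp (real m) \<le> of_int M" "of_int (M - 1) \<le> 2 * exp (real m)"
      "\<forall>z\<in>P. real_of_int \<bar>fst z\<bar> \<le> exp m \<and> real_of_int \<bar>snd z\<bar> \<le> exp m"
      "\<forall>f g t. l (\<lambda>x. f x + t * g x) = l f + t * l g"
      "\<forall>g W. (\<forall>z\<in>P. \<bar>g z\<bar> \<le> W) \<longrightarrow> \<bar>l g\<bar> \<le> A * W"
      "\<forall>z\<^sub>0\<in>P. \<bar>l (green m z\<^sub>0)\<bar> \<le> A" "0 \<le> A" "\<forall>z. z \<notin> gbox M \<longrightarrow> g z = 0"
    show "\<bar>l g\<bar> \<le> (C0 + 4) * A * sqrt (\<Sum>z\<in>gbox (M + 1). gsq g z)"
      by (rule key[where P = P]) (use a in auto)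
  qed (use C0 in auto)
qed

section \<open>Upwind forms of conservative flows\<close>

text \<open>Unit steps in the values of the logarithm; they add up to the truncated logarithm.\<close>

definition clip :: "nat \<Rightarrow> int \<times> int \<Rightarrow> real" where
  "clip k z = max 0 (min 1 (real k + 1 - lam z))"

text \<open>\<open>clip k\<close> varies only where \<open>lam\<close> is between \<open>k\<close>
  and \<open>k + 1\<close>. The exponents are wider by 2 on both sides because a shift by up to
  three changes \<open>lam\<close> by at most 2; the division by 2 passes from the Euclidean to the
  maximum norm.\<close>

definition shell :: "nat \<Rightarrow> (int \<times> int) set" where
  "shell k = annulus \<lfloor>exp (real k - 2) / 2\<rfloor> \<lceil>exp (real k + 3)\<rceil>"

lemma finite_shell [simp]: "finite (shell k)"
  by (simp add: shell_def)

lemma sum_clip: "(\<Sum>k<m. clip k z) = max 0 (real m - lam z)"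
proof (induction m)
  case 0
  then show ?case using lam_nonneg[of z] by simp
next
  case (Suc m)
  show ?case
    using lam_nonneg[of z] unfolding sum.lessThan_Suc Suc.IH of_nat_Suc unfolding clip_def by linarith
qed

lemma clip_diff:
  assumes "\<bar>fst z - fst z'\<bar> \<le> 3" "\<bar>snd z - snd z'\<bar> \<le> 3"
  shows "\<bar>clip k z' - clip k z\<bar> \<le> (if z \<in> shell k then 1 else 0)"
    and "\<bar>clip k z' - clip k z\<bar> \<le> 83 * exp (2 - real k)"
proof -
  have L: "\<bar>lam z - lam z'\<bar> \<le> 2" "\<bar>lam z - lam z'\<bar> \<le> 83 / exp (lam z)"
    using lam_diff_le[OF assms] by (simp_all add: exp_lam)
  have one: "\<bar>clip k z' - clip k z\<bar> \<le> 1" unfolding clip_def by linarith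
  have lip: "\<bar>clip k z' - clip k z\<bar> \<le> \<bar>lam z - lam z'\<bar>"
    unfolding clip_def by linarith
  have far: "clip k z' = clip k z" if "\<not> (real k - 2 \<le> lam z \<and> lam z \<le> real k + 3)"
    using L(1) that unfolding clip_def by linarith
  have mem: "z \<in> shell k" if "real k - 2 \<le> lam z" "lam z \<le> real k + 3"
  proof -
    define \<mu> where "\<mu> = max \<bar>fst z\<bar> \<bar>snd z\<bar>"
    define X where "X = exp (real k - 2)"
    have \<mu>0: "\<mu> \<ge> 0" by (simp add: \<mu>_def)
    have "X \<le> sqrt (ssq z)" "sqrt (ssq z) \<le> exp (real k + 3)"
      using that by (simp_all add: X_def flip: exp_lam)
    then have X: "X\<^sup>2 \<le> ssq z" and Y: "ssq z \<le> (exp (real k + 3))\<^sup>2"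
      using power_mono[of X "sqrt (ssq z)" 2] power_mono[of "sqrt (ssq z)" "exp (real k + 3)" 2]
        less_imp_le[OF ssq_pos[of z]] by (simp_all add: X_def)
    have sq: "(real_of_int (fst z))\<^sup>2 \<le> (of_int \<mu>)\<^sup>2" "(real_of_int (snd z))\<^sup>2 \<le> (of_int \<mu>)\<^sup>2"
      by (auto simp: \<mu>_def simp flip: abs_le_square_iff)
    have "(of_int \<mu>)\<^sup>2 = (real_of_int (fst z))\<^sup>2 \<or> (of_int \<mu>)\<^sup>2 = (real_of_int (snd z))\<^sup>2"
      by (auto simp: \<mu>_def max_def)
    then have "(real_of_int \<mu>)\<^sup>2 \<le> ssq z"
      using zero_le_power2[of "real_of_int (fst z)"] zero_le_power2[of "real_of_int (snd z)"]
      unfolding ssq_def by linarith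
    then have "(real_of_int \<mu>)\<^sup>2 \<le> (exp (real k + 3))\<^sup>2" using Y by linarith
    then have "real_of_int \<mu> \<le> exp (real k + 3)" by (rule power2_le_imp_le) simp
    then have up: "\<mu> \<le> \<lceil>exp (real k + 3)\<rceil>" by linarith
    have "X\<^sup>2 \<le> 1 + 2 * (of_int \<mu>)\<^sup>2" using X sq unfolding ssq_def by linarith
    \<comment> \<open>\<open>1 + 2 * \<mu>\<^sup>2 \<le> (2 * \<mu>)\<^sup>2\<close> for
      \<open>\<mu> \<ge> 1\<close>, hence the 2 in the inner radius; the floor settles
      \<open>\<mu> = 0\<close>.\<close>
    have lo: "\<lfloor>X / 2\<rfloor> \<le> \<mu>"
    proof (cases "\<mu> = 0")
      case True
      then have "X\<^sup>2 \<le> 1\<^sup>2" using \<open>X\<^sup>2 \<le> 1 + 2 * (of_int \<mu>)\<^sup>2\<close> by simp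
      then have "X \<le> 1" by (rule power2_le_imp_le) simp
      then show ?thesis using True by linarith
    next
      case False
      then have "(1::real) \<le> of_int \<mu>" using \<mu>0 by simp
      then have "(1::real) \<le> (of_int \<mu>)\<^sup>2" by (rule one_le_power)
      then have "X\<^sup>2 \<le> (2 * of_int \<mu>)\<^sup>2"
        using \<open>X\<^sup>2 \<le> 1 + 2 * (of_int \<mu>)\<^sup>2\<close> by (simp add: power_mult_distrib)
      then have "X \<le> 2 * of_int \<mu>" by (rule power2_le_imp_le) (use \<mu>0 in simp)
      then show ?thesis by linarith
    qed
    show ?thesis using up lo by (simp add: shell_def annulus_def \<mu>_def X_def)
  qed
  show "\<bar>clip k z' - clip k z\<bar> \<le> (if z \<in> shell k then 1 else 0)"
    using one far mem by (cases "real k - 2 \<le> lam z \<and> lam z \<le> real k + 3") auto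
  show "\<bar>clip k z' - clip k z\<bar> \<le> 83 * exp (2 - real k)"
  proof (cases "real k - 2 \<le> lam z \<and> lam z \<le> real k + 3")
    case True
    have "83 / exp (lam z) \<le> 83 / exp (real k - 2)"
      using True by (intro divide_left_mono) auto
    also have "\<dots> = 83 * exp (2 - real k)" by (simp add: exp_diff field_simps)
    finally show ?thesis using lip L(2) by linarith
  next
    case False
    then show ?thesis using far by simp
  qed
qed

text \<open>The factor of order exp (2 * k) is the one that the squared gradient of
  \<open>clip k\<close> will compensate.\<close>

lemma shell_poincare:
  "\<exists>c. (\<Sum>z\<in>shell k. (f z - c)\<^sup>2) \<le> 810000 * (exp (real k + 3))\<^sup>2 * (\<Sum>z\<in>shell k. gsq f z)"
proof -
  define a b where "a = \<lfloor>exp (real k - 2) / 2\<rfloor>" and "b = \<lceil>exp (real k + 3)\<rceil>"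
  have a: "0 \<le> a" "real_of_int a \<le> exp (real k - 2) / 2"
    unfolding a_def by (simp, rule of_int_floor_le)
  have b: "exp (real k + 3) \<le> of_int b" "of_int b \<le> exp (real k + 3) + 1"
    unfolding b_def by (rule le_of_int_ceiling, rule of_int_ceiling_le_add_one)
  have "exp (real k - 2) \<le> exp (real k + 3)" by simp
  with a b have "real_of_int (2 * a) \<le> of_int b" unfolding of_int_mult of_int_numeral by linarith
  then have "2 * a \<le> b" by (simp only: of_int_le_iff)
  with a obtain c where c: "(\<Sum>z\<in>annulus a b. (f z - c)\<^sup>2) \<le> 90000 * (of_int (b + 1))\<^sup>2 * (\<Sum>z\<in>annulus a b. gsq f z)"
    using annulus_poincare by blast
  have "1 \<le> exp (real k + 3)" by simp
  then have "real_of_int (b + 1) \<le> 3 * exp (real k + 3)" "0 \<le> real_of_int (b + 1)"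
    using b unfolding of_int_add of_int_1 by linarith+
  then have "(real_of_int (b + 1))\<^sup>2 \<le> (3 * exp (real k + 3))\<^sup>2"
    by (rule power_mono)
  then have "90000 * (of_int (b + 1))\<^sup>2 * (\<Sum>z\<in>annulus a b. gsq f z) \<le> 90000 * (3 * exp (real k + 3))\<^sup>2 * (\<Sum>z\<in>annulus a b. gsq f z)"
    by (intro mult_right_mono mult_left_mono) (auto simp: sum_nonneg)
  with c show ?thesis
    by (intro exI[of _ c]) (simp add: shell_def a_def b_def power_mult_distrib)
qed

text \<open>For \<open>k \<ge> k0 + 7\<close> the inner radius of shell \<open>k\<close> exceeds the
  outer radius of shell \<open>k0\<close>, so a point lies in at most seven shells.\<close>

lemma shell_overlap:
  fixes f :: "'a \<Rightarrow> real"
  assumes "finite S" "\<And>x. x \<in> S \<Longrightarrow> 0 \<le> f x"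
  shows "(\<Sum>k<m. \<Sum>x\<in>{x\<in>S. \<gamma> x \<in> shell k}. f x) \<le> 7 * (\<Sum>x\<in>S. f x)"
proof -
  have card: "card {k\<in>{..<m}. z \<in> shell k} \<le> 7" for z
  proof (cases "{k\<in>{..<m}. z \<in> shell k} = {}")
    case False
    define k0 where "k0 = Min {k\<in>{..<m}. z \<in> shell k}"
    define \<mu> where "\<mu> = max \<bar>fst z\<bar> \<bar>snd z\<bar>"
    have k0: "z \<in> shell k0" using Min_in[of "{k\<in>{..<m}. z \<in> shell k}"] False by (auto simp: k0_def)
    have "{k\<in>{..<m}. z \<in> shell k} \<subseteq> {k0..k0 + 6}"
    proof
      fix k assume k: "k \<in> {k\<in>{..<m}. z \<in> shell k}"
      then have "k0 \<le> k" by (auto simp: k0_def)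
      have "\<lfloor>exp (real k - 2) / 2\<rfloor> \<le> \<mu>" "\<mu> \<le> \<lceil>exp (real k0 + 3)\<rceil>"
        using k k0 by (auto simp: shell_def annulus_def \<mu>_def)
      then have "exp (real k - 2) / 2 < of_int \<mu> + 1" "real_of_int \<mu> < exp (real k0 + 3) + 1"
        by linarith+
      then have "exp (real k - 2) < 2 * exp (real k0 + 3) + 4" by simp
      also have "\<dots> \<le> 6 * exp (real k0 + 3)" using one_le_exp_iff[of "real k0 + 3"] by simp
      also have "\<dots> \<le> (exp 1 * exp 1) * exp (real k0 + 3)"
      proof (intro mult_right_mono)
        have "(6::real) \<le> 2.5 * 2.5" by simp
        also have "\<dots> \<le> exp 1 * exp 1"
          using exp_lower_Taylor_quadratic[of 1] by (intro mult_mono) auto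
        finally show "(6::real) \<le> exp 1 * exp 1" .
      qed simp
      also have "\<dots> = exp (real k0 + 5)" by (simp add: mult_exp_exp algebra_simps)
      finally have "real k < real (k0 + 7)" by simp
      then show "k \<in> {k0..k0 + 6}" using \<open>k0 \<le> k\<close> by auto
    qed
    then have "card {k\<in>{..<m}. z \<in> shell k} \<le> card {k0..k0 + 6}" by (rule card_mono[rotated]) simp
    then show ?thesis by simp
  next
    case True
    show ?thesis unfolding True by simp
  qed
  have "(\<Sum>k<m. \<Sum>x\<in>{x\<in>S. \<gamma> x \<in> shell k}. f x) = (\<Sum>k<m. \<Sum>x\<in>S. if \<gamma> x \<in> shell k then f x else 0)"
    using assms by (simp add: sum.inter_filter)
  also have "\<dots> = (\<Sum>x\<in>S. \<Sum>k<m. if \<gamma> x \<in> shell k then f x else 0)"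
    by (rule sum.swap)
  also have "\<dots> = (\<Sum>x\<in>S. real (card {k\<in>{..<m}. \<gamma> x \<in> shell k}) * f x)"
    by (intro sum.cong refl) (simp flip: sum.inter_filter)
  also have "\<dots> \<le> (\<Sum>x\<in>S. 7 * f x)"
    using card assms by (intro sum_mono mult_right_mono) (auto simp: numeral_le_real_of_nat_iff)
  finally show ?thesis by (simp add: sum_distrib_left)
qed

text \<open>In 21 = 3 * 7, the 3 counts the neighbours of a cell and the 7 is the overlap of the
  shells, whose root occurs once for \<open>y\<close> and once for \<open>e\<close>. Under the root,
  the first 2 stands for the sampling error; the rest is the Poincare constant times the squared
  gradient of \<open>clip k\<close>, where exp (2 * k) has cancelled.\<close>

definition green_const :: real where
  "green_const = 21 * sqrt (2 + 2 * (83 * exp 2)\<^sup>2 * 810000 * (exp 3)\<^sup>2)"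

text \<open>
  \<open>q K L\<close> is the flux from the cell \<open>K\<close> to its neighbour \<open>L\<close>, and \<open>\<gamma> K\<close> the grid point at which \<open>K\<close> is located.
\<close>

locale upwind_flow =
  fixes T :: "'c set" and N :: "'c \<Rightarrow> 'c set" and q :: "'c \<Rightarrow> 'c \<Rightarrow> real" and y :: "'c \<Rightarrow> real"
    and \<gamma> :: "'c \<Rightarrow> int \<times> int" and n :: nat
  assumes finite_T: "finite T"
    and N_sub: "K \<in> T \<Longrightarrow> N K \<subseteq> T"
    and N_sym: "K \<in> T \<Longrightarrow> L \<in> N K \<Longrightarrow> K \<in> N L"
    and card_N: "K \<in> T \<Longrightarrow> card (N K) \<le> 3"
    and q_anti: "K \<in> T \<Longrightarrow> L \<in> N K \<Longrightarrow> q L K = - q K L"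
    and q_sum: "K \<in> T \<Longrightarrow> (\<Sum>L\<in>N K. q K L) = 0"
    and q_le: "K \<in> T \<Longrightarrow> L \<in> N K \<Longrightarrow> \<bar>q K L\<bar> \<le> y K"
    and y_nonneg: "K \<in> T \<Longrightarrow> 0 \<le> y K"
    and near: "K \<in> T \<Longrightarrow> L \<in> N K \<Longrightarrow> \<bar>fst (\<gamma> K) - fst (\<gamma> L)\<bar> \<le> 3"
      "K \<in> T \<Longrightarrow> L \<in> N K \<Longrightarrow> \<bar>snd (\<gamma> K) - snd (\<gamma> L)\<bar> \<le> 3"
    and mult: "card {K\<in>T. \<gamma> K = z} \<le> n"
begin

text \<open>
  By \<open>q_sum\<close>, subtracting \<open>v K\<close> turns the upwind flux \<open>q\<^sup>+ v K + q\<^sup>- v L\<close> out of \<open>K\<close> into \<open>q\<^sup>- (v L - v K)\<close>.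
\<close>

definition upw :: "('c \<Rightarrow> real) \<Rightarrow> ('c \<Rightarrow> real) \<Rightarrow> real" where
  "upw v w = (\<Sum>K\<in>T. \<Sum>L\<in>N K. w K * (min (q K L) 0 * (v L - v K)))"

text \<open>\<open>e\<close> is an energy density on the grid that dominates at once the sampling
  error, the differences between adjacent cells and the gradient of the sampled function
  \<open>vg\<close>. The bounds below use only its sums over finite sets.\<close>

definition approx :: "('c \<Rightarrow> real) \<Rightarrow> (int \<times> int \<Rightarrow> real) \<Rightarrow> (int \<times> int \<Rightarrow> real) \<Rightarrow> bool" where
  "approx v vg e \<longleftrightarrow> (\<forall>K\<in>T. (v K - vg (\<gamma> K))\<^sup>2 \<le> e (\<gamma> K)) \<and>
     (\<forall>K\<in>T. \<forall>L\<in>N K. (v L - v K)\<^sup>2 \<le> e (\<gamma> K)) \<and> (\<forall>z. gsq vg z \<le> e z)"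

section \<open>Bounds on the upwind form\<close>

lemma N_in: "K \<in> T \<Longrightarrow> L \<in> N K \<Longrightarrow> L \<in> T"
  using N_sub by blast

lemma finite_N: "K \<in> T \<Longrightarrow> finite (N K)"
  using finite_T N_sub finite_subset by blast

lemma approx_nonneg: "approx v vg e \<Longrightarrow> 0 \<le> e z"
  using order_trans[OF gsq_nonneg] unfolding approx_def by blast

lemma approx_abs:
  assumes "approx v vg e" "K \<in> T"
  shows "\<bar>v K - vg (\<gamma> K)\<bar> \<le> sqrt (e (\<gamma> K))" "L \<in> N K \<Longrightarrow> \<bar>v L - v K\<bar> \<le> sqrt (e (\<gamma> K))"
  using assms unfolding approx_def by (metis real_sqrt_abs real_sqrt_le_mono)+

lemma sum_swap: "(\<Sum>K\<in>T. \<Sum>L\<in>N K. f K L) = (\<Sum>K\<in>T. \<Sum>L\<in>N K. f L K)" for f :: "'c \<Rightarrow> 'c \<Rightarrow> real"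
proof -
  have "(\<Sum>K\<in>T. \<Sum>L\<in>N K. f K L) = (\<Sum>(K, L)\<in>Sigma T N. f K L)"
    using finite_T finite_N by (simp add: sum.Sigma)
  also have "\<dots> = (\<Sum>(K, L)\<in>Sigma T N. f L K)"
    by (rule sum.reindex_bij_witness[of _ prod.swap prod.swap]) (auto simp: N_sym intro: N_in)
  also have "\<dots> = (\<Sum>K\<in>T. \<Sum>L\<in>N K. f L K)"
    using finite_T finite_N by (simp add: sum.Sigma)
  finally show ?thesis .
qed

lemma sum_nbr_le:
  fixes f :: "'c \<Rightarrow> 'c \<Rightarrow> real"
  assumes "\<And>K L. K \<in> T \<Longrightarrow> L \<in> N K \<Longrightarrow> f K L \<le> g K" "\<And>K. K \<in> T \<Longrightarrow> 0 \<le> g K"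
  shows "(\<Sum>K\<in>T. \<Sum>L\<in>N K. f K L) \<le> (\<Sum>K\<in>T. 3 * g K)"
proof (rule sum_mono)
  fix K assume K: "K \<in> T"
  have "(\<Sum>L\<in>N K. f K L) \<le> (\<Sum>L\<in>N K. g K)" using assms K by (intro sum_mono)
  also have "\<dots> = real (card (N K)) * g K" by simp
  also have "\<dots> \<le> 3 * g K"
    using card_N[OF K] assms(2)[OF K] by (intro mult_right_mono) auto
  finally show "(\<Sum>L\<in>N K. f K L) \<le> 3 * g K" .
qed

lemma sum_fibers_le:
  assumes "S \<subseteq> T" "finite Z" "\<gamma> ` S \<subseteq> Z" "\<And>z. 0 \<le> f z"
  shows "(\<Sum>K\<in>S. f (\<gamma> K)) \<le> real n * (\<Sum>z\<in>Z. f z)"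
proof -
  have fS: "finite S" using assms finite_T finite_subset by blast
  have "(\<Sum>K\<in>S. f (\<gamma> K)) = (\<Sum>z\<in>\<gamma> ` S. \<Sum>K\<in>{K\<in>S. \<gamma> K = z}. f (\<gamma> K))"
    by (rule sum.image_gen[OF fS])
  also have "\<dots> = (\<Sum>z\<in>\<gamma> ` S. real (card {K\<in>S. \<gamma> K = z}) * f z)"
    by (intro sum.cong refl) simp
  also have "\<dots> \<le> (\<Sum>z\<in>\<gamma> ` S. real n * f z)"
  proof (intro sum_mono mult_right_mono)
    fix z
    have "card {K\<in>S. \<gamma> K = z} \<le> card {K\<in>T. \<gamma> K = z}"
      using assms finite_T by (intro card_mono) auto
    then show "real (card {K\<in>S. \<gamma> K = z}) \<le> real n" using mult[of z] by linarith
  qed (use assms in auto)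
  also have "\<dots> \<le> (\<Sum>z\<in>Z. real n * f z)" using assms by (intro sum_mono2) auto
  finally show ?thesis by (simp add: sum_distrib_left)
qed

text \<open>Conservation moves the upwind difference quotient to the test function, up to an arbitrary constant.\<close>

lemma upw_dual: "upw v w = - (\<Sum>K\<in>T. \<Sum>L\<in>N K. max (q K L) 0 * ((v K - c) * (w L - w K)))"
proof -
  define S where "S f = (\<Sum>K\<in>T. \<Sum>L\<in>N K. f K L)" for f :: "'c \<Rightarrow> 'c \<Rightarrow> real"
  have swp: "S f = S (\<lambda>K L. f L K)" for f unfolding S_def by (rule sum_swap)
  have cong: "S f = S g" if "\<And>K L. K \<in> T \<Longrightarrow> L \<in> N K \<Longrightarrow> f K L = g K L" for f g
    unfolding S_def using that by (intro sum.cong) auto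
  have add: "S (\<lambda>K L. f K L + g K L) = S f + S g" for f g
    by (simp add: S_def sum.distrib)
  have neg: "S (\<lambda>K L. - f K L) = - S f" for f
    by (simp add: S_def sum_negf)
  have zero: "S (\<lambda>K L. q K L * f K) = 0" for f
    unfolding S_def by (rule sum.neutral, rule ballI) (simp only: q_sum sum_distrib_right[symmetric] mult_zero_left)
  \<comment> \<open>Exchanging the two cells turns inflow into outflow, as the flux is
    antisymmetric.\<close>
  have flip: "S (\<lambda>K L. min (q K L) 0 * f K L) = - S (\<lambda>K L. max (q K L) 0 * f L K)" for f
  proof -
    have "S (\<lambda>K L. min (q K L) 0 * f K L) = S (\<lambda>K L. min (q L K) 0 * f L K)"
      by (rule swp)
    also have "\<dots> = S (\<lambda>K L. - (max (q K L) 0 * f L K))"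
      by (rule cong) (simp add: q_anti min_def max_def)
    finally show ?thesis by (simp add: neg)
  qed
  \<comment> \<open>With a factor that depends on \<open>K\<close> only, inflow and outflow balance
    by \<open>q_sum\<close>.\<close>
  have mm: "S (\<lambda>K L. min (q K L) 0 * f K) = - S (\<lambda>K L. max (q K L) 0 * f K)" for f
  proof -
    have "S (\<lambda>K L. q K L * f K) = S (\<lambda>K L. min (q K L) 0 * f K + max (q K L) 0 * f K)"
      by (rule cong) (simp add: min_def max_def)
    then show ?thesis using zero[of f] by (simp add: add)
  qed
  have "upw v w = S (\<lambda>K L. min (q K L) 0 * (w K * v L) + - (min (q K L) 0 * (w K * v K)))"
    unfolding upw_def S_def by (simp add: algebra_simps)
  also have "\<dots> = - S (\<lambda>K L. max (q K L) 0 * (w L * v K)) + S (\<lambda>K L. max (q K L) 0 * (w K * v K))"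
    using flip[of "\<lambda>K L. w K * v L"] mm[of "\<lambda>K. w K * v K"] by (simp only: add neg)
  finally have 1: "upw v w = - S (\<lambda>K L. max (q K L) 0 * (w L * v K)) + S (\<lambda>K L. max (q K L) 0 * (w K * v K))" .
  \<comment> \<open>The two conservation rules together make the contribution of the constant
    \<open>c\<close> vanish.\<close>
  have "S (\<lambda>K L. max (q K L) 0 * (c * w L)) = S (\<lambda>K L. max (q K L) 0 * (c * w K))"
    using flip[of "\<lambda>K L. c * w K"] mm[of "\<lambda>K. c * w K"] by simp
  moreover have "S (\<lambda>K L. max (q K L) 0 * ((v K - c) * (w L - w K))) =
      S (\<lambda>K L. max (q K L) 0 * (w L * v K)) + - S (\<lambda>K L. max (q K L) 0 * (w K * v K)) +
      (- S (\<lambda>K L. max (q K L) 0 * (c * w L)) + S (\<lambda>K L. max (q K L) 0 * (c * w K)))"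
    unfolding add[symmetric] neg[symmetric] by (rule cong) (simp add: algebra_simps)
  ultimately show ?thesis using 1 by (simp add: S_def)
qed

lemma abs_upw_le:
  assumes "\<And>K. K \<in> T \<Longrightarrow> \<bar>w K\<bar> \<le> W K" "approx v vg e"
  shows "\<bar>upw v w\<bar> \<le> (\<Sum>K\<in>T. 3 * (y K * W K * sqrt (e (\<gamma> K))))"
proof -
  have "\<bar>upw v w\<bar> \<le> (\<Sum>K\<in>T. \<Sum>L\<in>N K. \<bar>w K * (min (q K L) 0 * (v L - v K))\<bar>)"
    unfolding upw_def by (intro order_trans[OF sum_abs] sum_mono sum_abs)
  also have "\<dots> \<le> (\<Sum>K\<in>T. 3 * (y K * W K * sqrt (e (\<gamma> K))))"
  proof (rule sum_nbr_le)
    fix K L assume KL: "K \<in> T" "L \<in> N K"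
    have W: "\<bar>w K\<bar> \<le> W K" "0 \<le> W K" using assms(1)[OF KL(1)] by auto
    define p where "p = min (q K L) 0"
    have "\<bar>p\<bar> \<le> y K" using q_le[OF KL] y_nonneg[OF KL(1)] by (auto simp: p_def min_def)
    then have "\<bar>w K\<bar> * (\<bar>p\<bar> * \<bar>v L - v K\<bar>) \<le> W K * (y K * sqrt (e (\<gamma> K)))"
      using W approx_abs(2)[OF assms(2) KL] y_nonneg[OF KL(1)] by (intro mult_mono) auto
    then show "\<bar>w K * (min (q K L) 0 * (v L - v K))\<bar> \<le> y K * W K * sqrt (e (\<gamma> K))"
      by (simp add: abs_mult mult_ac flip: p_def)
  next
    fix K assume K: "K \<in> T"
    then have "0 \<le> W K" using assms(1)[OF K] by auto
    then show "0 \<le> y K * W K * sqrt (e (\<gamma> K))"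
      using K y_nonneg approx_nonneg[OF assms(2)] by auto
  qed
  finally show ?thesis .
qed

lemma sum_energy_le:
  assumes "approx v vg e" "\<And>F. finite F \<Longrightarrow> sum e F \<le> E"
  shows "(\<Sum>K\<in>T. e (\<gamma> K)) \<le> real n * E"
proof -
  have "(\<Sum>K\<in>T. e (\<gamma> K)) \<le> real n * (\<Sum>z\<in>\<gamma> ` T. e z)"
    using finite_T approx_nonneg[OF assms(1)] by (intro sum_fibers_le) auto
  also have "\<dots> \<le> real n * E" using finite_T by (intro mult_left_mono assms) auto
  finally show ?thesis .
qed

text \<open>Cauchy-Schwarz without any cancellation; this is the supremum bound on which the duality
  rests.\<close>

lemma upw_sup_le:
  assumes "\<And>K. K \<in> T \<Longrightarrow> \<bar>w K\<bar> \<le> W" "0 \<le> W" "approx v vg e" "\<And>F. finite F \<Longrightarrow> sum e F \<le> E"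
  shows "\<bar>upw v w\<bar> \<le> 3 * (sqrt (real n) * sqrt (\<Sum>K\<in>T. (y K)\<^sup>2) * sqrt E) * W"
proof -
  have "\<bar>upw v w\<bar> \<le> (\<Sum>K\<in>T. 3 * (y K * W * sqrt (e (\<gamma> K))))"
    by (rule abs_upw_le) (use assms in auto)
  also have "\<dots> = 3 * W * (\<Sum>K\<in>T. sqrt ((y K)\<^sup>2) * sqrt (e (\<gamma> K)))"
    using y_nonneg by (simp add: sum_distrib_left mult_ac)
  also have "\<dots> \<le> 3 * W * (sqrt (\<Sum>K\<in>T. (y K)\<^sup>2) * sqrt (\<Sum>K\<in>T. e (\<gamma> K)))"
    using assms(2) approx_nonneg[OF assms(3)] by (intro mult_left_mono sum_sqrt_mult_le) auto
  also have "\<dots> \<le> 3 * W * (sqrt (\<Sum>K\<in>T. (y K)\<^sup>2) * sqrt (real n * E))"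
    using assms(2) sum_energy_le[OF assms(3,4)] by (intro mult_left_mono) (auto simp: sum_nonneg)
  finally show ?thesis by (simp add: real_sqrt_mult mult_ac)
qed

text \<open>The bound is free of \<open>m\<close>. Each shell contributes at most a constant times
  \<open>sqrt (Y k) * sqrt (R k)\<close>, the flux and the energy located there, with a constant
  independent of \<open>k\<close>. Cauchy-Schwarz in \<open>k\<close> and
  \<open>shell_overlap\<close> sum these at the price of a factor 7.\<close>

lemma upw_green_origin:
  assumes ap: "approx v vg e" and E: "\<And>F. finite F \<Longrightarrow> sum e F \<le> E"
  shows "\<bar>upw v (\<lambda>K. max 0 (real m - lam (\<gamma> K)))\<bar> \<le> green_const * (sqrt (real n) * sqrt (\<Sum>K\<in>T. (y K)\<^sup>2) * sqrt E)"
proof -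
  define D where "D = 2 + 2 * (83 * exp 2)\<^sup>2 * 810000 * (exp 3 :: real)\<^sup>2"
  have en: "0 \<le> e z" for z using approx_nonneg[OF ap] .
  define Tk where "Tk k = {K\<in>T. \<gamma> K \<in> shell k}" for k
  define Y where "Y k = (\<Sum>K\<in>Tk k. (y K)\<^sup>2)" for k
  define R where "R k = real n * D * (\<Sum>z\<in>shell k. e z)" for k
  have D0: "D \<ge> 0" by (simp add: D_def)
  have Tk: "finite (Tk k)" "Tk k \<subseteq> T" for k using finite_T by (auto simp: Tk_def)
  have step: "\<bar>upw v (\<lambda>K. clip k (\<gamma> K))\<bar> \<le> 3 * (sqrt (Y k) * sqrt (R k))" for k
  proof -
    obtain c where c: "(\<Sum>z\<in>shell k. (vg z - c)\<^sup>2) \<le> 810000 * (exp (real k + 3))\<^sup>2 * (\<Sum>z\<in>shell k. gsq vg z)"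
      using shell_poincare by blast
    define \<delta> where "\<delta> = 83 * exp (2 - real k)"
    \<comment> \<open>Dominates \<open>v K - c\<close> times the change of \<open>clip k\<close>:
      the sampling error, already square summable, is paired with the bound 1 for this change, and
      the deviation of \<open>vg\<close> from \<open>c\<close> with the gradient bound
      \<open>\<delta>\<close>.\<close>
    define r where "r K = sqrt (e (\<gamma> K)) + \<delta> * \<bar>vg (\<gamma> K) - c\<bar>" for K
    have r0: "r K \<ge> 0" for K by (simp add: r_def \<delta>_def en)
    have "\<bar>upw v (\<lambda>K. clip k (\<gamma> K))\<bar> \<le> (\<Sum>K\<in>T. \<Sum>L\<in>N K. \<bar>max (q K L) 0 * ((v K - c) * (clip k (\<gamma> L) - clip k (\<gamma> K)))\<bar>)"
      unfolding upw_dual[of v _ c] abs_minus_cancel by (intro order_trans[OF sum_abs] sum_mono sum_abs)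
    also have "\<dots> \<le> (\<Sum>K\<in>T. 3 * (if \<gamma> K \<in> shell k then y K * r K else 0))"
    proof (rule sum_nbr_le)
      fix K L assume KL: "K \<in> T" "L \<in> N K"
      note cd = clip_diff[OF near[OF KL], of k]
      define d where "d = \<bar>clip k (\<gamma> L) - clip k (\<gamma> K)\<bar>"
      show "\<bar>max (q K L) 0 * ((v K - c) * (clip k (\<gamma> L) - clip k (\<gamma> K)))\<bar> \<le> (if \<gamma> K \<in> shell k then y K * r K else 0)"
      proof (cases "\<gamma> K \<in> shell k")
        case True
        have d: "0 \<le> d" "d \<le> 1" "d \<le> \<delta>" using cd True by (auto simp: d_def \<delta>_def)
        have "\<bar>v K - c\<bar> * d \<le> (\<bar>v K - vg (\<gamma> K)\<bar> + \<bar>vg (\<gamma> K) - c\<bar>) * d"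
          using d by (intro mult_right_mono) auto
        also have "\<dots> = \<bar>v K - vg (\<gamma> K)\<bar> * d + d * \<bar>vg (\<gamma> K) - c\<bar>" by (simp add: algebra_simps)
        also have "\<dots> \<le> sqrt (e (\<gamma> K)) * 1 + \<delta> * \<bar>vg (\<gamma> K) - c\<bar>"
          using d approx_abs(1)[OF ap KL(1)] en by (intro add_mono mult_mono) auto
        finally have "\<bar>v K - c\<bar> * d \<le> r K" by (simp add: r_def)
        moreover define p where "p = max (q K L) 0"
        moreover have "\<bar>p\<bar> \<le> y K" using q_le[OF KL] y_nonneg[OF KL(1)] by (auto simp: p_def max_def)
        ultimately have "\<bar>p\<bar> * (\<bar>v K - c\<bar> * d) \<le> y K * r K"
          using d y_nonneg[OF KL(1)] by (intro mult_mono) auto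
        then show ?thesis using True by (simp add: abs_mult d_def flip: p_def)
      next
        case False
        then show ?thesis using cd by simp
      qed
    next
      fix K assume "K \<in> T"
      then show "0 \<le> (if \<gamma> K \<in> shell k then y K * r K else 0)"
        using y_nonneg r0 by auto
    qed
    also have "\<dots> = 3 * (\<Sum>K\<in>Tk k. y K * r K)"
      using finite_T by (simp add: Tk_def sum.inter_filter flip: sum_distrib_left)
    also have "(\<Sum>K\<in>Tk k. y K * r K) = (\<Sum>K\<in>Tk k. sqrt ((y K)\<^sup>2) * sqrt ((r K)\<^sup>2))"
    proof (rule sum.cong)
      fix K assume "K \<in> Tk k"
      then have "0 \<le> y K" using y_nonneg by (simp add: Tk_def)
      then show "y K * r K = sqrt ((y K)\<^sup>2) * sqrt ((r K)\<^sup>2)" using r0 by simp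
    qed simp
    also have "\<dots> \<le> sqrt (Y k) * sqrt (\<Sum>K\<in>Tk k. (r K)\<^sup>2)"
      unfolding Y_def by (intro sum_sqrt_mult_le) auto
    also have "(\<Sum>K\<in>Tk k. (r K)\<^sup>2) \<le> R k"
    proof -
      have "(\<Sum>K\<in>Tk k. (r K)\<^sup>2) \<le> (\<Sum>K\<in>Tk k. 2 * e (\<gamma> K) + 2 * \<delta>\<^sup>2 * (vg (\<gamma> K) - c)\<^sup>2)"
      proof (rule sum_mono)
        fix K
        have "(r K)\<^sup>2 \<le> 2 * (sqrt (e (\<gamma> K)))\<^sup>2 + 2 * (\<delta> * \<bar>vg (\<gamma> K) - c\<bar>)\<^sup>2"
          unfolding r_def using zero_le_power2[of "sqrt (e (\<gamma> K)) - \<delta> * \<bar>vg (\<gamma> K) - c\<bar>"]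
          by (simp add: power2_sum power2_diff)
        then show "(r K)\<^sup>2 \<le> 2 * e (\<gamma> K) + 2 * \<delta>\<^sup>2 * (vg (\<gamma> K) - c)\<^sup>2"
          using en by (simp add: power_mult_distrib)
      qed
      also have "\<dots> \<le> real n * (\<Sum>z\<in>shell k. 2 * e z + 2 * \<delta>\<^sup>2 * (vg z - c)\<^sup>2)"
        by (rule sum_fibers_le) (use Tk en in \<open>auto simp: Tk_def\<close>)
      also have "(\<Sum>z\<in>shell k. 2 * e z + 2 * \<delta>\<^sup>2 * (vg z - c)\<^sup>2) = 2 * (\<Sum>z\<in>shell k. e z) + 2 * \<delta>\<^sup>2 * (\<Sum>z\<in>shell k. (vg z - c)\<^sup>2)"
        by (simp add: sum.distrib sum_distrib_left)
      also have "\<dots> \<le> 2 * (\<Sum>z\<in>shell k. e z) + 2 * \<delta>\<^sup>2 * (810000 * (exp (real k + 3))\<^sup>2 * (\<Sum>z\<in>shell k. e z))"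
      proof -
        have "(\<Sum>z\<in>shell k. gsq vg z) \<le> (\<Sum>z\<in>shell k. e z)"
          using ap by (intro sum_mono) (auto simp: approx_def)
        then have "810000 * (exp (real k + 3))\<^sup>2 * (\<Sum>z\<in>shell k. gsq vg z) \<le> 810000 * (exp (real k + 3))\<^sup>2 * (\<Sum>z\<in>shell k. e z)"
          by (intro mult_left_mono) auto
        then show ?thesis using order_trans[OF c] by (intro add_left_mono mult_left_mono) auto
      qed
      also have "\<dots> = D * (\<Sum>z\<in>shell k. e z)"
      proof -
        \<comment> \<open>Scale invariance: \<open>k\<close> disappears here.\<close>
        have "\<delta> * exp (real k + 3) = 83 * exp 2 * exp 3"
          by (simp add: \<delta>_def mult_exp_exp)
        then have eq: "\<delta>\<^sup>2 * (exp (real k + 3))\<^sup>2 = (83 * exp 2)\<^sup>2 * (exp 3)\<^sup>2"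
          by (metis power_mult_distrib)
        have "2 * (\<Sum>z\<in>shell k. e z) + 2 * \<delta>\<^sup>2 * (810000 * (exp (real k + 3))\<^sup>2 * (\<Sum>z\<in>shell k. e z)) =
            2 * (\<Sum>z\<in>shell k. e z) + 1620000 * (\<delta>\<^sup>2 * (exp (real k + 3))\<^sup>2) * (\<Sum>z\<in>shell k. e z)"
          by simp
        also have "\<dots> = D * (\<Sum>z\<in>shell k. e z)"
          unfolding eq D_def by (simp add: algebra_simps)
        finally show ?thesis .
      qed
      finally show ?thesis using D0 by (simp add: R_def mult_left_mono mult.assoc)
    qed
    finally show ?thesis
      by (simp add: Y_def mult_left_mono sum_nonneg)
  qed
  have "upw v (\<lambda>K. max 0 (real m - lam (\<gamma> K))) = (\<Sum>k<m. upw v (\<lambda>K. clip k (\<gamma> K)))"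
    unfolding sum_clip[symmetric] upw_def sum_distrib_right
    by (subst (2) sum.swap, intro sum.cong refl, subst sum.swap) simp
  also have "\<bar>\<dots>\<bar> \<le> (\<Sum>k<m. 3 * (sqrt (Y k) * sqrt (R k)))"
    by (rule order_trans[OF sum_abs]) (intro sum_mono step)
  also have "\<dots> \<le> 3 * (sqrt (\<Sum>k<m. Y k) * sqrt (\<Sum>k<m. R k))"
    unfolding sum_distrib_left[symmetric]
    by (intro mult_left_mono sum_sqrt_mult_le) (auto simp: Y_def R_def D0 en sum_nonneg)
  also have "\<dots> \<le> 3 * (sqrt (7 * (\<Sum>K\<in>T. (y K)\<^sup>2)) * sqrt (7 * (real n * D * E)))"
  proof (intro mult_left_mono mult_mono real_sqrt_le_mono)
    show "(\<Sum>k<m. Y k) \<le> 7 * (\<Sum>K\<in>T. (y K)\<^sup>2)"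
      unfolding Y_def Tk_def by (rule shell_overlap) (use finite_T in auto)
    define Z where "Z = (\<Union>k<m. shell k)"
    have "(\<Sum>k<m. \<Sum>z\<in>shell k. e z) = (\<Sum>k<m. \<Sum>z\<in>{z\<in>Z. z \<in> shell k}. e z)"
      by (intro sum.cong refl) (auto simp: Z_def)
    also have "\<dots> \<le> 7 * (\<Sum>z\<in>Z. e z)"
      by (rule shell_overlap) (auto simp: Z_def en)
    also have "\<dots> \<le> 7 * E" using E[of Z] by (simp add: Z_def)
    finally show "(\<Sum>k<m. R k) \<le> 7 * (real n * D * E)"
      unfolding R_def sum_distrib_left[symmetric] using D0
      by (simp add: mult_left_mono mult.left_commute[of 7])
  qed (auto simp: sum_nonneg Y_def R_def D0 en)
  also have "\<dots> = green_const * (sqrt (real n) * sqrt (\<Sum>K\<in>T. (y K)\<^sup>2) * sqrt E)"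
    unfolding green_const_def D_def[symmetric] by (simp add: real_sqrt_mult mult_ac)
  finally show ?thesis .
qed

text \<open>The assumptions see \<open>\<gamma>\<close> only through differences and the sizes of
  fibers, so any grid point may be taken as the origin.\<close>

lemma shifted: "upwind_flow T N q y (\<lambda>K. \<gamma> K - z\<^sub>0) n"
proof
  show "card {K\<in>T. \<gamma> K - z\<^sub>0 = z} \<le> n" for z
    using mult[of "z + z\<^sub>0"] by (simp add: diff_eq_eq)
qed (use finite_T N_sub N_sym card_N q_anti q_sum q_le y_nonneg near in auto)

lemma upw_green:
  assumes ap: "approx v vg e" and E: "\<And>F. finite F \<Longrightarrow> sum e F \<le> E"
  shows "\<bar>upw v (\<lambda>K. green m z\<^sub>0 (\<gamma> K))\<bar> \<le> green_const * (sqrt (real n) * sqrt (\<Sum>K\<in>T. (y K)\<^sup>2) * sqrt E)"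
proof -
  interpret s: upwind_flow T N q y "\<lambda>K. \<gamma> K - z\<^sub>0" n by (rule shifted)
  have "gsq (\<lambda>z. vg (z + z\<^sub>0)) z = gsq vg (z + z\<^sub>0)" for z
    by (cases z; cases z\<^sub>0) (simp add: gsq_def add_ac)
  then have "s.approx v (\<lambda>z. vg (z + z\<^sub>0)) (\<lambda>z. e (z + z\<^sub>0))"
    using ap by (simp add: s.approx_def approx_def del: split_paired_All)
  moreover have "(\<Sum>z\<in>F. e (z + z\<^sub>0)) \<le> E" if "finite F" for F
    using E[of "(\<lambda>z. z + z\<^sub>0) ` F"] that by (simp add: sum.reindex inj_on_def)
  ultimately show ?thesis
    using s.upw_green_origin[of v "\<lambda>z. vg (z + z\<^sub>0)" "\<lambda>z. e (z + z\<^sub>0)" E m]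
    by (simp add: green_def)
qed

text \<open>The test function is split into its grid sampling, handled by duality, and a local remainder.\<close>

lemma upw_bound:
  assumes C: "\<forall>m M P l A.
     2 * exp (real m) \<le> of_int M \<longrightarrow> of_int (M - 1) \<le> 2 * exp (real m) \<longrightarrow>
     (\<forall>z\<in>P. real_of_int \<bar>fst z\<bar> \<le> exp m \<and> real_of_int \<bar>snd z\<bar> \<le> exp m) \<longrightarrow>
     (\<forall>f g t. l (\<lambda>x. f x + t * g x) = l f + t * l g) \<longrightarrow>
     (\<forall>g W. (\<forall>z\<in>P. \<bar>g z\<bar> \<le> W) \<longrightarrow> \<bar>l g\<bar> \<le> A * W) \<longrightarrow>
     (\<forall>z\<^sub>0\<in>P. \<bar>l (green m z\<^sub>0)\<bar> \<le> A) \<longrightarrow> A \<ge> 0 \<longrightarrow>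
     (\<forall>g. (\<forall>z. z \<notin> gbox M \<longrightarrow> g z = 0) \<longrightarrow> \<bar>l g\<bar> \<le> C * A * sqrt (\<Sum>z\<in>gbox (M + 1). gsq g z))"
    and "0 \<le> C"
    and ap: "approx v vg e" "approx w wg e'" and fin: "finite {z. wg z \<noteq> 0}"
    and E: "\<And>F. finite F \<Longrightarrow> sum e F \<le> E" and E': "\<And>F. finite F \<Longrightarrow> sum e' F \<le> E'"
  shows "\<bar>upw v w\<bar> \<le> (C * green_const + 3) * real n * sqrt (\<Sum>K\<in>T. (y K)\<^sup>2) * sqrt E * sqrt E'"
proof -
  define U where "U = sqrt (\<Sum>K\<in>T. (y K)\<^sup>2)"
  have U0: "U \<ge> 0" by (simp add: U_def sum_nonneg)
  have EE: "0 \<le> E" "0 \<le> E'" using E[of "{}"] E'[of "{}"] by auto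
  have en: "0 \<le> e z" "0 \<le> e' z" for z using approx_nonneg ap by blast+
  have upw_add: "upw v (\<lambda>K. f K + t * g K) = upw v f + t * upw v g" for f g t
    by (simp add: upw_def sum_distrib_left algebra_simps flip: sum.distrib)
  have gc: "green_const \<ge> 3"
  proof -
    have "0 \<le> 2 * (83 * exp 2)\<^sup>2 * 810000 * (exp (3::real))\<^sup>2" by simp
    then have "sqrt 1 \<le> sqrt (2 + 2 * (83 * exp 2)\<^sup>2 * 810000 * (exp (3::real))\<^sup>2)"
      by (intro real_sqrt_le_mono) linarith
    then show ?thesis unfolding green_const_def real_sqrt_one by linarith
  qed
  have rem: "\<bar>upw v (\<lambda>K. w K - wg (\<gamma> K))\<bar> \<le> 3 * real n * U * sqrt E * sqrt E'"
  proof -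
    have "\<bar>upw v (\<lambda>K. w K - wg (\<gamma> K))\<bar> \<le> (\<Sum>K\<in>T. 3 * (y K * sqrt (e' (\<gamma> K)) * sqrt (e (\<gamma> K))))"
      by (rule abs_upw_le[OF _ ap(1)]) (rule approx_abs(1)[OF ap(2)])
    also have "\<dots> \<le> (\<Sum>K\<in>T. 3 * (U * (sqrt (e (\<gamma> K)) * sqrt (e' (\<gamma> K)))))"
    proof (rule sum_mono)
      fix K assume K: "K \<in> T"
      \<comment> \<open>Both sampled functions contribute a square root of a local energy to the
        remainder, so \<open>y\<close> may be estimated by its supremum, which is at most
        \<open>U\<close>.\<close>
      have "(y K)\<^sup>2 \<le> (\<Sum>K\<in>T. (y K)\<^sup>2)" using K finite_T by (intro member_le_sum) auto
      then have "y K \<le> U" unfolding U_def by (rule real_le_rsqrt)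
      then have "y K * (sqrt (e (\<gamma> K)) * sqrt (e' (\<gamma> K))) \<le> U * (sqrt (e (\<gamma> K)) * sqrt (e' (\<gamma> K)))"
        using en by (intro mult_right_mono) auto
      then show "3 * (y K * sqrt (e' (\<gamma> K)) * sqrt (e (\<gamma> K))) \<le> 3 * (U * (sqrt (e (\<gamma> K)) * sqrt (e' (\<gamma> K))))"
        by (simp add: mult_ac)
    qed
    also have "\<dots> = 3 * U * (\<Sum>K\<in>T. sqrt (e (\<gamma> K)) * sqrt (e' (\<gamma> K)))"
      by (simp add: sum_distrib_left mult.assoc)
    also have "\<dots> \<le> 3 * U * (sqrt (\<Sum>K\<in>T. e (\<gamma> K)) * sqrt (\<Sum>K\<in>T. e' (\<gamma> K)))"
      using U0 en by (intro mult_left_mono sum_sqrt_mult_le) auto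
    also have "\<dots> \<le> 3 * U * (sqrt (real n * E) * sqrt (real n * E'))"
      using U0 EE sum_energy_le[OF ap(1) E] sum_energy_le[OF ap(2) E'] en
      by (intro mult_left_mono mult_mono real_sqrt_le_mono) (auto simp: sum_nonneg)
    also have "\<dots> = 3 * real n * U * sqrt E * sqrt E'"
      by (simp add: real_sqrt_mult)
    finally show ?thesis .
  qed
  define A where "A = green_const * (sqrt (real n) * U * sqrt E)"
  have A0: "A \<ge> 0" using gc U0 EE by (simp add: A_def)
  \<comment> \<open>Brings both parts of the bound to the same power of \<open>n\<close>.\<close>
  have An: "A \<le> green_const * (real n * U * sqrt E)"
  proof -
    have "real n \<le> real n * real n" by (cases n) auto
    then have "sqrt (real n) \<le> real n" by (intro real_le_lsqrt) (auto simp: power2_eq_square)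
    then show ?thesis unfolding A_def using gc U0 EE by (intro mult_left_mono mult_right_mono) auto
  qed
  define Q where "Q = \<gamma> ` T \<union> {z. wg z \<noteq> 0}"
  have fQ: "finite Q" using fin finite_T by (simp add: Q_def)
  \<comment> \<open>Any \<open>m\<close> such that exp m exceeds all coordinates in \<open>Q\<close>
    would do, as the final bound is independent of it.\<close>
  define m where "m = (\<Sum>z\<in>Q. nat \<bar>fst z\<bar> + nat \<bar>snd z\<bar>)"
  have mexp: "real m \<le> exp (real m)" using exp_ge_add_one_self[of "real m"] by linarith
  have Qm: "real_of_int \<bar>fst z\<bar> \<le> exp m \<and> real_of_int \<bar>snd z\<bar> \<le> exp m" if "z \<in> Q" for z
  proof -
    have "nat \<bar>fst z\<bar> + nat \<bar>snd z\<bar> \<le> m"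
      unfolding m_def using fQ that by (intro member_le_sum) auto
    then have "\<bar>fst z\<bar> \<le> int m" "\<bar>snd z\<bar> \<le> int m" by linarith+
    then have "real_of_int \<bar>fst z\<bar> \<le> real m" "real_of_int \<bar>snd z\<bar> \<le> real m"
      by (metis of_int_le_iff of_int_of_nat_eq)+
    then show ?thesis using mexp by linarith
  qed
  define M where "M = \<lceil>2 * exp (real m)\<rceil>"
  have M: "2 * exp (real m) \<le> of_int M" "of_int (M - 1) \<le> 2 * exp (real m)"
    unfolding M_def by linarith+
  have supp: "wg z = 0" if "z \<notin> gbox M" for z
  proof (rule ccontr)
    assume "wg z \<noteq> 0"
    then have "real_of_int \<bar>fst z\<bar> \<le> exp m \<and> real_of_int \<bar>snd z\<bar> \<le> exp m"
      by (intro Qm) (simp add: Q_def)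
    then have "real_of_int \<bar>fst z\<bar> \<le> of_int M \<and> real_of_int \<bar>snd z\<bar> \<le> of_int M"
      using M(1) exp_gt_zero[of "real m"] by linarith
    then show False using that unfolding of_int_le_iff by (cases z) (auto simp: gbox_def)
  qed
  have main: "\<bar>upw v (\<lambda>K. wg (\<gamma> K))\<bar> \<le> C * A * sqrt (\<Sum>z\<in>gbox (M + 1). gsq wg z)"
  proof (rule C[THEN spec[of _ m], THEN spec[of _ M], THEN spec[of _ "\<gamma> ` T"],
        THEN spec[of _ "\<lambda>g. upw v (\<lambda>K. g (\<gamma> K))"], THEN spec[of _ A], THEN mp, THEN mp, THEN mp, THEN mp,
        THEN mp, THEN mp, THEN mp, THEN spec[of _ wg], THEN mp])
    show "\<forall>g W. (\<forall>z\<in>\<gamma> ` T. \<bar>g z\<bar> \<le> W) \<longrightarrow> \<bar>upw v (\<lambda>K. g (\<gamma> K))\<bar> \<le> A * W"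
    proof (intro allI impI)
      fix g :: "int \<times> int \<Rightarrow> real" and W assume g: "\<forall>z\<in>\<gamma> ` T. \<bar>g z\<bar> \<le> W"
      show "\<bar>upw v (\<lambda>K. g (\<gamma> K))\<bar> \<le> A * W"
      proof (cases "T = {}")
        case False
        then obtain K where "K \<in> T" by blast
        then have W0: "0 \<le> W" using g by force
        have "\<bar>upw v (\<lambda>K. g (\<gamma> K))\<bar> \<le> 3 * (sqrt (real n) * sqrt (\<Sum>K\<in>T. (y K)\<^sup>2) * sqrt E) * W"
          by (rule upw_sup_le[OF _ W0 ap(1) E]) (use g in auto)
        also have "\<dots> \<le> A * W"
          unfolding A_def U_def using gc EE W0
          by (intro mult_right_mono) (auto simp: sum_nonneg)
        finally show ?thesis .
      next
        case True
        then have "upw v (\<lambda>K. g (\<gamma> K)) = 0" "U = 0" unfolding upw_def U_def by simp_all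
        then show ?thesis by (simp add: A_def)
      qed
    qed
    show "\<forall>z\<^sub>0\<in>\<gamma> ` T. \<bar>upw v (\<lambda>K. green m z\<^sub>0 (\<gamma> K))\<bar> \<le> A"
      unfolding A_def U_def using upw_green[OF ap(1), of E] E by blast
  qed (use M A0 supp Qm upw_add in \<open>auto simp: Q_def\<close>)
  also have "\<dots> \<le> C * (green_const * (real n * U * sqrt E)) * sqrt E'"
  proof (intro mult_mono mult_left_mono An real_sqrt_le_mono)
    have "(\<Sum>z\<in>gbox (M + 1). gsq wg z) \<le> (\<Sum>z\<in>gbox (M + 1). e' z)"
      using ap(2) by (intro sum_mono) (simp add: approx_def del: split_paired_All)
    also have "\<dots> \<le> E'" by (rule E') simp
    finally show "(\<Sum>z\<in>gbox (M + 1). gsq wg z) \<le> E'" .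
  qed (use \<open>0 \<le> C\<close> A0 gc U0 EE in \<open>auto simp: sum_nonneg\<close>)
  finally have main': "\<bar>upw v (\<lambda>K. wg (\<gamma> K))\<bar> \<le> C * green_const * real n * U * sqrt E * sqrt E'"
    by (simp add: mult_ac)
  have "upw v w = upw v (\<lambda>K. w K - wg (\<gamma> K)) + upw v (\<lambda>K. wg (\<gamma> K))"
    using upw_add[of "\<lambda>K. w K - wg (\<gamma> K)" 1 "\<lambda>K. wg (\<gamma> K)"] by simp
  then have "\<bar>upw v w\<bar> \<le> 3 * real n * U * sqrt E * sqrt E' + C * green_const * real n * U * sqrt E * sqrt E'"
    using rem main' by linarith
  then show ?thesis by (simp add: U_def algebra_simps)
qed

end

text \<open>The constant is chosen before the flow: a mesh enters only through the multiplicity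
  \<open>n\<close>, the size of its fluxes and its energies.\<close>

theorem upwind_flow_bound:
  "\<exists>C>0. \<forall>(T :: 'c set) N q y \<gamma> n v vg e w wg e' E E'.
     upwind_flow T N q y \<gamma> n \<longrightarrow> upwind_flow.approx T N \<gamma> v vg e \<longrightarrow> upwind_flow.approx T N \<gamma> w wg e' \<longrightarrow>
     finite {z. wg z \<noteq> 0} \<longrightarrow> (\<forall>F. finite F \<longrightarrow> sum e F \<le> E) \<longrightarrow> (\<forall>F. finite F \<longrightarrow> sum e' F \<le> E') \<longrightarrow>
     \<bar>upwind_flow.upw T N q v w\<bar> \<le> C * real n * sqrt (\<Sum>K\<in>T. (y K)\<^sup>2) * sqrt E * sqrt E'"
proof -
  obtain C where C: "C > 0" "\<forall>m M P l A.
     2 * exp (real m) \<le> of_int M \<longrightarrow> of_int (M - 1) \<le> 2 * exp (real m) \<longrightarrow>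
     (\<forall>z\<in>P. real_of_int \<bar>fst z\<bar> \<le> exp m \<and> real_of_int \<bar>snd z\<bar> \<le> exp m) \<longrightarrow>
     (\<forall>f g t. l (\<lambda>x. f x + t * g x) = l f + t * l g) \<longrightarrow>
     (\<forall>g W. (\<forall>z\<in>P. \<bar>g z\<bar> \<le> W) \<longrightarrow> \<bar>l g\<bar> \<le> A * W) \<longrightarrow>
     (\<forall>z\<^sub>0\<in>P. \<bar>l (green m z\<^sub>0)\<bar> \<le> A) \<longrightarrow> A \<ge> 0 \<longrightarrow>
     (\<forall>g. (\<forall>z. z \<notin> gbox M \<longrightarrow> g z = 0) \<longrightarrow> \<bar>l g\<bar> \<le> C * A * sqrt (\<Sum>z\<in>gbox (M + 1). gsq g z))"
    using grid_duality by (elim exE conjE)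
  show ?thesis
  proof (intro exI[of _ "C * green_const + 3"] conjI allI impI)
    fix T :: "'c set" and N q y \<gamma> n v vg e w wg e' E E'
    assume "upwind_flow T N q y \<gamma> n"
    then interpret upwind_flow T N q y \<gamma> n .
    assume "approx v vg e" "approx w wg e'" "finite {z. wg z \<noteq> 0}"
      "\<forall>F. finite F \<longrightarrow> sum e F \<le> E" "\<forall>F. finite F \<longrightarrow> sum e' F \<le> E'"
    then show "\<bar>upw v w\<bar> \<le> (C * green_const + 3) * real n * sqrt (\<Sum>K\<in>T. (y K)\<^sup>2) * sqrt E * sqrt E'"
      by (intro upw_bound[OF C(2) less_imp_le[OF C(1)]]) auto
  qed (use C(1) in \<open>simp add: green_const_def add_nonneg_pos\<close>)
qed

section \<open>Triangles\<close>

definition cross2 :: "real^2 \<Rightarrow> real^2 \<Rightarrow> real" where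
  "cross2 u w = u $ 1 * w $ 2 - u $ 2 * w $ 1"

text \<open>Clockwise quarter turn; it takes the edges of a positively oriented triangle to outward
  normals.\<close>

definition rot :: "real^2 \<Rightarrow> real^2" where
  "rot u = vector [u $ 2, - u $ 1]"

lemma rot_inner: "rot u \<bullet> w = cross2 w u"
  by (simp add: rot_def cross2_def inner_vec_def sum_2 algebra_simps)

lemma norm_rot [simp]: "norm (rot u) = norm u"
  by (simp add: rot_def norm_vec_def L2_set_def sum_2 add.commute)

lemma rot_add: "rot (u + w) = rot u + rot w"
  by (simp add: rot_def vec_eq_iff forall_2)

lemma cross2_shift: "cross2 (b - a) (c - a) = cross2 (c - b) (a - b)"
  by (simp add: cross2_def algebra_simps)

lemma cross2_swap: "cross2 u w = - cross2 w u"
  by (simp add: cross2_def)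

lemma eq_rot_multiple:
  fixes n u :: "real^2"
  assumes "n \<bullet> u = 0" "u \<noteq> 0"
  shows "n = ((n \<bullet> rot u) / (norm u)\<^sup>2) *\<^sub>R rot u"
proof -
  have nz: "(u $ 1)\<^sup>2 + (u $ 2)\<^sup>2 \<noteq> 0"
    using assms(2) by (simp add: vec_eq_iff forall_2 sum_power2_eq_zero_iff)
  have o: "n $ 1 * u $ 1 + n $ 2 * u $ 2 = 0"
    using assms(1) by (simp add: inner_vec_def sum_2)
  have "(norm u)\<^sup>2 = (u $ 1)\<^sup>2 + (u $ 2)\<^sup>2"
    unfolding power2_norm_eq_inner inner_vec_def sum_2 by (simp add: power2_eq_square)
  moreover have "n $ 1 * ((u $ 1)\<^sup>2 + (u $ 2)\<^sup>2) = (n $ 1 * u $ 2 - n $ 2 * u $ 1) * u $ 2"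
    "n $ 2 * ((u $ 1)\<^sup>2 + (u $ 2)\<^sup>2) = - (n $ 1 * u $ 2 - n $ 2 * u $ 1) * u $ 1"
    using o by algebra+
  ultimately show ?thesis
    using nz by (simp add: vec_eq_iff forall_2 rot_def inner_vec_def sum_2 field_simps)
qed

text \<open>Barycentric coordinate of \<open>x\<close> relative to the vertex \<open>c\<close> of the triangle \<open>a b c\<close>.\<close>

definition bary :: "real^2 \<Rightarrow> real^2 \<Rightarrow> real^2 \<Rightarrow> real^2 \<Rightarrow> real" where
  "bary a b c x = cross2 (b - a) (x - a) / cross2 (b - a) (c - a)"

lemma bary_sum:
  assumes "cross2 (b - a) (c - a) \<noteq> 0"
  shows "bary b c a x + bary c a b x + bary a b c x = 1"
    and "bary b c a x *\<^sub>R a + bary c a b x *\<^sub>R b + bary a b c x *\<^sub>R c = x"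
proof -
  define D where "D = cross2 (b - a) (c - a)"
  have D: "cross2 (c - b) (a - b) = D" "cross2 (a - c) (b - c) = D" "D \<noteq> 0"
    using assms by (simp_all add: D_def cross2_def algebra_simps)
  have "cross2 (c - b) (x - b) + cross2 (a - c) (x - c) + cross2 (b - a) (x - a) = D"
    by (simp add: D_def cross2_def algebra_simps)
  then show "bary b c a x + bary c a b x + bary a b c x = 1"
    using D by (simp add: bary_def add_divide_distrib[symmetric] flip: D_def)
  have "cross2 (c - b) (x - b) * a $ i + cross2 (a - c) (x - c) * b $ i + cross2 (b - a) (x - a) * c $ i = D * x $ i"
    for i
    using exhaust_2[of i] by (auto simp: D_def cross2_def algebra_simps)
  then have "(bary b c a x *\<^sub>R a + bary c a b x *\<^sub>R b + bary a b c x *\<^sub>R c) $ i = x $ i" for i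
    using D by (simp add: bary_def add_divide_distrib[symmetric] field_simps flip: D_def)
  then show "bary b c a x *\<^sub>R a + bary c a b x *\<^sub>R b + bary a b c x *\<^sub>R c = x"
    by (simp add: vec_eq_iff)
qed

lemma bary_combination:
  assumes "cross2 (b - a) (c - a) \<noteq> 0" "u + v + w = 1"
  shows "bary a b c (u *\<^sub>R a + v *\<^sub>R b + w *\<^sub>R c) = w"
proof -
  have u: "u = 1 - v - w" using assms by simp
  have "cross2 (b - a) (u *\<^sub>R a + v *\<^sub>R b + w *\<^sub>R c - a) = w * cross2 (b - a) (c - a)"
    unfolding u by (simp add: cross2_def algebra_simps)
  then show ?thesis using assms by (simp add: bary_def)
qed

lemma bary_vertex [simp]:
  assumes "cross2 (b - a) (c - a) \<noteq> 0"
  shows "bary a b c a = 0" "bary a b c b = 0" "bary a b c c = 1"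
  using assms by (simp_all add: bary_def cross2_def)

lemma bary_affine: "bary a b c ((1 - t) *\<^sub>R x + t *\<^sub>R y) = (1 - t) * bary a b c x + t * bary a b c y"
proof -
  have "cross2 (b - a) ((1 - t) *\<^sub>R x + t *\<^sub>R y - a) = (1 - t) * cross2 (b - a) (x - a) + t * cross2 (b - a) (y - a)"
    by (simp add: cross2_def algebra_simps)
  then show ?thesis by (simp add: bary_def add_divide_distrib)
qed

lemma continuous_on_bary [continuous_intros]: "continuous_on S (bary a b c)"
  unfolding bary_def cross2_def divide_inverse by (intro continuous_intros)

lemma triangle_mem_iff:
  assumes "cross2 (b - a) (c - a) \<noteq> 0"
  shows "x \<in> convex hull {a, b, c} \<longleftrightarrow> 0 \<le> bary b c a x \<and> 0 \<le> bary c a b x \<and> 0 \<le> bary a b c x"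
proof
  assume "x \<in> convex hull {a, b, c}"
  then obtain u v w where x: "x = u *\<^sub>R a + v *\<^sub>R b + w *\<^sub>R c" "0 \<le> u" "0 \<le> v" "0 \<le> w" "u + v + w = 1"
    unfolding convex_hull_3 by blast
  have D: "cross2 (c - b) (a - b) \<noteq> 0" "cross2 (a - c) (b - c) \<noteq> 0"
    using assms by (simp_all add: cross2_def algebra_simps)
  have "bary a b c x = w" unfolding x(1) by (rule bary_combination) (use assms x in auto)
  moreover have "bary b c a x = u"
    using bary_combination[OF D(1), of v w u] x by (simp add: add_ac)
  moreover have "bary c a b x = v"
    using bary_combination[OF D(2), of w u v] x by (simp add: add_ac)
  ultimately show "0 \<le> bary b c a x \<and> 0 \<le> bary c a b x \<and> 0 \<le> bary a b c x"
    using x by simp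
next
  assume "0 \<le> bary b c a x \<and> 0 \<le> bary c a b x \<and> 0 \<le> bary a b c x"
  then show "x \<in> convex hull {a, b, c}"
    unfolding convex_hull_3 using bary_sum[OF assms, of x] by (metis (mono_tags, lifting) mem_Collect_eq)
qed

text \<open>Nondegeneracy is carried in two forms: barycentric computations divide by the cross
  product, while the description of the faces relies on affine independence.\<close>

definition is_triangle :: "real^2 \<Rightarrow> real^2 \<Rightarrow> real^2 \<Rightarrow> (real^2) set \<Rightarrow> bool" where
  "is_triangle a b c K \<longleftrightarrow> K = convex hull {a, b, c} \<and> cross2 (b - a) (c - a) \<noteq> 0 \<and>
     a \<noteq> b \<and> b \<noteq> c \<and> c \<noteq> a \<and> \<not> affine_dependent {a, b, c}"

lemma is_triangle_rotate: "is_triangle a b c K \<Longrightarrow> is_triangle b c a K"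
  unfolding is_triangle_def using cross2_shift[of b a c] by (simp add: insert_commute)

lemma is_triangle_swap: "is_triangle a b c K \<Longrightarrow> is_triangle b a c K"
  unfolding is_triangle_def by (auto simp: insert_commute cross2_def algebra_simps)

lemma measure_lebesgue_triangle:
  "measure lebesgue (convex hull {a, b, c}) = \<bar>cross2 (b - a) (c - a)\<bar> / 2"
proof -
  have "convex hull {a, b, c} \<in> sets lborel"
    by (simp add: borel_compact finite_imp_compact_convex_hull)
  then have "measure lebesgue (convex hull {a, b, c}) = measure lborel (convex hull {a, b, c})"
    by (rule measure_completion)
  then show ?thesis unfolding content_triangle cross2_def
    by (subst abs_minus_commute) (simp add: mult.commute)
qed

text \<open>The cross product is nonzero because a full-dimensional simplex has interior points,
  hence positive area, and the area is half the cross product in absolute value.\<close>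

lemma triangle_exists:
  assumes "2 simplex K"
  obtains a b c where "is_triangle a b c K"
proof -
  obtain C where C: "\<not> affine_dependent C" "int (card C) = 3" "K = convex hull C"
    using assms unfolding simplex_def by auto
  then have "card C = 3" by simp
  then obtain a b c where abc: "C = {a, b, c}" "a \<noteq> b" "b \<noteq> c" "a \<noteq> c"
    unfolding card_3_iff by blast
  have "aff_dim K = 2" by (rule aff_dim_simplex[OF assms])
  then have "affine hull K = UNIV" using aff_dim_eq_full[of K] by simp
  then have "interior K = rel_interior K" by (metis rel_interior_interior)
  moreover have "rel_interior K \<noteq> {}" using C abc by (simp add: rel_interior_eq_empty)
  ultimately have "interior K \<noteq> {}" by simp
  then have "\<not> negligible K" using C by (simp add: negligible_convex_interior)
  moreover have "K \<in> lmeasurable" unfolding C(3) abc(1)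
    by (intro lmeasurable_compact finite_imp_compact_convex_hull) auto
  ultimately have "measure lebesgue K \<noteq> 0" by (simp add: negligible_iff_measure0)
  then have "cross2 (b - a) (c - a) \<noteq> 0"
    unfolding C(3) abc(1) measure_lebesgue_triangle by auto
  then show ?thesis using that C abc by (auto simp: is_triangle_def)
qed

lemma vertices_triangle: "is_triangle a b c K \<Longrightarrow> vertices K = {a, b, c}"
  unfolding is_triangle_def vertices_def by (auto simp: extreme_point_of_convex_hull_affine_independent)

lemma face_triangle_iff: "is_triangle a b c K \<Longrightarrow> F face_of K \<longleftrightarrow> (\<exists>S\<subseteq>{a, b, c}. F = convex hull S)"
  unfolding is_triangle_def using face_of_convex_hull_affine_independent[of "{a, b, c}" F] by simp

text \<open>The faces are the hulls of sets of vertices, of dimension one less than the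
  cardinality.\<close>

lemma edges_triangle:
  assumes "is_triangle a b c K"
  shows "edges K = {closed_segment a b, closed_segment b c, closed_segment c a}"
proof -
  note T = assms[unfolded is_triangle_def]
  have ad: "aff_dim (convex hull S) = int (card S) - 1" if "S \<subseteq> {a, b, c}" for S
    using aff_dim_affine_independent[OF affine_independent_subset[OF _ that]] T
    by (simp add: aff_dim_convex_hull)
  have two: "S = {a, b} \<or> S = {b, c} \<or> S = {c, a}" if S: "S \<subseteq> {a, b, c}" "card S = 2" for S
  proof -
    obtain x y where "S = {x, y}" "x \<noteq> y" using S(2) by (auto simp: card_2_iff)
    then show ?thesis using S(1) by (auto simp: insert_commute)
  qed
  have "aff_dim (convex hull S) = 1 \<longleftrightarrow> card S = 2" if "S \<subseteq> {a, b, c}" for S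
    using ad[OF that] by auto
  then have "\<sigma> \<in> edges K \<longleftrightarrow> (\<exists>S\<subseteq>{a, b, c}. \<sigma> = convex hull S \<and> card S = 2)" for \<sigma>
    unfolding edges_def edge_of_def mem_Collect_eq face_triangle_iff[OF assms] by blast
  also have "(\<exists>S\<subseteq>{a, b, c}. \<sigma> = convex hull S \<and> card S = 2) \<longleftrightarrow> \<sigma> \<in> {convex hull {a, b}, convex hull {b, c}, convex hull {c, a}}" for \<sigma>
  proof
    show "\<sigma> \<in> {convex hull {a, b}, convex hull {b, c}, convex hull {c, a}}"
      if "\<exists>S\<subseteq>{a, b, c}. \<sigma> = convex hull S \<and> card S = 2" using that two by blast
    show "\<exists>S\<subseteq>{a, b, c}. \<sigma> = convex hull S \<and> card S = 2"
      if "\<sigma> \<in> {convex hull {a, b}, convex hull {b, c}, convex hull {c, a}}"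
    proof -
      have "card {a, b} = 2" "card {b, c} = 2" "card {c, a} = 2" using T by auto
      then show ?thesis using that by (metis empty_iff insertE insert_subset insertCI empty_subsetI)
    qed
  qed
  finally show ?thesis by (auto simp: segment_convex_hull)
qed

lemma edge_ends:
  assumes "2 simplex K" "\<sigma> \<in> edges K"
  obtains a b c where "is_triangle a b c K" "\<sigma> = closed_segment a b"
proof -
  obtain a b c where t: "is_triangle a b c K" using triangle_exists[OF assms(1)] .
  note t2 = is_triangle_rotate[OF t] and t3 = is_triangle_rotate[OF is_triangle_rotate[OF t]]
  show ?thesis using assms(2) edges_triangle[OF t] that[OF t] that[OF t2] that[OF t3] by auto
qed

lemma edge_length_segment [simp]: "edge_length (closed_segment a b) = dist a b"
  unfolding edge_length_def by (rule the_equality) (auto simp: doubleton_eq_iff dist_commute)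

lemma edge_midpoint_segment [simp]: "edge_midpoint (closed_segment a b) = midpoint a b"
  unfolding edge_midpoint_def by (rule the_equality) (auto simp: doubleton_eq_iff midpoint_sym)

lemma circumcenter_exists:
  assumes "is_triangle a b c K"
  shows "dist (circumcenter K) a = circumradius K" "dist (circumcenter K) b = circumradius K"
    "dist (circumcenter K) c = circumradius K"
proof -
  define D where "D = cross2 (b - a) (c - a)"
  have D: "D \<noteq> 0" using assms by (simp add: D_def is_triangle_def)
  have V: "vertices K = {a, b, c}" by (rule vertices_triangle[OF assms])
  define P Q where "P = (b - a) \<bullet> (b - a) / 2" and "Q = (c - a) \<bullet> (c - a) / 2"
  have eqd: "dist x p = dist x a \<longleftrightarrow> (x - a) \<bullet> (p - a) = (p - a) \<bullet> (p - a) / 2" for x p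
  proof -
    have "dist x p = dist x a \<longleftrightarrow> (dist x p)\<^sup>2 = (dist x a)\<^sup>2" by simp
    also have "(dist x p)\<^sup>2 = (x - a) \<bullet> (x - a) - 2 * ((x - a) \<bullet> (p - a)) + (p - a) \<bullet> (p - a)"
      unfolding dist_norm power2_norm_eq_inner by (simp add: inner_diff_left inner_diff_right inner_commute algebra_simps)
    finally show ?thesis by (auto simp: dist_norm power2_norm_eq_inner)
  qed
  define A1 A2 B1 B2 where "A1 = (b - a) $ 1" and "A2 = (b - a) $ 2" and "B1 = (c - a) $ 1" and "B2 = (c - a) $ 2"
  have Dd: "D = A1 * B2 - A2 * B1" by (simp add: D_def cross2_def A1_def A2_def B1_def B2_def)
  have ip: "y \<bullet> (b - a) = y $ 1 * A1 + y $ 2 * A2" "y \<bullet> (c - a) = y $ 1 * B1 + y $ 2 * B2" for y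
    unfolding inner_vec_def sum_2 A1_def A2_def B1_def B2_def by simp_all
  \<comment> \<open>Cramer's rule for the two linear equations that equidistance from
    \<open>a\<close>, \<open>b\<close> and from \<open>a\<close>, \<open>c\<close> imposes on
    \<open>x - a\<close>.\<close>
  define z1 z2 where "z1 = (P * B2 - Q * A2) / D" and "z2 = (Q * A1 - P * B1) / D"
  define x where "x = a + vector [z1, z2]"
  have "x - a = vector [z1, z2]" by (simp add: x_def)
  then have xa: "(x - a) $ 1 = z1" "(x - a) $ 2 = z2" by simp_all
  have "(P * B2 - Q * A2) * A1 + (Q * A1 - P * B1) * A2 = P * D" "(P * B2 - Q * A2) * B1 + (Q * A1 - P * B1) * B2 = Q * D"
    unfolding Dd by (simp_all add: algebra_simps)
  then have "z1 * A1 + z2 * A2 = P" "z1 * B1 + z2 * B2 = Q"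
    using D unfolding z1_def z2_def by (simp_all add: field_simps)
  then have x: "dist x b = dist x a" "dist x c = dist x a"
    unfolding eqd ip xa P_def Q_def by simp_all
  have uniq: "y = x" if "dist y b = dist y a" "dist y c = dist y a" for y
  proof -
    have e: "(y - x) \<bullet> (b - a) = 0" "(y - x) \<bullet> (c - a) = 0"
      using that x unfolding eqd by (simp_all add: inner_diff_left)
    have "D * (y - x) $ 1 = ((y - x) \<bullet> (b - a)) * B2 - ((y - x) \<bullet> (c - a)) * A2"
      "D * (y - x) $ 2 = ((y - x) \<bullet> (c - a)) * A1 - ((y - x) \<bullet> (b - a)) * B1"
      unfolding ip Dd by (simp_all add: algebra_simps)
    then show ?thesis unfolding e using D by (simp add: vec_eq_iff forall_2)
  qed
  have cc: "circumcenter K = x"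
    unfolding circumcenter_def V
  proof (rule the_equality)
    show "\<exists>r. {a, b, c} \<subseteq> sphere x r" using x by (intro exI[of _ "dist x a"]) auto
    fix y assume "\<exists>r. {a, b, c} \<subseteq> sphere y r"
    then obtain r where "{a, b, c} \<subseteq> sphere y r" by blast
    then have "dist y a = r" "dist y b = r" "dist y c = r" by simp_all
    then show "y = x" by (intro uniq) simp_all
  qed
  have "circumradius K = dist x a"
    unfolding circumradius_def V cc
  proof (rule the_equality)
    show "{a, b, c} \<subseteq> sphere x (dist x a)" using x by simp
    show "r = dist x a" if "{a, b, c} \<subseteq> sphere x r" for r using that by simp
  qed
  then show "dist (circumcenter K) a = circumradius K" "dist (circumcenter K) b = circumradius K"
    "dist (circumcenter K) c = circumradius K" using cc x by auto
qed

lemma triangle_subset_circumdisc: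
  assumes "is_triangle a b c K"
  shows "K \<subseteq> cball (circumcenter K) (circumradius K)"
proof -
  have "{a, b, c} \<subseteq> cball (circumcenter K) (circumradius K)"
    using circumcenter_exists[OF assms] by simp
  then show ?thesis
    using assms convex_cball unfolding is_triangle_def by (metis hull_minimal)
qed

lemma dist_in_triangle:
  assumes "is_triangle a b c K" "x \<in> K" "y \<in> K"
  shows "dist x y \<le> circumdiameter K"
proof -
  have "dist (circumcenter K) x \<le> circumradius K" "dist (circumcenter K) y \<le> circumradius K"
    using triangle_subset_circumdisc[OF assms(1)] assms by auto
  then show ?thesis
    using dist_triangle3[of x y "circumcenter K"] by (simp add: circumdiameter_def)
qed

lemma triangle_area:
  assumes "is_triangle a b c K"
  shows "area K = \<bar>cross2 (b - a) (c - a)\<bar> / 2"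
  using assms measure_lebesgue_triangle unfolding is_triangle_def area_def by simp

text \<open>The classical formula abc = 4RS, verified after squaring: it is then a polynomial
  consequence of the linear equations \<open>e\<close> for the circumcenter. It bounds the area from
  below by the edge lengths in \<open>area_ge\<close>.\<close>

lemma area_circumradius:
  assumes "is_triangle a b c K"
  shows "4 * circumradius K * area K = dist a b * dist b c * dist c a"
proof -
  define x where "x = circumcenter K - a"
  define A B where "A = b - a" and "B = c - a"
  define D where "D = cross2 A B"
  have iff: "y \<bullet> p = y $ 1 * p $ 1 + y $ 2 * p $ 2" for y p :: "real^2" by (simp add: inner_vec_def sum_2)
  note cc = circumcenter_exists[OF assms]
  have R: "(circumradius K)\<^sup>2 = x \<bullet> x"
    using cc(1) by (simp add: x_def dist_norm flip: power2_norm_eq_inner)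
  have "(dist (circumcenter K) b)\<^sup>2 = x \<bullet> x" "(dist (circumcenter K) c)\<^sup>2 = x \<bullet> x" using cc R by simp_all
  then have e: "2 * (x \<bullet> A) = A \<bullet> A" "2 * (x \<bullet> B) = B \<bullet> B"
    unfolding dist_norm power2_norm_eq_inner x_def A_def B_def
    by (simp_all add: inner_diff_left inner_diff_right inner_commute algebra_simps)
  have "4 * D\<^sup>2 * (x \<bullet> x) = (A \<bullet> A) * (B \<bullet> B) * ((B - A) \<bullet> (B - A))"
    using e unfolding iff D_def cross2_def vector_minus_component by algebra
  moreover have "(4 * circumradius K * area K)\<^sup>2 = 4 * D\<^sup>2 * (circumradius K)\<^sup>2"
    unfolding triangle_area[OF assms] A_def[symmetric] B_def[symmetric] D_def[symmetric]
    by (simp add: power_mult_distrib power_divide)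
  moreover have "(dist a b * dist b c * dist c a)\<^sup>2 = (A \<bullet> A) * (B \<bullet> B) * ((B - A) \<bullet> (B - A))"
    unfolding power_mult_distrib dist_norm power2_norm_eq_inner A_def B_def
    by (simp add: inner_diff_left inner_diff_right inner_commute algebra_simps)
  ultimately have "(4 * circumradius K * area K)\<^sup>2 = (dist a b * dist b c * dist c a)\<^sup>2" using R by simp
  moreover have "0 \<le> circumradius K" using cc(1) by (metis zero_le_dist)
  moreover have "0 \<le> area K" by (simp add: area_def)
  ultimately show ?thesis by (simp add: power2_eq_iff_nonneg)
qed

text \<open>The sign of the cross product corrects the orientation. Multiplied by the length, the
  normal is a linear image of the edge vector, so that the three of them add up to zero in
  \<open>flux_balance\<close>.\<close>

lemma outer_normal_triangle:
  assumes "is_triangle a b c K"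
  shows "dist a b *\<^sub>R outer_normal K (closed_segment a b) = sgn (cross2 (b - a) (c - a)) *\<^sub>R rot (b - a)"
    and "norm (outer_normal K (closed_segment a b)) = 1"
proof -
  define D where "D = cross2 (b - a) (c - a)"
  define \<nu> where "\<nu> = (sgn D / norm (b - a)) *\<^sub>R rot (b - a)"
  have D: "D \<noteq> 0" and ab: "b - a \<noteq> 0" "norm (b - a) > 0" and K: "K = convex hull {a, b, c}"
    using assms by (auto simp: D_def is_triangle_def)
  have \<nu>: "norm \<nu> = 1" "\<nu> \<bullet> (b - a) = 0" "\<nu> \<bullet> (c - a) < 0"
  proof -
    show "norm \<nu> = 1" using D ab by (simp add: \<nu>_def sgn_real_def)
    show "\<nu> \<bullet> (b - a) = 0" by (simp add: \<nu>_def rot_inner cross2_def)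
    have "\<nu> \<bullet> (c - a) = - \<bar>D\<bar> / norm (b - a)"
      using cross2_swap[of "c - a" "b - a"] by (simp add: \<nu>_def rot_inner D_def abs_sgn)
    then show "\<nu> \<bullet> (c - a) < 0" using D ab by simp
  qed
  have seg: "n \<bullet> (y - a) = 0" if y: "y \<in> closed_segment a b" "n \<bullet> (b - a) = 0" for y n :: "real^2"
  proof -
    obtain t where "y = (1 - t) *\<^sub>R a + t *\<^sub>R b" using y(1) by (auto simp: in_segment)
    then have "y - a = t *\<^sub>R (b - a)" by (simp add: algebra_simps)
    then show ?thesis using y(2) by simp
  qed
  have "outer_normal K (closed_segment a b) = \<nu>"
    unfolding outer_normal_def
  proof (rule the_equality)
    have z: "\<nu> \<bullet> (x - y) = \<nu> \<bullet> (x - a)" if "y \<in> closed_segment a b" for x y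
      using seg[OF that \<nu>(2)] by (simp add: inner_diff_right)
    show "norm \<nu> = 1 \<and> (\<forall>x\<in>closed_segment a b. \<forall>y\<in>closed_segment a b. \<nu> \<bullet> (x - y) = 0) \<and>
        (\<forall>x\<in>K. \<forall>y\<in>closed_segment a b. \<nu> \<bullet> (x - y) \<le> 0)"
    proof (intro conjI ballI)
      fix x y assume "x \<in> K" "y \<in> closed_segment a b"
      obtain u v w where x: "x = u *\<^sub>R a + v *\<^sub>R b + w *\<^sub>R c" "0 \<le> u" "0 \<le> v" "0 \<le> w" "u + v + w = 1"
        using \<open>x \<in> K\<close> unfolding K convex_hull_3 by blast
      have "x - a = v *\<^sub>R (b - a) + w *\<^sub>R (c - a)"
      proof -
        have u: "u = 1 - v - w" using x(5) by simp
        show ?thesis unfolding x(1) u by (simp add: algebra_simps)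
      qed
      then have "\<nu> \<bullet> (x - a) = w * (\<nu> \<bullet> (c - a))" using \<nu>(2) by (simp add: inner_add_right)
      then show "\<nu> \<bullet> (x - y) \<le> 0"
        unfolding z[OF \<open>y \<in> closed_segment a b\<close>] using \<nu>(3) x(4) by (simp add: mult_nonneg_nonpos)
    next
      fix x y assume xy: "x \<in> closed_segment a b" "y \<in> closed_segment a b"
      show "\<nu> \<bullet> (x - y) = 0"
        unfolding z[OF xy(2)] by (rule seg[OF xy(1) \<nu>(2)])
    qed (rule \<nu>(1))
  next
    fix n assume n: "norm n = 1 \<and> (\<forall>x\<in>closed_segment a b. \<forall>y\<in>closed_segment a b. n \<bullet> (x - y) = 0) \<and>
        (\<forall>x\<in>K. \<forall>y\<in>closed_segment a b. n \<bullet> (x - y) \<le> 0)"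
    have "c \<in> K" by (simp add: K hull_inc)
    then have nb: "n \<bullet> (b - a) = 0" and nc: "n \<bullet> (c - a) \<le> 0" using n by auto
    define t where "t = (n \<bullet> rot (b - a)) / (norm (b - a))\<^sup>2"
    have nt: "n = t *\<^sub>R rot (b - a)" unfolding t_def using nb ab by (intro eq_rot_multiple) auto
    then have "\<bar>t\<bar> * norm (b - a) = 1" using n by simp
    then have at: "\<bar>t\<bar> = 1 / norm (b - a)" using ab by (simp add: field_simps)
    have "n \<bullet> (c - a) = - t * D"
      unfolding nt inner_scaleR_left rot_inner using cross2_swap[of "c - a" "b - a"] by (simp add: D_def)
    then have "0 \<le> t * D" using nc by simp
    then have "t = sgn D * \<bar>t\<bar>" using D at
      by (auto simp: sgn_real_def zero_le_mult_iff abs_if split: if_splits)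
    then show "n = \<nu>" using nt at by (simp add: \<nu>_def)
  qed
  then show "dist a b *\<^sub>R outer_normal K (closed_segment a b) = sgn (cross2 (b - a) (c - a)) *\<^sub>R rot (b - a)"
    "norm (outer_normal K (closed_segment a b)) = 1"
    using ab \<nu> by (simp_all add: \<nu>_def D_def dist_norm norm_minus_commute)
qed

lemma face_triangle_cases:
  assumes "is_triangle a b c K" "F face_of K" "x \<in> F" "x \<notin> vertices K"
  shows "F = K \<or> F \<in> edges K"
proof -
  obtain S where S: "S \<subseteq> {a, b, c}" "F = convex hull S"
    using assms(2) face_triangle_iff[OF assms(1)] by blast
  have x: "x \<noteq> a" "x \<noteq> b" "x \<noteq> c" using assms(4) vertices_triangle[OF assms(1)] by auto
  have K: "K = convex hull {a, b, c}" using assms by (simp add: is_triangle_def)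
  have E: "edges K = {convex hull {a, b}, convex hull {b, c}, convex hull {c, a}}"
    using edges_triangle[OF assms(1)] by (simp add: segment_convex_hull)
  have "S = {} \<or> S = {a} \<or> S = {b} \<or> S = {c} \<or> S = {a, b} \<or> S = {b, c} \<or> S = {c, a} \<or> S = {a, b, c}"
  proof -
    have "\<exists>p q r. S = (if p then {a} else {}) \<union> (if q then {b} else {}) \<union> (if r then {c} else {})"
      using S(1) by (intro exI[of _ "a \<in> S"] exI[of _ "b \<in> S"] exI[of _ "c \<in> S"]) auto
    then obtain p q r where "S = (if p then {a} else {}) \<union> (if q then {b} else {}) \<union> (if r then {c} else {})"
      by (elim exE)
    then show ?thesis by (cases p; cases q; cases r) (simp_all add: insert_commute)
  qed
  then consider "S = {}" | "S = {a}" | "S = {b}" | "S = {c}" | "S = {a, b}" | "S = {b, c}" | "S = {c, a}" | "S = {a, b, c}"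
    by metis
  then show ?thesis using S(2) assms(3) x K E by cases simp_all
qed

lemma bary_zero_segment:
  assumes "is_triangle a b c K" "bary a b c x = 0" "0 \<le> bary b c a x" "0 \<le> bary c a b x"
  shows "x \<in> closed_segment a b"
proof -
  have D: "cross2 (b - a) (c - a) \<noteq> 0" using assms(1) by (simp add: is_triangle_def)
  have u: "bary b c a x = 1 - bary c a b x" using bary_sum(1)[OF D, of x] assms(2) by simp
  have "x = (1 - bary c a b x) *\<^sub>R a + bary c a b x *\<^sub>R b"
    using bary_sum(2)[OF D, of x] unfolding assms(2) u by simp
  then show ?thesis
    unfolding in_segment using assms(3,4) u by (intro exI[of _ "bary c a b x"]) simp
qed

lemma open_bary: "open {y. 0 < bary a b c y}"
  by (intro open_Collect_less continuous_on_const continuous_on_bary)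

lemma edge_face: "\<sigma> \<in> edges K \<Longrightarrow> \<sigma> face_of K" and edge_aff_dim: "\<sigma> \<in> edges K \<Longrightarrow> aff_dim \<sigma> = 1"
  by (simp_all add: edges_def edge_of_def)

lemma edge_subset: "\<sigma> \<in> edges K \<Longrightarrow> \<sigma> \<subseteq> K"
  using edge_face face_of_imp_subset by blast

lemma edge_subset_edge:
  assumes "\<sigma> \<in> edges K" "\<tau> \<in> edges K" "\<sigma> \<subseteq> \<tau>"
  shows "\<sigma> = \<tau>"
proof (rule ccontr)
  assume "\<sigma> \<noteq> \<tau>"
  have "\<sigma> face_of \<tau>"
    using assms edge_face face_of_subset edge_subset by blast
  then have "aff_dim \<sigma> < aff_dim \<tau>"
    using \<open>\<sigma> \<noteq> \<tau>\<close> face_of_imp_convex[OF edge_face[OF assms(2)]] face_of_aff_dim_lt by blast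
  then show False using assms edge_aff_dim by fastforce
qed

lemma interior_triangle:
  fixes K :: "(real^2) set"
  assumes "2 simplex K"
  shows "interior K \<noteq> {}" "closure (interior K) = K"
proof -
  have "affine hull K = UNIV" using aff_dim_eq_full[of K] aff_dim_simplex[OF assms] by simp
  then have "interior K = rel_interior K" by (metis rel_interior_interior)
  moreover have "convex K" "closed K" using assms convex_simplex closed_simplex by blast+
  moreover have "K \<noteq> {}" using assms by auto
  ultimately show "interior K \<noteq> {}" by (simp add: rel_interior_eq_empty)
  then show "closure (interior K) = K"
    using \<open>convex K\<close> \<open>closed K\<close> by (simp add: convex_closure_interior)
qed

section \<open>Edges and cells of a triangulation\<close>

locale triangle_mesh =
  fixes \<Omega> :: "(real^2) set" and T :: "(real^2) set set"
  assumes domain: "polygonal_domain \<Omega>" and mesh: "acute_mesh \<Omega> T"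
begin

lemma finite_T: "finite T"
  and simplex: "K \<in> T \<Longrightarrow> 2 simplex K"
  and face_Int: "K \<in> T \<Longrightarrow> L \<in> T \<Longrightarrow> K \<inter> L face_of K"
  and cover: "\<Union>T = closure \<Omega>"
  using mesh by (auto simp: acute_mesh_def triangulation_def)

text \<open>Here the domain lies on one side of its boundary: slits would belong to the interior of
  the union of the cells but not to \<open>\<Omega>\<close>.\<close>

lemma interior_cover: "interior (\<Union>T) = \<Omega>" and open_\<Omega>: "open \<Omega>" and bounded_\<Omega>: "bounded \<Omega>"
  using domain by (auto simp: cover polygonal_domain_def)

lemma triangle_antimono:
  assumes "K \<in> T" "L \<in> T" "K \<subseteq> L"
  shows "K = L"
proof (rule ccontr)
  assume "K \<noteq> L"
  have "L \<inter> K face_of L" using face_Int assms by blast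
  then have "K face_of L" using assms(3) by (simp add: Int_absorb1)
  then have "aff_dim K < aff_dim L"
    using \<open>K \<noteq> L\<close> face_of_aff_dim_lt[of L K] convex_simplex[OF simplex[OF assms(2)]] by blast
  then show False using aff_dim_simplex[OF simplex] assms by simp
qed

lemma Int_edge:
  assumes "K \<in> T" "L \<in> T" "K \<noteq> L" "x \<in> K" "x \<in> L" "x \<notin> vertices K"
  shows "K \<inter> L \<in> edges K" "K \<inter> L \<in> edges L"
proof -
  obtain a b c where t: "is_triangle a b c K" using triangle_exists simplex assms by blast
  have "K \<inter> L = K \<or> K \<inter> L \<in> edges K"
    using face_triangle_cases[OF t face_Int] assms by blast
  moreover have "K \<inter> L \<noteq> K" using triangle_antimono assms by blast
  ultimately show 1: "K \<inter> L \<in> edges K" by blast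
  have "L \<inter> K face_of L" using face_Int assms by blast
  then show "K \<inter> L \<in> edges L"
    using edge_aff_dim[OF 1] by (simp add: edges_def edge_of_def Int_commute)
qed

lemma apex:
  assumes "K \<in> T" "closed_segment a b \<in> edges K"
  obtains c where "is_triangle a b c K"
proof -
  obtain a' b' c where t: "is_triangle a' b' c K" "closed_segment a b = closed_segment a' b'"
    using edge_ends[OF simplex[OF assms(1)] assms(2)] by blast
  then have "{a, b} = {a', b'}" by simp
  then show ?thesis using t(1) is_triangle_swap that unfolding doubleton_eq_iff by blast
qed

lemma midpoint_edge:
  assumes "is_triangle a b c K"
  shows "midpoint a b \<in> closed_segment a b" "midpoint a b \<notin> vertices K"
proof -
  have D: "cross2 (b - a) (c - a) \<noteq> 0" "a \<noteq> b" using assms by (auto simp: is_triangle_def)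
  have "bary a b c (midpoint a b) = 0"
    using bary_affine[of a b c "1/2" a b] D(1) by (simp add: midpoint_def scaleR_add_right)
  then have "midpoint a b \<noteq> c" using bary_vertex(3)[OF D(1)] by auto
  then show "midpoint a b \<notin> vertices K" using D(2) by (simp add: vertices_triangle[OF assms])
qed simp

text \<open>The midpoint of the edge is a common point other than a vertex, so the intersection is
  an edge, and one edge contains another only if they are equal.\<close>

lemma shared_edge:
  assumes "K \<in> T" "L \<in> T" "K \<noteq> L" "\<sigma> \<in> edges K" "\<sigma> \<in> edges L"
  shows "K \<inter> L = \<sigma>"
proof -
  obtain a b c where t: "is_triangle a b c K" "\<sigma> = closed_segment a b"
    using edge_ends[OF simplex[OF assms(1)] assms(4)] .
  have "midpoint a b \<in> K \<inter> L" using midpoint_edge(1)[OF t(1)] t(2) assms edge_subset by blast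
  then have "K \<inter> L \<in> edges K"
    using Int_edge assms midpoint_edge(2)[OF t(1)] by blast
  then show ?thesis using edge_subset_edge[of \<sigma> K "K \<inter> L"] edge_subset assms by blast
qed

text \<open>Were both apexes on the same side, a point slightly off the midpoint of the edge in the
  direction of \<open>c\<close> would lie in both triangles but not on the edge.\<close>

lemma opposite_sides:
  assumes "K \<in> T" "L \<in> T" "K \<noteq> L" "is_triangle a b c K" "is_triangle a b d L"
  shows "cross2 (b - a) (c - a) * cross2 (b - a) (d - a) < 0"
proof (rule ccontr)
  assume "\<not> ?thesis"
  moreover have D: "cross2 (b - a) (c - a) \<noteq> 0" "cross2 (b - a) (d - a) \<noteq> 0"
    using assms by (auto simp: is_triangle_def)
  ultimately have pos: "0 < cross2 (b - a) (c - a) * cross2 (b - a) (d - a)"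
    by (metis linorder_neqE_linordered_idom mult_eq_0_iff)
  have D': "cross2 (d - b) (a - b) \<noteq> 0" "cross2 (a - d) (b - d) \<noteq> 0"
    using is_triangle_rotate[OF assms(5)] is_triangle_rotate[OF is_triangle_rotate[OF assms(5)]]
    by (auto simp: is_triangle_def)
  \<comment> \<open>The coordinates of \<open>p\<close> at the ends of the edge, relative to
    \<open>L\<close>, are \<open>1/2 - t * (1/2 - \<alpha>)\<close> and
    \<open>1/2 - t * (1/2 - \<beta>)\<close>; this \<open>t\<close> keeps them nonnegative.\<close>
  define \<alpha> \<beta> t where "\<alpha> = bary b d a c" and "\<beta> = bary d a b c" and "t = 1 / (2 * (1 + \<bar>\<alpha>\<bar> + \<bar>\<beta>\<bar>))"
  define m p where "m = midpoint a b" and "p = (1 - t) *\<^sub>R m + t *\<^sub>R c"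
  have m: "m = (1 - 1/2) *\<^sub>R a + (1/2) *\<^sub>R b" by (simp add: m_def midpoint_def scaleR_add_right)
  have t: "0 < t" "t \<le> 1" "t * (2 * (1 + \<bar>\<alpha>\<bar> + \<bar>\<beta>\<bar>)) = 1"
    by (auto simp: t_def field_simps)
  have bm: "bary a b d m = 0" "bary b d a m = 1/2" "bary d a b m = 1/2" "bary a b c m = 0"
    unfolding m bary_affine using D D' by simp_all
  have seg: "closed_segment a b \<in> edges K" "closed_segment a b \<in> edges L"
    by (simp_all add: edges_triangle[OF assms(4)] edges_triangle[OF assms(5)])
  have "m \<in> K"
    unfolding m_def using midpoint_edge(1)[OF assms(4)] edge_subset[OF seg(1)] by blast
  moreover have "K = convex hull {a, b, c}" using assms(4) by (simp add: is_triangle_def)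
  then have "c \<in> K" "convex K" by (simp_all add: hull_inc)
  ultimately have mc: "m \<in> K" "c \<in> K" "convex K" by auto
  then have pK: "p \<in> K" unfolding p_def using t mc by (intro convexD) auto
  have "bary a b d p = t * (cross2 (b - a) (c - a) / cross2 (b - a) (d - a))"
    unfolding p_def bary_affine bm by (simp add: bary_def)
  moreover have "0 < cross2 (b - a) (c - a) / cross2 (b - a) (d - a)"
    using pos by (simp add: zero_less_divide_iff zero_less_mult_iff)
  ultimately have 1: "0 \<le> bary a b d p" using t(1) by (simp only: mult_pos_pos less_imp_le)
  have half: "t * (1 + \<bar>\<alpha>\<bar> + \<bar>\<beta>\<bar>) = 1/2" using t(3) by (simp add: algebra_simps)
  have "t * (1/2 - \<alpha>) \<le> t * (1 + \<bar>\<alpha>\<bar> + \<bar>\<beta>\<bar>)" "t * (1/2 - \<beta>) \<le> t * (1 + \<bar>\<alpha>\<bar> + \<bar>\<beta>\<bar>)"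
    using t by (intro mult_left_mono; simp)+
  moreover have "(1 - t) * (1/2) + t * x = 1/2 - t * (1/2 - x)" for x
    by (simp add: diff_divide_distrib right_diff_distrib)
  ultimately have "0 \<le> (1 - t) * (1/2) + t * \<alpha>" "0 \<le> (1 - t) * (1/2) + t * \<beta>"
    unfolding half by simp_all
  then have 2: "0 \<le> bary b d a p" "0 \<le> bary d a b p"
    unfolding p_def bary_affine bm \<alpha>_def[symmetric] \<beta>_def[symmetric] .
  have pL: "p \<in> L" using triangle_mem_iff[OF D(2)] 1 2 assms(5) by (simp add: is_triangle_def)
  have "p \<in> closed_segment a b" using shared_edge[OF assms(1-3) seg] pK pL by blast
  then obtain s where "p = (1 - s) *\<^sub>R a + s *\<^sub>R b" by (auto simp: in_segment)
  then have "bary a b c p = 0" using D by (simp only: bary_affine) simp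
  moreover have "bary a b c p = t" unfolding p_def bary_affine bm using D by simp
  ultimately show False using t by simp
qed

text \<open>Near an inner point of the edge the coordinates at \<open>a\<close> and \<open>b\<close>
  are positive for both triangles, and the sign of the remaining one tells in which triangle a point
  lies.\<close>

lemma interior_shared_edge:
  assumes "K \<in> T" "L \<in> T" "K \<noteq> L" "is_triangle a b c K" "is_triangle a b d L" "x \<in> open_segment a b"
  shows "x \<in> interior (K \<union> L)"
proof -
  have neg: "cross2 (b - a) (c - a) * cross2 (b - a) (d - a) < 0" by (rule opposite_sides) fact+
  have D: "cross2 (b - a) (c - a) \<noteq> 0" "cross2 (b - a) (d - a) \<noteq> 0"
    using neg by auto
  have D': "cross2 (c - b) (a - b) \<noteq> 0" "cross2 (a - c) (b - c) \<noteq> 0"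
    "cross2 (d - b) (a - b) \<noteq> 0" "cross2 (a - d) (b - d) \<noteq> 0"
    using D by (simp_all add: cross2_def algebra_simps)
  define W where "W = {y. 0 < bary b c a y} \<inter> {y. 0 < bary c a b y} \<inter> ({y. 0 < bary b d a y} \<inter> {y. 0 < bary d a b y})"
  have "open W" unfolding W_def by (intro open_Int open_bary)
  moreover obtain s where s: "0 < s" "s < 1" "x = (1 - s) *\<^sub>R a + s *\<^sub>R b"
    using assms(6) by (auto simp: in_segment)
  have "x \<in> W" unfolding W_def s(3) Int_iff mem_Collect_eq bary_affine using D D' s by simp
  moreover have "W \<subseteq> K \<union> L"
  proof
    fix y assume y: "y \<in> W"
    have "0 \<le> bary a b c y \<or> 0 \<le> bary a b d y"
      using neg unfolding bary_def by (auto simp: zero_le_divide_iff mult_less_0_iff)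
    then show "y \<in> K \<union> L"
      using y assms(4,5) triangle_mem_iff[OF D(1)] triangle_mem_iff[OF D(2)]
      by (auto simp: W_def is_triangle_def)
  qed
  ultimately show ?thesis by (meson interiorI)
qed

text \<open>Any other cell through \<open>x\<close> would contain the whole edge as one of its
  edges. So if \<open>x\<close> were interior to the union, \<open>K\<close> alone would be a
  neighbourhood of \<open>x\<close>, which is impossible on a proper face.\<close>

lemma boundary_edge:
  assumes "K \<in> T" "is_triangle a b c K" "x \<in> open_segment a b"
    and alone: "\<And>L. L \<in> T \<Longrightarrow> closed_segment a b \<in> edges L \<Longrightarrow> L = K"
  shows "x \<notin> interior (\<Union>T)"
proof
  assume x: "x \<in> interior (\<Union>T)"
  define \<sigma> where "\<sigma> = closed_segment a b"
  have \<sigma>: "\<sigma> \<in> edges K" using edges_triangle[OF assms(2)] by (simp add: \<sigma>_def)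
  have x\<sigma>: "x \<in> \<sigma>" using assms(3) open_closed_segment by (auto simp: \<sigma>_def)
  have D: "cross2 (b - a) (c - a) \<noteq> 0" using assms(2) by (simp add: is_triangle_def)
  have xv: "x \<notin> vertices K"
  proof -
    obtain s where "x = (1 - s) *\<^sub>R a + s *\<^sub>R b" using x\<sigma> by (auto simp: \<sigma>_def in_segment)
    then have "bary a b c x = 0" using D by (simp only: bary_affine) simp
    then have "x \<noteq> c" using bary_vertex(3)[OF D] by auto
    moreover have "x \<noteq> a" "x \<noteq> b" using assms(3) by (auto simp: open_segment_def)
    ultimately show ?thesis by (simp add: vertices_triangle[OF assms(2)])
  qed
  have out: "x \<notin> M" if M: "M \<in> T" "M \<noteq> K" for M
  proof
    assume xM: "x \<in> M"
    have xK: "x \<in> K" using x\<sigma> edge_subset[OF \<sigma>] by blast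
    have e: "K \<inter> M \<in> edges K" "K \<inter> M \<in> edges M"
      using Int_edge[OF assms(1) M(1) M(2)[symmetric] xK xM xv] .
    \<comment> \<open>Two edges of \<open>K\<close> through a point that is not a vertex coincide,
      since their intersection is again a face.\<close>
    have "K \<inter> M \<inter> \<sigma> face_of K" using face_of_Int edge_face e(1) \<sigma> by blast
    moreover have "x \<in> K \<inter> M \<inter> \<sigma>" using xK xM x\<sigma> by blast
    ultimately have "K \<inter> M \<inter> \<sigma> = K \<or> K \<inter> M \<inter> \<sigma> \<in> edges K"
      using face_triangle_cases[OF assms(2)] xv by blast
    moreover have "K \<inter> M \<inter> \<sigma> \<noteq> K" using triangle_antimono[OF assms(1) M(1)] M(2) by blast
    ultimately have "K \<inter> M \<inter> \<sigma> \<in> edges K" by blast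
    then have "K \<inter> M \<inter> \<sigma> = \<sigma>" "K \<inter> M \<inter> \<sigma> = K \<inter> M"
      using edge_subset_edge \<sigma> e(1) by blast+
    then have "\<sigma> \<in> edges M" using e(2) by simp
    then show False using alone[of M] M by (simp add: \<sigma>_def)
  qed
  define U where "U = - \<Union>(T - {K}) \<inter> interior (\<Union>T)"
  have "closed (\<Union>(T - {K}))"
    using finite_T simplex closed_simplex by (intro closed_Union) auto
  then have "open U" unfolding U_def by (intro open_Int) auto
  moreover have "x \<in> U" using out x by (auto simp: U_def)
  moreover have "U \<subseteq> K" using interior_subset[of "\<Union>T"] unfolding U_def by blast
  ultimately have "x \<in> interior K" by (rule interiorI)
  moreover have "\<sigma> \<noteq> K" using edge_aff_dim[OF \<sigma>] aff_dim_simplex[OF simplex[OF assms(1)]] by auto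
  then have "\<sigma> \<inter> interior K = {}" using face_of_disjoint_interior[OF edge_face[OF \<sigma>]] by blast
  ultimately show False using x\<sigma> by blast
qed

section \<open>Interior and boundary edges\<close>

definition shared :: "(real^2) set \<Rightarrow> bool" where
  "shared \<sigma> \<longleftrightarrow> (\<exists>K\<in>T. \<exists>L\<in>T. K \<noteq> L \<and> \<sigma> \<in> edges K \<and> \<sigma> \<in> edges L)"

lemma mesh_edge_obtain:
  assumes "\<sigma> \<in> mesh_edges T"
  obtains K a b c where "K \<in> T" "is_triangle a b c K" "\<sigma> = closed_segment a b" "\<sigma> \<in> edges K" "a \<noteq> b"
proof -
  obtain K where K: "K \<in> T" "\<sigma> \<in> edges K" using assms by (auto simp: mesh_edges_def)
  then show ?thesis using edge_ends[OF simplex[OF K(1)] K(2)] that by (metis is_triangle_def)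
qed

text \<open>Passes from topology to incidence. Two cells together surround the inner points of their
  common edge, whereas the inner points of an edge of a single cell avoid \<open>\<Omega>\<close>,
  and by closure the whole edge lies on the frontier.\<close>

lemma int_edge_iff: "\<sigma> \<in> int_edges \<Omega> T \<longleftrightarrow> \<sigma> \<in> mesh_edges T \<and> shared \<sigma>"
  and ext_edge_iff: "\<sigma> \<in> ext_edges \<Omega> T \<longleftrightarrow> \<sigma> \<in> mesh_edges T \<and> \<not> shared \<sigma>"
proof -
  have inn: "rel_interior \<sigma> \<subseteq> \<Omega>" "rel_interior \<sigma> \<noteq> {}" if "\<sigma> \<in> mesh_edges T" "shared \<sigma>"
  proof -
    obtain K L where KL: "K \<in> T" "L \<in> T" "K \<noteq> L" "\<sigma> \<in> edges K" "\<sigma> \<in> edges L"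
      using \<open>shared \<sigma>\<close> unfolding shared_def by blast
    obtain a b c where t: "is_triangle a b c K" "\<sigma> = closed_segment a b"
      using edge_ends[OF simplex[OF KL(1)] KL(4)] .
    obtain d where t': "is_triangle a b d L" using apex KL(2,5) t(2) by blast
    have ab: "a \<noteq> b" using t by (simp add: is_triangle_def)
    have "open_segment a b \<subseteq> interior (K \<union> L)"
      using interior_shared_edge[OF KL(1-3) t(1) t'] by blast
    also have "\<dots> \<subseteq> interior (\<Union>T)" using KL by (intro interior_mono) auto
    finally show "rel_interior \<sigma> \<subseteq> \<Omega>" using ab by (simp add: interior_cover t(2) rel_interior_closed_segment)
    show "rel_interior \<sigma> \<noteq> {}" using ab by (simp add: t(2) rel_interior_closed_segment)
  qed
  have out: "\<sigma> \<subseteq> frontier \<Omega>" "\<not> rel_interior \<sigma> \<subseteq> \<Omega>" if "\<sigma> \<in> mesh_edges T" "\<not> shared \<sigma>"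
  proof -
    obtain K a b c where t: "K \<in> T" "is_triangle a b c K" "\<sigma> = closed_segment a b" "\<sigma> \<in> edges K" "a \<noteq> b"
      using mesh_edge_obtain[OF \<open>\<sigma> \<in> mesh_edges T\<close>] .
    have alone: "L = K" if "L \<in> T" "closed_segment a b \<in> edges L" for L
      using that t(1,3,4) \<open>\<not> shared \<sigma>\<close> by (auto simp: shared_def)
    have "x \<notin> \<Omega>" if "x \<in> open_segment a b" for x
      using boundary_edge[OF t(1,2) that alone] by (simp add: interior_cover)
    then have disj: "open_segment a b \<inter> \<Omega> = {}" by blast
    then show "\<not> rel_interior \<sigma> \<subseteq> \<Omega>" 
    proof -
      have ne: "open_segment a b \<noteq> {}" using t(5) by simp
      have "\<not> open_segment a b \<subseteq> \<Omega>"
      proof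
        assume "open_segment a b \<subseteq> \<Omega>"
        then have "open_segment a b \<inter> \<Omega> = open_segment a b" by (rule Int_absorb2)
        with disj ne show False by (simp only:)
      qed
      then show ?thesis using t(3,5) by (simp add: rel_interior_closed_segment)
    qed
    have "open_segment a b \<subseteq> closed_segment a b" by (rule segment_open_subset_closed)
    also have "closed_segment a b \<subseteq> K" using edge_subset[OF t(4)] t(3) by simp
    also have "K \<subseteq> closure \<Omega>" unfolding cover[symmetric] using t(1) by (rule Union_upper)
    finally have "open_segment a b \<subseteq> closure \<Omega>" .
    then have "open_segment a b \<subseteq> frontier \<Omega>"
      unfolding frontier_def interior_open[OF open_\<Omega>] using disj by (simp only: Diff_eq Int_subset_iff disjoint_eq_subset_Compl)
    then have "closure (open_segment a b) \<subseteq> frontier \<Omega>" by (rule closure_minimal) (rule frontier_closed)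
    then show "\<sigma> \<subseteq> frontier \<Omega>" using t(3,5) by (simp add: closure_open_segment)
  qed
  show "\<sigma> \<in> int_edges \<Omega> T \<longleftrightarrow> \<sigma> \<in> mesh_edges T \<and> shared \<sigma>"
    using inn(1) out(2) by (cases "\<sigma> \<in> mesh_edges T"; cases "shared \<sigma>") (simp_all add: int_edges_def)
  have "\<not> \<sigma> \<subseteq> frontier \<Omega>" if "\<sigma> \<in> mesh_edges T" "shared \<sigma>"
  proof
    assume "\<sigma> \<subseteq> frontier \<Omega>"
    then have "rel_interior \<sigma> \<subseteq> frontier \<Omega>" using rel_interior_subset by (rule order_trans[rotated])
    moreover have "frontier \<Omega> \<inter> \<Omega> = {}" unfolding frontier_def interior_open[OF open_\<Omega>] by blast
    ultimately have "rel_interior \<sigma> \<subseteq> {}" using inn(1)[OF that] by (metis le_inf_iff)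
    then show False using inn(2)[OF that] by simp
  qed
  then show "\<sigma> \<in> ext_edges \<Omega> T \<longleftrightarrow> \<sigma> \<in> mesh_edges T \<and> \<not> shared \<sigma>"
    using out(1) by (cases "\<sigma> \<in> mesh_edges T"; cases "shared \<sigma>") (simp_all add: ext_edges_def)
qed

text \<open>Of three apexes off the line of the edge, two lie on the same side.\<close>

lemma third_triangle:
  assumes "K \<in> T" "L \<in> T" "M \<in> T" "\<sigma> \<in> edges K" "\<sigma> \<in> edges L" "\<sigma> \<in> edges M" "K \<noteq> L" "K \<noteq> M"
  shows "L = M"
proof (rule ccontr)
  assume LM: "L \<noteq> M"
  obtain a b c where t: "is_triangle a b c K" "\<sigma> = closed_segment a b"
    using edge_ends[OF simplex[OF assms(1)] assms(4)] .
  obtain d where d: "is_triangle a b d L" using apex assms t(2) by blast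
  obtain e where e: "is_triangle a b e M" using apex assms t(2) by blast
  show False
    using opposite_sides[OF assms(1,2,7) t(1) d] opposite_sides[OF assms(1,3,8) t(1) e] opposite_sides[OF assms(2,3) LM d e]
    by (auto simp: mult_less_0_iff)
qed

lemma opposite_tri_eq:
  assumes "K \<in> T" "L \<in> T" "K \<noteq> L" "\<sigma> \<in> edges K" "\<sigma> \<in> edges L"
  shows "opposite_tri T K \<sigma> = L"
  unfolding opposite_tri_def by (rule the_equality) (use assms third_triangle in blast)+

lemma edge_tri_mem:
  assumes "\<sigma> \<in> mesh_edges T"
  shows "edge_tri T \<sigma> \<in> T" "\<sigma> \<in> edges (edge_tri T \<sigma>)"
proof -
  have "\<exists>K. K \<in> T \<and> \<sigma> \<in> edges K" using assms by (auto simp: mesh_edges_def)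
  then have "edge_tri T \<sigma> \<in> T \<and> \<sigma> \<in> edges (edge_tri T \<sigma>)"
    unfolding edge_tri_def by (rule someI_ex)
  then show "edge_tri T \<sigma> \<in> T" "\<sigma> \<in> edges (edge_tri T \<sigma>)" by auto
qed

text \<open>Which of the two cells \<open>edge_tri\<close> picks is undetermined; later uses treat
  both cases alike.\<close>

lemma edge_tris_shared:
  assumes "K \<in> T" "L \<in> T" "K \<noteq> L" "\<sigma> \<in> edges K" "\<sigma> \<in> edges L"
  shows "(edge_tri T \<sigma> = K \<and> edge_tri2 T \<sigma> = L) \<or> (edge_tri T \<sigma> = L \<and> edge_tri2 T \<sigma> = K)"
proof -
  have m: "\<sigma> \<in> mesh_edges T" using assms by (auto simp: mesh_edges_def)
  have "edge_tri T \<sigma> = K \<or> edge_tri T \<sigma> = L"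
    using third_triangle[of K "edge_tri T \<sigma>" L] edge_tri_mem[OF m] assms by blast
  then show ?thesis
    unfolding edge_tri2_def using opposite_tri_eq assms by metis
qed

lemma edge_tri_unshared:
  assumes "K \<in> T" "\<sigma> \<in> edges K" "\<not> shared \<sigma>"
  shows "edge_tri T \<sigma> = K"
proof -
  have "\<sigma> \<in> mesh_edges T" using assms by (auto simp: mesh_edges_def)
  then show ?thesis using edge_tri_mem assms unfolding shared_def by blast
qed

text \<open>Its sign depends on the choice made by \<open>edge_tri\<close>, so it is used through
  squares and absolute values. On a boundary edge it is the jump to the value zero outside.\<close>

definition jump :: "((real^2) set \<Rightarrow> real) \<Rightarrow> (real^2) set \<Rightarrow> real" where
  "jump f \<sigma> = (if shared \<sigma> then f (edge_tri2 T \<sigma>) - f (edge_tri T \<sigma>) else f (edge_tri T \<sigma>))"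

text \<open>The exterior \<open>outside\<close> is treated as one more cell, on which discrete functions vanish.\<close>

definition outside :: "(real^2) set" where
  "outside = closure (- \<Union>T)"

text \<open>Asking for the interior to meet \<open>B\<close> leaves an open piece of the cell in an
  open \<open>B\<close>, which survives the removal of the finitely many vertices.\<close>

definition nodes :: "(real^2) set \<Rightarrow> (real^2) set set" where
  "nodes B = {K \<in> insert outside T. interior K \<inter> B \<noteq> {}}"

definition node_value :: "((real^2) set \<Rightarrow> real) \<Rightarrow> (real^2) set \<Rightarrow> real" where
  "node_value f K = (if K \<in> T then f K else 0)"

section \<open>Oscillation of discrete functions on a ball\<close>

lemma finite_mesh_edges: "finite (mesh_edges T)"
proof -
  have "finite (edges K)" if "K \<in> T" for K
    using triangle_exists[OF simplex[OF that]] edges_triangle by (metis finite.emptyI finite_insert)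
  then show ?thesis using finite_T by (simp add: mesh_edges_def)
qed

lemma finite_vertices: "finite (\<Union>(vertices ` T))"
proof -
  have "finite (vertices K)" if "K \<in> T" for K
    using triangle_exists[OF simplex[OF that]] vertices_triangle by (metis finite.emptyI finite_insert)
  then show ?thesis using finite_T by simp
qed

lemma closed_Union: "closed (\<Union>T)"
  by (simp add: cover)

text \<open>Two cells through a point that is not a vertex meet in an edge. If one of them is
  \<open>outside\<close>, the point is not interior to the union, so it lies on an edge of the other
  cell, and that edge is unshared by \<open>interior_shared_edge\<close>.\<close>

lemma crossing_edge:
  assumes "X \<in> insert outside T" "Y \<in> insert outside T" "X \<noteq> Y" "x \<in> X" "x \<in> Y" "x \<notin> \<Union>(vertices ` T)"
  shows "\<exists>\<sigma>\<in>mesh_edges T. x \<in> \<sigma> \<and> \<bar>node_value f X - node_value f Y\<bar> = \<bar>jump f \<sigma>\<bar>"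
proof -
  have out: "outside \<notin> T"
  proof
    assume "outside \<in> T"
    then have "closure (- \<Union>T) \<subseteq> \<Union>T" by (auto simp: outside_def)
    then have "- \<Union>T = {}" using closure_subset by blast
    then have "closure \<Omega> = UNIV" by (auto simp: cover)
    then show False using bounded_\<Omega> bounded_closure not_bounded_UNIV by metis
  qed
  have two: "\<exists>\<sigma>\<in>mesh_edges T. x \<in> \<sigma> \<and> \<bar>node_value f X - node_value f Y\<bar> = \<bar>jump f \<sigma>\<bar>"
    if XY: "X \<in> T" "Y \<in> T" "X \<noteq> Y" "x \<in> X" "x \<in> Y" for X Y
  proof -
    have e: "X \<inter> Y \<in> edges X" "X \<inter> Y \<in> edges Y"
      using Int_edge[OF XY] assms(6) XY(1) by auto
    have sh: "shared (X \<inter> Y)" using XY e by (auto simp: shared_def)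
    have "\<bar>f X - f Y\<bar> = \<bar>jump f (X \<inter> Y)\<bar>"
      using edge_tris_shared[OF XY(1-3) e] sh by (auto simp: jump_def)
    then show "\<exists>\<sigma>\<in>mesh_edges T. x \<in> \<sigma> \<and> \<bar>node_value f X - node_value f Y\<bar> = \<bar>jump f \<sigma>\<bar>"
      using XY e by (intro bexI[of _ "X \<inter> Y"]) (auto simp: node_value_def mesh_edges_def)
  qed
  have one: "\<exists>\<sigma>\<in>mesh_edges T. x \<in> \<sigma> \<and> \<bar>node_value f X\<bar> = \<bar>jump f \<sigma>\<bar>"
    if X: "X \<in> T" "x \<in> X" "x \<in> outside" for X
  proof -
    have notin: "x \<notin> interior (\<Union>T)" using X(3) by (simp add: outside_def closure_complement)
    obtain a b c where t: "is_triangle a b c X" using triangle_exists simplex X by blast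
    have "x \<notin> interior X" using notin interior_mono[of X "\<Union>T"] X by blast
    have D: "cross2 (b - a) (c - a) \<noteq> 0" using t by (simp add: is_triangle_def)
    have m: "0 \<le> bary b c a x \<and> 0 \<le> bary c a b x \<and> 0 \<le> bary a b c x"
      using triangle_mem_iff[OF D] t X(2) by (simp add: is_triangle_def)
    have "\<not> (0 < bary b c a x \<and> 0 < bary c a b x \<and> 0 < bary a b c x)"
    proof
      assume pos: "0 < bary b c a x \<and> 0 < bary c a b x \<and> 0 < bary a b c x"
      define W where "W = {y. 0 < bary b c a y} \<inter> ({y. 0 < bary c a b y} \<inter> {y. 0 < bary a b c y})"
      have "open W" unfolding W_def by (intro open_Int open_bary)
      moreover have "W \<subseteq> X"
      proof
        fix y assume "y \<in> W"
        then have "y \<in> convex hull {a, b, c}" unfolding triangle_mem_iff[OF D] by (simp add: W_def)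
        then show "y \<in> X" using t by (simp add: is_triangle_def)
      qed
      ultimately have "x \<in> interior X" using pos by (intro interiorI[of W]) (auto simp: W_def)
      with \<open>x \<notin> interior X\<close> show False by simp
    qed
    then have zero: "bary b c a x = 0 \<or> bary c a b x = 0 \<or> bary a b c x = 0" using m by auto
    note t' = is_triangle_rotate[OF t] and t'' = is_triangle_rotate[OF is_triangle_rotate[OF t]]
    have "x \<in> closed_segment a b \<or> x \<in> closed_segment b c \<or> x \<in> closed_segment c a"
      using zero
    proof (elim disjE)
      assume "bary b c a x = 0"
      then have "x \<in> closed_segment b c" by (rule bary_zero_segment[OF t']) (use m in simp_all)
      then show ?thesis by simp
    next
      assume "bary c a b x = 0"
      then have "x \<in> closed_segment c a" by (rule bary_zero_segment[OF t'']) (use m in simp_all)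
      then show ?thesis by simp
    next
      assume "bary a b c x = 0"
      then have "x \<in> closed_segment a b" by (rule bary_zero_segment[OF t]) (use m in simp_all)
      then show ?thesis by simp
    qed
    then have "\<exists>\<sigma>\<in>edges X. x \<in> \<sigma>"
      by (simp add: edges_triangle[OF t])
    then obtain \<sigma> where \<sigma>: "\<sigma> \<in> edges X" "x \<in> \<sigma>" by blast
    obtain a b c where t: "is_triangle a b c X" "\<sigma> = closed_segment a b"
      using edge_ends[OF simplex[OF X(1)] \<sigma>(1)] .
    have "x \<noteq> a" "x \<noteq> b" using assms(6) X(1) vertices_triangle[OF t(1)] by auto
    then have xo: "x \<in> open_segment a b" using \<sigma>(2) t(2) by (simp add: open_segment_def)
    have ns: "\<not> shared \<sigma>"
    proof
      assume "shared \<sigma>"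
      then obtain K L where KL: "K \<in> T" "L \<in> T" "K \<noteq> L" "\<sigma> \<in> edges K" "\<sigma> \<in> edges L"
        unfolding shared_def by blast
      obtain c' where c': "is_triangle a b c' K" using apex KL t(2) by blast
      obtain d where d: "is_triangle a b d L" using apex KL t(2) by blast
      have "x \<in> interior (K \<union> L)" by (rule interior_shared_edge[OF KL(1-3) c' d xo])
      then have "x \<in> interior (\<Union>T)" using KL interior_mono[of "K \<union> L" "\<Union>T"] by blast
      with notin show False by simp
    qed
    have "jump f \<sigma> = f X" using ns edge_tri_unshared[OF X(1) \<sigma>(1) ns] by (simp add: jump_def)
    then show ?thesis using \<sigma> X by (intro bexI[of _ \<sigma>]) (auto simp: node_value_def mesh_edges_def)
  qed
  consider "X \<in> T" "Y \<in> T" | "X \<in> T" "Y = outside" | "X = outside" "Y \<in> T"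
    using assms by blast
  then show ?thesis
  proof cases
    case 1
    then show ?thesis using two assms by blast
  next
    case 2
    then show ?thesis using one[of X] assms out by (simp add: node_value_def)
  next
    case 3
    then show ?thesis using one[of Y] assms out by (simp add: node_value_def)
  qed
qed

text \<open>Starting from \<open>x\<close>, a set is enlarged by one element at a time across its
  cut, at a cost \<open>J\<close> each. Connectedness is stated by cuts rather than paths because
  this is the form in which topological connectedness supplies it.\<close>

lemma chain_bound:
  fixes g :: "'a \<Rightarrow> real"
  assumes V: "finite V" and J: "0 \<le> J"
    and link: "\<And>S. S \<subseteq> V \<Longrightarrow> S \<noteq> {} \<Longrightarrow> S \<noteq> V \<Longrightarrow> \<exists>x\<in>S. \<exists>y\<in>V - S. \<bar>g x - g y\<bar> \<le> J"
    and "x \<in> V" "y \<in> V"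
  shows "\<bar>g x - g y\<bar> \<le> real (card V) * J"
proof -
  have grow: "k < card V \<Longrightarrow> \<exists>S\<subseteq>V. x \<in> S \<and> card S = Suc k \<and> (\<forall>z\<in>S. \<bar>g x - g z\<bar> \<le> real k * J)" for k
  proof (induction k)
    case 0
    show ?case using \<open>x \<in> V\<close> by (intro exI[of _ "{x}"]) auto
  next
    case (Suc k)
    then obtain S where S: "S \<subseteq> V" "x \<in> S" "card S = Suc k" "\<forall>z\<in>S. \<bar>g x - g z\<bar> \<le> real k * J" by auto
    then have "S \<noteq> V" using Suc.prems by auto
    then obtain u w where u: "u \<in> S" "w \<in> V - S" "\<bar>g u - g w\<bar> \<le> J" using link[OF S(1)] S(2) by blast
    have k1: "real (Suc k) * J = real k * J + J" by (simp add: algebra_simps)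
    have "\<bar>g x - g w\<bar> \<le> real (Suc k) * J"
      using S(4)[rule_format, OF u(1)] u(3) unfolding k1 by linarith
    moreover have "\<bar>g x - g z\<bar> \<le> real (Suc k) * J" if "z \<in> S" for z
      using S(4)[rule_format, OF that] J unfolding k1 by linarith
    moreover have "card (insert w S) = Suc (Suc k)"
      using S u V finite_subset[OF S(1) V] by auto
    ultimately show ?case using S u by (intro exI[of _ "insert w S"]) auto
  qed
  have "V \<noteq> {}" using \<open>x \<in> V\<close> by auto
  then have "card V > 0" using V by (simp add: card_gt_0_iff)
  then obtain S where S: "S \<subseteq> V" "card S = card V" "\<forall>z\<in>S. \<bar>g x - g z\<bar> \<le> real (card V - 1) * J"
    using grow[of "card V - 1"] by auto
  have "S = V" by (rule card_subset_eq[OF V S(1,2)])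
  then have "\<bar>g x - g y\<bar> \<le> real (card V - 1) * J" using S(3) \<open>y \<in> V\<close> by simp
  also have "\<dots> \<le> real (card V) * J" using J by (intro mult_right_mono) auto
  finally show ?thesis .
qed

text \<open>The ball stays connected after removal of the finitely many vertices, so its cells form a connected graph.\<close>

lemma local_oscillation:
  assumes "X \<in> nodes (ball p r)" "Y \<in> nodes (ball p r)"
  shows "(node_value f X - node_value f Y)\<^sup>2 \<le>
    (real (card (nodes (ball p r))))\<^sup>2 * (\<Sum>\<sigma>\<in>{\<sigma>\<in>mesh_edges T. \<sigma> \<inter> ball p r \<noteq> {}}. (jump f \<sigma>)\<^sup>2)"
proof -
  define B where "B = ball p r"
  define P where "P = \<Union>(vertices ` T)"
  define J where "J = sqrt (\<Sum>\<sigma>\<in>{\<sigma>\<in>mesh_edges T. \<sigma> \<inter> B \<noteq> {}}. (jump f \<sigma>)\<^sup>2)"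
  have fin: "finite (nodes B)" using finite_T by (simp add: nodes_def)
  have conn: "connected (B - P)"
    unfolding B_def P_def by (intro connected_open_delete_finite finite_vertices) auto
  have J0: "0 \<le> J" by (simp add: J_def sum_nonneg)
  have closedX: "closed X" if "X \<in> insert outside T" for X
    using that simplex closed_simplex by (auto simp: outside_def)
  have cov: "\<exists>X\<in>nodes B. x \<in> X" if x: "x \<in> B" for x
  proof -
    have "\<exists>X\<in>insert outside T. x \<in> X \<and> closure (interior X) = X"
    proof (cases "x \<in> \<Union>T")
      case True
      then obtain K where "K \<in> T" "x \<in> K" by auto
      then show ?thesis using interior_triangle(2)[OF simplex[of K]] by (intro bexI[of _ K]) simp_all
    next
      case False
      have "open (- \<Union>T)" using closed_Union by auto
      then have "- \<Union>T \<subseteq> interior outside" unfolding outside_def by (intro interior_maximal closure_subset)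
      then have "outside \<subseteq> closure (interior outside)"
        unfolding outside_def by (rule closure_mono)
      moreover have "closure (interior outside) \<subseteq> outside"
        by (rule closure_minimal[OF interior_subset]) (simp add: outside_def)
      ultimately have "closure (interior outside) = outside" by (rule equalityI[rotated])
      moreover have "x \<in> outside" using False closure_subset[of "- \<Union>T"] unfolding outside_def by auto
      ultimately show ?thesis by (intro bexI[of _ outside]) simp_all
    qed
    then obtain X where X: "X \<in> insert outside T" "x \<in> X" "closure (interior X) = X" by blast
    then have "B \<inter> closure (interior X) \<noteq> {}" using x by auto
    then have "B \<inter> interior X \<noteq> {}"
      using open_Int_closure_eq_empty[of B "interior X"] by (simp add: B_def)
    then have "X \<in> nodes B" using X(1) by (simp add: nodes_def Int_commute)
    then show ?thesis using X(2) by (rule bexI[rotated])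
  qed
  have ne: "X \<inter> (B - P) \<noteq> {}" if "X \<in> nodes B" for X
  proof
    assume "X \<inter> (B - P) = {}"
    then have "interior X \<inter> B \<subseteq> P" using interior_subset by blast
    then have "finite (interior X \<inter> B)" using finite_vertices finite_subset by (auto simp: P_def)
    moreover have "open (interior X \<inter> B)" unfolding B_def by (intro open_Int) auto
    ultimately have "interior X \<inter> B = {}" by (rule finite_imp_not_open)
    then show False using that by (simp add: nodes_def)
  qed
  have "\<bar>node_value f X - node_value f Y\<bar> \<le> real (card (nodes B)) * J"
  proof (rule chain_bound[OF fin J0])
    fix S assume S: "S \<subseteq> nodes B" "S \<noteq> {}" "S \<noteq> nodes B"
    have cl: "closed (\<Union>S')" if "S' \<subseteq> nodes B" for S'
      using that finite_subset[OF that fin] closedX by (intro Topological_Spaces.closed_Union) (auto simp: nodes_def)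
    \<comment> \<open>Otherwise the two closed unions would disconnect \<open>B - P\<close>.\<close>
    have "\<Union>S \<inter> \<Union>(nodes B - S) \<inter> (B - P) \<noteq> {}"
    proof
      assume e: "\<Union>S \<inter> \<Union>(nodes B - S) \<inter> (B - P) = {}"
      have "B - P \<subseteq> \<Union>S \<union> \<Union>(nodes B - S)" using cov by blast
      moreover have "\<Union>S \<inter> (B - P) \<noteq> {}" "\<Union>(nodes B - S) \<inter> (B - P) \<noteq> {}"
        using S ne by blast+
      ultimately have "\<exists>A A'. closed A \<and> closed A' \<and> B - P \<subseteq> A \<union> A' \<and> A \<inter> A' \<inter> (B - P) = {} \<and>
          A \<inter> (B - P) \<noteq> {} \<and> A' \<inter> (B - P) \<noteq> {}"
        using e cl[OF S(1)] cl[OF Diff_subset] by (intro exI[of _ "\<Union>S"] exI[of _ "\<Union>(nodes B - S)"]) simp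
      with conn show False unfolding connected_closed by (rule notE)
    qed
    then obtain x X Y where x: "x \<in> B" "x \<notin> P" "X \<in> S" "Y \<in> nodes B - S" "x \<in> X" "x \<in> Y" by blast
    have "S \<subseteq> insert outside T" "nodes B \<subseteq> insert outside T" using S(1) by (auto simp: nodes_def)
    then have "X \<in> insert outside T" "Y \<in> insert outside T" "X \<noteq> Y" using x(3,4) by auto
    then obtain \<sigma> where \<sigma>: "\<sigma> \<in> mesh_edges T" "x \<in> \<sigma>" "\<bar>node_value f X - node_value f Y\<bar> = \<bar>jump f \<sigma>\<bar>"
      using crossing_edge[of X Y x f] x by (auto simp: P_def)
    \<comment> \<open>A single jump is at most the root of the sum of all squared jumps near the
      ball, so one \<open>J\<close> serves for every cut.\<close>
    have "(jump f \<sigma>)\<^sup>2 \<le> (\<Sum>\<sigma>\<in>{\<sigma>\<in>mesh_edges T. \<sigma> \<inter> B \<noteq> {}}. (jump f \<sigma>)\<^sup>2)"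
      using \<sigma> x finite_mesh_edges by (intro member_le_sum) auto
    then have "\<bar>jump f \<sigma>\<bar> \<le> J" unfolding J_def using real_sqrt_le_mono by fastforce
    then show "\<exists>x\<in>S. \<exists>y\<in>nodes B - S. \<bar>node_value f x - node_value f y\<bar> \<le> J"
      using x \<sigma> by (intro bexI[of _ X] bexI[of _ Y]) auto
  qed (use assms in \<open>auto simp: B_def\<close>)
  then have "(node_value f X - node_value f Y)\<^sup>2 \<le> (real (card (nodes B)) * J)\<^sup>2"
    using abs_le_square_iff[of "node_value f X - node_value f Y" "real (card (nodes B)) * J"] J0 by simp
  then show ?thesis by (simp add: power_mult_distrib J_def sum_nonneg B_def)
qed

end

section \<open>Sampling on a square grid\<close>

locale regular_mesh = triangle_mesh +
  fixes c\<^sub>0 :: real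
  assumes c0_pos: "0 < c\<^sub>0"
    and dist_ge: "\<sigma> \<in> mesh_edges T \<Longrightarrow> c\<^sub>0 * edge_length \<sigma> \<le> edge_dist \<Omega> T \<sigma>"
    and length_ge: "\<sigma> \<in> mesh_edges T \<Longrightarrow> c\<^sub>0 * mesh_size T \<le> edge_length \<sigma>"
begin

abbreviation h :: real where "h \<equiv> mesh_size T"

lemma circumdiameter_le: "K \<in> T \<Longrightarrow> circumdiameter K \<le> h"
  unfolding mesh_size_def using finite_T by (intro Max_ge) auto

lemma dist_in_cell: "K \<in> T \<Longrightarrow> x \<in> K \<Longrightarrow> y \<in> K \<Longrightarrow> dist x y \<le> h"
  using triangle_exists[OF simplex] dist_in_triangle circumdiameter_le by (metis order_trans)

lemma edge_length_bounds:
  assumes "\<sigma> \<in> mesh_edges T"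
  shows "0 < edge_length \<sigma>" "edge_length \<sigma> \<le> h"
proof -
  obtain K a b c where t: "K \<in> T" "is_triangle a b c K" "\<sigma> = closed_segment a b" "\<sigma> \<in> edges K" "a \<noteq> b"
    using mesh_edge_obtain[OF assms] .
  have "a \<in> K" "b \<in> K" using edge_subset[OF t(4)] t(3) by auto
  then show "edge_length \<sigma> \<le> h" using dist_in_cell[OF t(1)] t(3) by simp
  show "0 < edge_length \<sigma>" using t(3,5) by simp
qed

lemma T_nonempty: "T \<noteq> {}"
  using cover domain by (auto simp: polygonal_domain_def)

lemma h_pos: "0 < h"
proof -
  obtain K where K: "K \<in> T" using T_nonempty by auto
  obtain a b c where t: "is_triangle a b c K" using triangle_exists[OF simplex[OF K]] .
  have "closed_segment a b \<in> mesh_edges T" using K edges_triangle[OF t] by (auto simp: mesh_edges_def)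
  then show ?thesis using edge_length_bounds[of "closed_segment a b"] by linarith
qed

text \<open>By \<open>area_circumradius\<close>, the product of the edge lengths is twice the
  circumdiameter times the area; the edges are at least \<open>c\<^sub>0 * h\<close> and the
  circumdiameter is at most \<open>h\<close>.\<close>

lemma area_ge:
  assumes "K \<in> T"
  shows "c\<^sub>0 ^ 3 * h\<^sup>2 / 2 \<le> area K" "0 < area K"
proof -
  obtain a b c where t: "is_triangle a b c K" using triangle_exists[OF simplex[OF assms]] .
  have "closed_segment a b \<in> mesh_edges T" "closed_segment b c \<in> mesh_edges T" "closed_segment c a \<in> mesh_edges T"
    using assms edges_triangle[OF t] by (auto simp: mesh_edges_def)
  then have l: "c\<^sub>0 * h \<le> dist a b" "c\<^sub>0 * h \<le> dist b c" "c\<^sub>0 * h \<le> dist c a"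
    using length_ge by fastforce+
  have ch: "0 < c\<^sub>0 * h" using c0_pos h_pos by simp
  have "(c\<^sub>0 * h) * (c\<^sub>0 * h) * (c\<^sub>0 * h) \<le> dist a b * dist b c * dist c a"
    using l ch by (intro mult_mono) auto
  also have "\<dots> = 2 * circumdiameter K * area K"
    unfolding area_circumradius[OF t, symmetric] by (simp add: circumdiameter_def)
  also have "\<dots> \<le> 2 * h * area K"
    using circumdiameter_le[OF assms] by (intro mult_right_mono) (auto simp: area_def)
  finally have "h * (c\<^sub>0 ^ 3 * h\<^sup>2) \<le> h * (2 * area K)"
    by (simp add: power2_eq_square power3_eq_cube algebra_simps)
  then have "c\<^sub>0 ^ 3 * h\<^sup>2 \<le> 2 * area K" using h_pos by simp
  then show "c\<^sub>0 ^ 3 * h\<^sup>2 / 2 \<le> area K" by simp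
  moreover have "0 < c\<^sub>0 ^ 3 * h\<^sup>2 / 2" using c0_pos h_pos by simp
  ultimately show "0 < area K" by linarith
qed

lemma lmeasurable_cell: "K \<in> T \<Longrightarrow> K \<in> lmeasurable"
  using simplex compact_simplex lmeasurable_compact by blast

lemma disjoint_interior:
  assumes "K \<in> T" "L \<in> T" "K \<noteq> L"
  shows "interior K \<inter> L = {}"
proof -
  have "K \<inter> L \<noteq> K" using triangle_antimono[OF assms(1,2)] assms(3) by (metis Int_lower2)
  then have "(K \<inter> L) \<inter> interior K = {}" using face_of_disjoint_interior[OF face_Int[OF assms(1,2)]] by simp
  moreover have "interior K \<subseteq> K" by (rule interior_subset)
  ultimately show ?thesis by auto
qed

lemma negligible_Int:
  assumes "K \<in> T" "L \<in> T" "K \<noteq> L"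
  shows "negligible (K \<inter> L)"
proof -
  have "interior (K \<inter> L) \<subseteq> interior K \<inter> L" using interior_subset[of L] by (auto simp: interior_Int)
  then have "interior (K \<inter> L) = {}" using disjoint_interior[OF assms] by simp
  moreover have "convex (K \<inter> L)"
    using convex_simplex[OF simplex] assms by (intro convex_Int) auto
  ultimately show ?thesis by (simp add: negligible_convex_interior)
qed

text \<open>A square of side \<open>10 * h\<close> has area \<open>100 * h\<^sup>2\<close> and holds
  at most 200 / \<open>c\<^sub>0 ^ 3\<close> cells by \<open>area_ge\<close>; one more node is
  \<open>outside\<close>.\<close>

definition packing :: nat where
  "packing = nat \<lceil>200 / c\<^sub>0 ^ 3\<rceil> + 1"

lemma card_nodes_le: "card (nodes (ball p (4 * h))) \<le> packing"
proof -
  define F where "F = {K\<in>T. interior K \<inter> ball p (4 * h) \<noteq> {}}"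
  have fF: "finite F" "F \<subseteq> T" using finite_T by (auto simp: F_def)
  \<comment> \<open>The radius of the ball plus one cell diameter.\<close>
  define Q where "Q = cbox (p - (\<chi> i. 5 * h)) (p + (\<chi> i. 5 * h))"
  have sub: "\<Union>F \<subseteq> Q"
  proof
    fix x assume "x \<in> \<Union>F"
    then obtain K where K: "K \<in> F" "x \<in> K" by auto
    then obtain y where y: "y \<in> interior K" "dist p y < 4 * h" by (auto simp: F_def)
    have "dist y x \<le> h" using K y interior_subset[of K] by (intro dist_in_cell[of K]) (auto simp: F_def)
    then have "dist p x \<le> 5 * h" using dist_triangle[of p x y] y by linarith
    then have "norm (x - p) \<le> 5 * h" by (simp add: dist_norm norm_minus_commute)
    then have "\<bar>(x - p) $ i\<bar> \<le> 5 * h" for i using component_le_norm_cart[of "x - p" i] by linarith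
    then have "\<bar>x $ i - p $ i\<bar> \<le> 5 * h" for i by simp
    then show "x \<in> Q" by (auto simp: Q_def mem_box_cart abs_le_iff algebra_simps)
  qed
  have "real (card F) * (c\<^sub>0 ^ 3 * h\<^sup>2 / 2) = (\<Sum>K\<in>F. c\<^sub>0 ^ 3 * h\<^sup>2 / 2)" by simp
  also have "\<dots> \<le> (\<Sum>K\<in>F. measure lebesgue K)"
    using fF area_ge by (intro sum_mono) (auto simp: area_def)
  also have "\<dots> = measure lebesgue (\<Union>F)"
  proof (rule measure_negligible_finite_Union[symmetric])
    show "pairwise (\<lambda>S T. negligible (S \<inter> T)) F"
      unfolding pairwise_def using negligible_Int fF(2) by (metis subsetD)
  qed (use fF lmeasurable_cell in auto)
  also have "\<dots> \<le> measure lebesgue Q"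
    using sub fF lmeasurable_cell by (intro measure_mono_fmeasurable) (auto simp: Q_def intro!: fmeasurableD fmeasurable.finite_Union)
  also have "measure lebesgue Q = 100 * h\<^sup>2"
    using h_pos by (simp add: Q_def content_cbox_cart prod_2 UNIV_2 power2_eq_square interval_ne_empty_cart measure_completion)
  finally have "real (card F) * (c\<^sub>0 ^ 3 / 2) * h\<^sup>2 \<le> 100 * h\<^sup>2" by (simp add: algebra_simps)
  then have "real (card F) * (c\<^sub>0 ^ 3 / 2) \<le> 100" using h_pos by simp
  then have "real (card F) \<le> 200 / c\<^sub>0 ^ 3" using c0_pos by (simp add: field_simps)
  then have "card F \<le> nat \<lceil>200 / c\<^sub>0 ^ 3\<rceil>" by linarith
  moreover have "card (nodes (ball p (4 * h))) \<le> card (insert outside F)"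
    using fF by (intro card_mono) (auto simp: nodes_def F_def)
  moreover have "card (insert outside F) \<le> card F + 1" using fF by (simp add: card_insert_le_m1 card_insert_if)
  ultimately show ?thesis unfolding packing_def by linarith
qed

lemma cell_in_nodes:
  assumes "K \<in> T" "x \<in> K" "x \<in> ball p r"
  shows "K \<in> nodes (ball p r)"
proof -
  have "ball p r \<inter> closure (interior K) \<noteq> {}"
    using interior_triangle(2)[OF simplex[OF assms(1)]] assms by auto
  then have "ball p r \<inter> interior K \<noteq> {}" using open_Int_closure_eq_empty[of "ball p r" "interior K"] by simp
  then show ?thesis using assms(1) by (simp add: nodes_def Int_commute)
qed

lemma outside_in_nodes:
  assumes "x \<notin> \<Union>T" "x \<in> ball p r"
  shows "outside \<in> nodes (ball p r)"
proof -
  have "open (- \<Union>T)" using closed_Union by auto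
  then have "- \<Union>T \<subseteq> interior outside" unfolding outside_def by (intro interior_maximal closure_subset)
  then have "x \<in> interior outside" using assms(1) by auto
  then have "interior outside \<inter> ball p r \<noteq> {}" using assms(2) by (metis IntI empty_iff)
  then show ?thesis by (simp add: nodes_def)
qed

lemma outside_notin: "outside \<notin> T"
proof
  assume "outside \<in> T"
  then have "closure (- \<Union>T) \<subseteq> \<Union>T" by (auto simp: outside_def)
  then have "- \<Union>T = {}" using closure_subset by blast
  then have "closure \<Omega> = UNIV" by (auto simp: cover)
  then show False using bounded_\<Omega> bounded_closure not_bounded_UNIV by metis
qed

section \<open>Grid points and sampled functions\<close>

definition point :: "int \<times> int \<Rightarrow> real^2" where
  "point z = vector [h * of_int (fst z), h * of_int (snd z)]"

definition rep :: "(real^2) set \<Rightarrow> real^2" where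
  "rep K = (SOME x. x \<in> interior K)"

definition grid :: "(real^2) set \<Rightarrow> int \<times> int" where
  "grid K = (\<lfloor>rep K $ 1 / h\<rfloor>, \<lfloor>rep K $ 2 / h\<rfloor>)"

definition cell_at :: "int \<times> int \<Rightarrow> (real^2) set" where
  "cell_at z = (if point z \<in> \<Union>T then (SOME K. K \<in> T \<and> point z \<in> K) else outside)"

definition sample :: "((real^2) set \<Rightarrow> real) \<Rightarrow> int \<times> int \<Rightarrow> real" where
  "sample f z = node_value f (cell_at z)"

definition energy :: "((real^2) set \<Rightarrow> real) \<Rightarrow> real" where
  "energy f = (\<Sum>\<sigma>\<in>mesh_edges T. (jump f \<sigma>)\<^sup>2)"

text \<open>The radius \<open>4 * h\<close> reaches the cells located at \<open>z\<close> (within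
  \<open>2 * h\<close>), their neighbours (another \<open>2 * h\<close>) and the adjacent grid
  points. The factor \<open>packing\<close> squared comes from \<open>local_oscillation\<close>, and
  the 2 makes room for the two differences in \<open>gsq\<close>.\<close>

definition local_energy :: "((real^2) set \<Rightarrow> real) \<Rightarrow> int \<times> int \<Rightarrow> real" where
  "local_energy f z = 2 * (real packing)\<^sup>2 *
     (\<Sum>\<sigma>\<in>{\<sigma>\<in>mesh_edges T. \<sigma> \<inter> ball (point z) (4 * h) \<noteq> {}}. (jump f \<sigma>)\<^sup>2)"

definition nbrs :: "(real^2) set \<Rightarrow> (real^2) set set" where
  "nbrs K = {L\<in>T. L \<noteq> K \<and> (\<exists>\<sigma>. \<sigma> \<in> edges K \<and> \<sigma> \<in> edges L)}"

lemma rep_in: "K \<in> T \<Longrightarrow> rep K \<in> K"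
  using interior_triangle(1)[OF simplex] some_in_eq[of "interior K"] interior_subset[of K]
  by (auto simp: rep_def some_in_eq)

lemma norm_2_le: "norm (x :: real^2) \<le> \<bar>x $ 1\<bar> + \<bar>x $ 2\<bar>"
  using norm_le_l1_cart[of x] by (simp add: sum_2)

lemma dist_point_rep: "dist (point (grid K)) (rep K) < 2 * h"
proof -
  have frac: "\<bar>h * of_int \<lfloor>t / h\<rfloor> - t\<bar> < h" for t
  proof -
    have e: "h * (t / h) = t" using h_pos by simp
    have "of_int \<lfloor>t / h\<rfloor> \<le> t / h" "t / h < of_int \<lfloor>t / h\<rfloor> + 1" by linarith+
    then have "h * of_int \<lfloor>t / h\<rfloor> \<le> h * (t / h)" "h * (t / h) < h * (of_int \<lfloor>t / h\<rfloor> + 1)"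
      using h_pos by (intro mult_left_mono mult_strict_left_mono; simp)+
    then have "h * of_int \<lfloor>t / h\<rfloor> \<le> t" "t < h * of_int \<lfloor>t / h\<rfloor> + h"
      unfolding e distrib_left mult_1_right .
    then show ?thesis by linarith
  qed
  have "dist (point (grid K)) (rep K) \<le> \<bar>(point (grid K) - rep K) $ 1\<bar> + \<bar>(point (grid K) - rep K) $ 2\<bar>"
    unfolding dist_norm by (rule norm_2_le)
  also have "\<dots> = \<bar>h * of_int \<lfloor>rep K $ 1 / h\<rfloor> - rep K $ 1\<bar> + \<bar>h * of_int \<lfloor>rep K $ 2 / h\<rfloor> - rep K $ 2\<bar>"
    by (simp add: point_def grid_def)
  also have "\<dots> < h + h" by (intro add_strict_mono frac)
  finally show ?thesis by simp
qed

lemma self_node: "K \<in> T \<Longrightarrow> K \<in> nodes (ball (point (grid K)) (4 * h))"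
  using dist_point_rep[of K] h_pos by (intro cell_in_nodes[of K "rep K"] rep_in) auto

lemma nbr_dist:
  assumes "K \<in> T" "L \<in> nbrs K"
  shows "dist (rep K) (rep L) \<le> 2 * h"
proof -
  obtain \<sigma> where \<sigma>: "\<sigma> \<in> edges K" "\<sigma> \<in> edges L" and L: "L \<in> T" using assms(2) by (auto simp: nbrs_def)
  obtain a b c where "\<sigma> = closed_segment a b" using edge_ends[OF simplex[OF assms(1)] \<sigma>(1)] by metis
  then have "a \<in> K" "a \<in> L" using edge_subset[OF \<sigma>(1)] edge_subset[OF \<sigma>(2)] by auto
  then have "dist (rep K) a \<le> h" "dist a (rep L) \<le> h"
    using rep_in dist_in_cell assms(1) L by auto
  then show ?thesis using dist_triangle[of "rep K" "rep L" a] by linarith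
qed

lemma nbr_node:
  assumes "K \<in> T" "L \<in> nbrs K"
  shows "L \<in> nodes (ball (point (grid K)) (4 * h))"
proof -
  have "dist (point (grid K)) (rep L) < 4 * h"
    using nbr_dist[OF assms] dist_point_rep[of K] dist_triangle[of "point (grid K)" "rep L" "rep K"] by linarith
  moreover have "L \<in> T" using assms by (simp add: nbrs_def)
  ultimately show ?thesis by (intro cell_in_nodes[of L "rep L"] rep_in) auto
qed

lemma cell_at_node:
  assumes "point z \<in> ball p r"
  shows "cell_at z \<in> nodes (ball p r)"
proof (cases "point z \<in> \<Union>T")
  case True
  then have "\<exists>K. K \<in> T \<and> point z \<in> K" by auto
  then have "(SOME K. K \<in> T \<and> point z \<in> K) \<in> T \<and> point z \<in> (SOME K. K \<in> T \<and> point z \<in> K)" by (rule someI_ex)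
  then show ?thesis using True assms by (auto simp: cell_at_def intro: cell_in_nodes)
next
  case False
  then show ?thesis using outside_in_nodes[OF False assms] by (simp add: cell_at_def)
qed

lemma sample_oscillation:
  assumes "X \<in> nodes (ball (point z) (4 * h))" "Y \<in> nodes (ball (point z) (4 * h))"
  shows "2 * (node_value f X - node_value f Y)\<^sup>2 \<le> local_energy f z"
proof -
  define S where "S = (\<Sum>\<sigma>\<in>{\<sigma>\<in>mesh_edges T. \<sigma> \<inter> ball (point z) (4 * h) \<noteq> {}}. (jump f \<sigma>)\<^sup>2)"
  have "0 \<le> S" by (simp add: S_def sum_nonneg)
  moreover have "(real (card (nodes (ball (point z) (4 * h)))))\<^sup>2 \<le> (real packing)\<^sup>2"
    using card_nodes_le[of "point z"] by (intro power_mono) auto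
  ultimately have "(real (card (nodes (ball (point z) (4 * h)))))\<^sup>2 * S \<le> (real packing)\<^sup>2 * S"
    by (rule mult_right_mono[rotated])
  then show ?thesis using local_oscillation[OF assms, of f] by (simp add: local_energy_def S_def)
qed

text \<open>The coordinates of the representatives differ by at most \<open>2 * h\<close>, and
  taking floors adds at most one: this is the origin of the 3 in the locale
  \<open>upwind_flow\<close>.\<close>

lemma grid_near:
  assumes "K \<in> T" "L \<in> nbrs K"
  shows "\<bar>fst (grid K) - fst (grid L)\<bar> \<le> 3" "\<bar>snd (grid K) - snd (grid L)\<bar> \<le> 3"
proof -
  have fl: "\<bar>\<lfloor>s / h\<rfloor> - \<lfloor>t / h\<rfloor>\<bar> \<le> 3" if "\<bar>s - t\<bar> \<le> 2 * h" for s t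
  proof -
    have "\<bar>s / h - t / h\<bar> \<le> 2"
      using that h_pos by (simp add: diff_divide_distrib[symmetric] abs_divide field_simps)
    then show ?thesis by linarith
  qed
  have "\<bar>(rep K - rep L) $ i\<bar> \<le> 2 * h" for i
    using nbr_dist[OF assms] component_le_norm_cart[of "rep K - rep L" i] unfolding dist_norm by linarith
  then show "\<bar>fst (grid K) - fst (grid L)\<bar> \<le> 3" "\<bar>snd (grid K) - snd (grid L)\<bar> \<le> 3"
    unfolding grid_def fst_conv snd_conv by (intro fl; simp)+
qed

lemma grid_fiber: "card {K\<in>T. grid K = z} \<le> packing"
proof -
  have "{K\<in>T. grid K = z} \<subseteq> nodes (ball (point z) (4 * h))" using self_node by auto
  moreover have "finite (nodes (ball (point z) (4 * h)))" using finite_T by (simp add: nodes_def)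
  ultimately have "card {K\<in>T. grid K = z} \<le> card (nodes (ball (point z) (4 * h)))"
    by (rule card_mono[rotated])
  then show ?thesis using card_nodes_le[of "point z"] by (rule order_trans)
qed

lemma finite_sample: "finite {z. sample f z \<noteq> 0}"
proof -
  have "bounded (\<Union>T)" by (simp add: cover bounded_\<Omega> bounded_closure)
  then obtain R where R: "\<And>x. x \<in> \<Union>T \<Longrightarrow> norm x \<le> R" unfolding bounded_iff by blast
  define n where "n = \<lceil>R / h\<rceil>"
  have "z \<in> {-n..n} \<times> {-n..n}" if "sample f z \<noteq> 0" for z
  proof -
    have "point z \<in> \<Union>T"
    proof (rule ccontr)
      assume "point z \<notin> \<Union>T"
      then have "sample f z = 0" using outside_notin by (simp add: sample_def cell_at_def node_value_def)
      with that show False by simp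
    qed
    then have "\<bar>point z $ i\<bar> \<le> R" for i using R component_le_norm_cart[of "point z" i] order_trans by blast
    from this[of 1] this[of 2] have "h * \<bar>of_int (fst z)\<bar> \<le> R" "h * \<bar>of_int (snd z)\<bar> \<le> R"
      using h_pos by (simp_all add: point_def abs_mult)
    then have "\<bar>real_of_int (fst z)\<bar> \<le> R / h" "\<bar>real_of_int (snd z)\<bar> \<le> R / h"
      using h_pos by (simp_all add: field_simps)
    then have "\<bar>fst z\<bar> \<le> n" "\<bar>snd z\<bar> \<le> n" unfolding n_def by linarith+
    then show ?thesis by (cases z) auto
  qed
  then have "{z. sample f z \<noteq> 0} \<subseteq> {-n..n} \<times> {-n..n}" by blast
  then show ?thesis by (rule finite_subset) simp
qed

lemma point_step: "point (i + 1, j) \<in> ball (point (i, j)) (4 * h)" "point (i, j + 1) \<in> ball (point (i, j)) (4 * h)"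
proof -
  have "dist (point (i, j)) (point (i + 1, j)) \<le> h" "dist (point (i, j)) (point (i, j + 1)) \<le> h"
    unfolding dist_norm by (rule order_trans[OF norm_2_le]; simp add: point_def algebra_simps h_pos less_imp_le)+
  then show "point (i + 1, j) \<in> ball (point (i, j)) (4 * h)" "point (i, j + 1) \<in> ball (point (i, j)) (4 * h)"
    using h_pos by auto
qed

lemma point_center: "point z \<in> ball (point z) (4 * h)"
  using h_pos by simp

lemma gsq_sample: "gsq (sample f) z \<le> local_energy f z"
proof -
  obtain i j where z: "z = (i, j)" by (cases z)
  note o = sample_oscillation[of _ z "cell_at z" f, OF _ cell_at_node[OF point_center]]
  have "2 * (sample f (i + 1, j) - sample f z)\<^sup>2 \<le> local_energy f z" "2 * (sample f (i, j + 1) - sample f z)\<^sup>2 \<le> local_energy f z"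
    unfolding sample_def by (intro o cell_at_node; simp only: z point_step)+
  then show ?thesis by (simp add: gsq_def z)
qed

text \<open>An edge has length at most \<open>h\<close>, so the grid points whose balls it meets lie
  within \<open>5 * h\<close> of one of its ends, in a block of 12 by 12; 288 = 2 * 144.\<close>

lemma sum_local_energy:
  assumes "finite F"
  shows "(\<Sum>z\<in>F. local_energy f z) \<le> 288 * (real packing)\<^sup>2 * energy f"
proof -
  define near where "near \<sigma> z \<longleftrightarrow> \<sigma> \<inter> ball (point z) (4 * h) \<noteq> {}" for \<sigma> z
  have card: "card {z\<in>F. near \<sigma> z} \<le> 144" if \<sigma>: "\<sigma> \<in> mesh_edges T" for \<sigma>
  proof -
    obtain K a b c where t: "K \<in> T" "is_triangle a b c K" "\<sigma> = closed_segment a b" "\<sigma> \<in> edges K" "a \<noteq> b"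
      using mesh_edge_obtain[OF \<sigma>] .
    have aK: "a \<in> K" using edge_subset[OF t(4)] t(3) by auto
    define i j where "i = \<lfloor>a $ 1 / h\<rfloor>" and "j = \<lfloor>a $ 2 / h\<rfloor>"
    have "{z\<in>F. near \<sigma> z} \<subseteq> {i-5..i+6} \<times> {j-5..j+6}"
    proof
      fix z assume "z \<in> {z\<in>F. near \<sigma> z}"
      then obtain x where x: "x \<in> \<sigma>" "dist (point z) x < 4 * h" by (auto simp: near_def)
      have "dist x a \<le> h" using dist_in_cell[OF t(1) _ aK] x(1) edge_subset[OF t(4)] by auto
      then have d: "norm (point z - a) < 5 * h"
        using x(2) dist_triangle[of "point z" a x] unfolding dist_norm by linarith
      have "\<bar>(point z - a) $ k\<bar> < 5 * h" for k
        using d component_le_norm_cart[of "point z - a" k] by linarith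
      from this[of 1] this[of 2] have "\<bar>h * of_int (fst z) - a $ 1\<bar> < 5 * h" "\<bar>h * of_int (snd z) - a $ 2\<bar> < 5 * h"
        by (simp_all add: point_def)
      moreover have "\<bar>r - s / h\<bar> < 5" if "\<bar>h * r - s\<bar> < 5 * h" for r s
      proof -
        have "h * \<bar>r - s / h\<bar> = \<bar>h * r - s\<bar>"
        proof -
          have "h * r - s = h * (r - s / h)" using h_pos by (simp add: right_diff_distrib)
          then show ?thesis using h_pos by (simp add: abs_mult)
        qed
        then have "h * \<bar>r - s / h\<bar> < h * 5" using that by linarith
        then show ?thesis using h_pos by (simp only: mult_less_cancel_left_pos)
      qed
      ultimately have "\<bar>of_int (fst z) - a $ 1 / h\<bar> < 5" "\<bar>of_int (snd z) - a $ 2 / h\<bar> < 5" by auto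
      then have "fst z \<in> {i-5..i+6}" "snd z \<in> {j-5..j+6}"
        unfolding i_def j_def atLeastAtMost_iff by linarith+
      then show "z \<in> {i-5..i+6} \<times> {j-5..j+6}" by (cases z) auto
    qed
    then have "card {z\<in>F. near \<sigma> z} \<le> card ({i-5..i+6} \<times> {j-5..j+6})" by (rule card_mono[rotated]) simp
    also have "\<dots> = 144" by (simp add: card_cartesian_product)
    finally show ?thesis .
  qed
  have "(\<Sum>z\<in>F. \<Sum>\<sigma>\<in>{\<sigma>\<in>mesh_edges T. near \<sigma> z}. (jump f \<sigma>)\<^sup>2) = (\<Sum>z\<in>F. \<Sum>\<sigma>\<in>mesh_edges T. if near \<sigma> z then (jump f \<sigma>)\<^sup>2 else 0)"
    using finite_mesh_edges by (simp add: sum.inter_filter)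
  also have "\<dots> = (\<Sum>\<sigma>\<in>mesh_edges T. \<Sum>z\<in>F. if near \<sigma> z then (jump f \<sigma>)\<^sup>2 else 0)"
    by (rule sum.swap)
  also have "\<dots> = (\<Sum>\<sigma>\<in>mesh_edges T. real (card {z\<in>F. near \<sigma> z}) * (jump f \<sigma>)\<^sup>2)"
    using assms by (intro sum.cong refl) (simp flip: sum.inter_filter)
  also have "\<dots> \<le> (\<Sum>\<sigma>\<in>mesh_edges T. 144 * (jump f \<sigma>)\<^sup>2)"
    using card by (intro sum_mono mult_right_mono) (auto simp: numeral_le_real_of_nat_iff)
  finally have "(\<Sum>z\<in>F. \<Sum>\<sigma>\<in>{\<sigma>\<in>mesh_edges T. near \<sigma> z}. (jump f \<sigma>)\<^sup>2) \<le> 144 * energy f"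
    by (simp add: energy_def sum_distrib_left)
  then have "2 * (real packing)\<^sup>2 * (\<Sum>z\<in>F. \<Sum>\<sigma>\<in>{\<sigma>\<in>mesh_edges T. near \<sigma> z}. (jump f \<sigma>)\<^sup>2) \<le> 2 * (real packing)\<^sup>2 * (144 * energy f)"
    by (intro mult_left_mono) auto
  then show ?thesis unfolding local_energy_def near_def sum_distrib_left[symmetric] by simp
qed

end

section \<open>Fluxes and norms\<close>

lemma affine_map_unique:
  assumes "affine_map g" "open U" "U \<noteq> {}" "\<And>x. x \<in> U \<Longrightarrow> g x = c"
  shows "g = (\<lambda>_. c)"
proof -
  obtain A b where A: "linear A" "g = (\<lambda>x. A x + b)" using assms(1) by (auto simp: affine_map_def)
  obtain x\<^sub>0 where x0: "x\<^sub>0 \<in> U" using assms(3) by auto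
  then obtain e where e: "e > 0" "ball x\<^sub>0 e \<subseteq> U" using assms(2) open_contains_ball by metis
  have A0: "A y = 0" for y
  proof (cases "y = 0")
    case False
    define t where "t = e / (2 * norm y)"
    have t: "t > 0" "norm (t *\<^sub>R y) < e" using False e by (simp_all add: t_def)
    then have "x\<^sub>0 + t *\<^sub>R y \<in> U" using e(2) by (intro subsetD[OF e(2)]) (simp add: dist_norm)
    then have "A (x\<^sub>0 + t *\<^sub>R y) + b = A x\<^sub>0 + b" using assms(4) x0 A(2) by metis
    then have "t *\<^sub>R A y = 0" by (simp add: linear_add[OF A(1)] linear_cmul[OF A(1)])
    then show ?thesis using t by simp
  qed (simp add: linear_0[OF A(1)])
  moreover have "b = c" using assms(4)[OF x0] A0 by (simp add: A(2))
  ultimately show ?thesis by (simp add: A(2))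
qed

lemma cell_value_eq:
  assumes "v \<in> P0 T" "K \<in> T" "interior K \<noteq> {}" "x \<in> interior K"
  shows "v x = cell_value v K"
proof -
  obtain c where c: "\<And>x. x \<in> interior K \<Longrightarrow> v x = c"
    using assms(1,2) unfolding P0_def constant_on_def by blast
  have "cell_value v K = c" unfolding cell_value_def
    by (rule the_equality) (use c assms(4) in auto)
  then show ?thesis using c assms(4) by simp
qed

lemma affine_piece_eq:
  assumes "v \<in> P0 T" "K \<in> T" "interior K \<noteq> {}"
  shows "affine_piece v K = (\<lambda>_. cell_value v K)"
  unfolding affine_piece_def
proof (rule the_equality)
  have "affine_map (\<lambda>_. cell_value v K)"
    unfolding affine_map_def by (intro exI[of _ "\<lambda>_. 0"] exI[of _ "cell_value v K"]) (simp add: linear_zero)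
  then show "affine_map (\<lambda>_. cell_value v K) \<and> (\<forall>x\<in>interior K. cell_value v K = v x)"
    using cell_value_eq[OF assms] by simp
  show "g = (\<lambda>_. cell_value v K)" if "affine_map g \<and> (\<forall>x\<in>interior K. g x = v x)" for g
    using affine_map_unique[of g "interior K"] that cell_value_eq[OF assms] assms(3) by simp
qed

lemma cauchy_schwarz_2:
  fixes a b c d :: real
  shows "a * c + b * d \<le> sqrt (a\<^sup>2 + b\<^sup>2) * sqrt (c\<^sup>2 + d\<^sup>2)"
proof -
  have "(a * c + b * d)\<^sup>2 + (a * d - b * c)\<^sup>2 = (a\<^sup>2 + b\<^sup>2) * (c\<^sup>2 + d\<^sup>2)"
    by (simp add: power2_eq_square algebra_simps)
  then have "(a * c + b * d)\<^sup>2 \<le> (a\<^sup>2 + b\<^sup>2) * (c\<^sup>2 + d\<^sup>2)"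
    using zero_le_power2[of "a * d - b * c"] by linarith
  then show ?thesis unfolding real_sqrt_mult[symmetric] by (rule real_le_rsqrt)
qed

lemma norm_sq_2: "(norm (x :: real^2))\<^sup>2 = (x $ 1)\<^sup>2 + (x $ 2)\<^sup>2"
  unfolding power2_norm_eq_inner inner_vec_def sum_2 by (simp add: power2_eq_square)

context regular_mesh
begin

section \<open>Fluxes of piecewise constant Raviart-Thomas fields\<close>

lemma interior_nonempty: "K \<in> T \<Longrightarrow> interior K \<noteq> {}"
  using interior_triangle(1)[OF simplex] .

lemma normal_flux_eq:
  assumes "u \<in> P0 T" "K \<in> T" "\<sigma> \<in> edges K"
  shows "normal_flux u K \<sigma> = cell_value u K \<bullet> outer_normal K \<sigma>"
proof -
  obtain a b c where "\<sigma> = closed_segment a b" using edge_ends[OF simplex[OF assms(2)] assms(3)] by metis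
  then have "\<sigma> \<noteq> {}" by auto
  then show ?thesis
    unfolding normal_flux_def affine_piece_eq[OF assms(1,2) interior_nonempty[OF assms(2)]]
    by (intro the_equality) auto
qed

lemma edge_length_le: "K \<in> T \<Longrightarrow> \<sigma> \<in> edges K \<Longrightarrow> 0 < edge_length \<sigma>" "K \<in> T \<Longrightarrow> \<sigma> \<in> edges K \<Longrightarrow> edge_length \<sigma> \<le> h"
  using edge_length_bounds[of \<sigma>] by (auto simp: mesh_edges_def)

lemma abs_normal_flux_le:
  assumes "u \<in> P0 T" "K \<in> T" "\<sigma> \<in> edges K"
  shows "\<bar>edge_length \<sigma> * normal_flux u K \<sigma>\<bar> \<le> h * norm (cell_value u K)"
proof -
  obtain a b c where t: "is_triangle a b c K" "\<sigma> = closed_segment a b"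
    using edge_ends[OF simplex[OF assms(2)] assms(3)] .
  have "\<bar>normal_flux u K \<sigma>\<bar> \<le> norm (cell_value u K) * norm (outer_normal K \<sigma>)"
    unfolding normal_flux_eq[OF assms] by (rule Cauchy_Schwarz_ineq2)
  then have "\<bar>normal_flux u K \<sigma>\<bar> \<le> norm (cell_value u K)"
    using outer_normal_triangle(2)[OF t(1)] t(2) by simp
  then show ?thesis
    using edge_length_le[OF assms(2,3)] by (simp add: abs_mult mult_mono)
qed

lemma outer_normal_opposite:
  assumes "K \<in> T" "L \<in> T" "K \<noteq> L" "\<sigma> \<in> edges K" "\<sigma> \<in> edges L"
  shows "outer_normal L \<sigma> = - outer_normal K \<sigma>"
proof -
  obtain a b c where t: "is_triangle a b c K" "\<sigma> = closed_segment a b"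
    using edge_ends[OF simplex[OF assms(1)] assms(4)] .
  obtain d where d: "is_triangle a b d L" using apex[of L a b] assms t(2) by metis
  have neg: "cross2 (b - a) (c - a) * cross2 (b - a) (d - a) < 0"
    by (rule opposite_sides[OF assms(1-3) t(1) d])
  then have "sgn (cross2 (b - a) (d - a)) = - sgn (cross2 (b - a) (c - a))"
    by (auto simp: mult_less_0_iff)
  then have "dist a b *\<^sub>R outer_normal L \<sigma> = dist a b *\<^sub>R (- outer_normal K \<sigma>)"
    using outer_normal_triangle(1)[OF t(1)] outer_normal_triangle(1)[OF d] t(2) by simp
  moreover have "dist a b \<noteq> 0" using t(1) by (simp add: is_triangle_def)
  ultimately show ?thesis by (simp only: scaleR_cancel_left) simp
qed

text \<open>\<open>RT0\<close> tests both traces against the normal of the cell chosen by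
  \<open>edge_tri\<close>, hence the two cases.\<close>

lemma flux_antisym:
  assumes "u \<in> P0 T" "u \<in> RT0 \<Omega> T" "K \<in> T" "L \<in> T" "K \<noteq> L" "\<sigma> \<in> edges K" "\<sigma> \<in> edges L"
  shows "normal_flux u L \<sigma> = - normal_flux u K \<sigma>"
proof -
  have m: "\<sigma> \<in> mesh_edges T" using assms by (auto simp: mesh_edges_def)
  have "shared \<sigma>" using assms unfolding shared_def by blast
  then have "\<sigma> \<in> int_edges \<Omega> T" using m by (simp add: int_edge_iff)
  then have rt: "\<forall>x\<in>\<sigma>. affine_piece u (edge_tri T \<sigma>) x \<bullet> outer_normal (edge_tri T \<sigma>) \<sigma> =
      affine_piece u (edge_tri2 T \<sigma>) x \<bullet> outer_normal (edge_tri T \<sigma>) \<sigma>"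
    using assms(2) unfolding RT0_def by blast
  obtain a b c where "\<sigma> = closed_segment a b" using edge_ends[OF simplex[OF assms(3)] assms(6)] by metis
  then have "a \<in> \<sigma>" by simp
  note rt' = rt[rule_format, OF this]
  note ap = affine_piece_eq[OF assms(1) assms(3) interior_nonempty[OF assms(3)]]
    affine_piece_eq[OF assms(1) assms(4) interior_nonempty[OF assms(4)]]
  note fl = normal_flux_eq[OF assms(1,3,6)] normal_flux_eq[OF assms(1,4,7)]
  from edge_tris_shared[OF assms(3-7)] show ?thesis
  proof
    assume "edge_tri T \<sigma> = K \<and> edge_tri2 T \<sigma> = L"
    then have "cell_value u K \<bullet> outer_normal K \<sigma> = cell_value u L \<bullet> outer_normal K \<sigma>"
      using rt' ap by simp
    then show ?thesis using fl outer_normal_opposite[OF assms(3-7)] by simp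
  next
    assume "edge_tri T \<sigma> = L \<and> edge_tri2 T \<sigma> = K"
    then have "cell_value u L \<bullet> outer_normal L \<sigma> = cell_value u K \<bullet> outer_normal L \<sigma>"
      using rt' ap by simp
    then show ?thesis using fl outer_normal_opposite[OF assms(3-7)] by simp
  qed
qed

lemma flux_boundary:
  assumes "u \<in> P0 T" "u \<in> RT0 \<Omega> T" "K \<in> T" "\<sigma> \<in> edges K" "\<not> shared \<sigma>"
  shows "normal_flux u K \<sigma> = 0"
proof -
  have "\<sigma> \<in> mesh_edges T" using assms by (auto simp: mesh_edges_def)
  then have "\<sigma> \<in> ext_edges \<Omega> T" using assms(5) by (simp add: ext_edge_iff)
  then have rt: "\<forall>x\<in>\<sigma>. affine_piece u (edge_tri T \<sigma>) x \<bullet> outer_normal (edge_tri T \<sigma>) \<sigma> = 0"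
    using assms(2) unfolding RT0_def by blast
  obtain a b c where "\<sigma> = closed_segment a b" using edge_ends[OF simplex[OF assms(3)] assms(4)] by metis
  then have a: "a \<in> \<sigma>" by simp
  show ?thesis
    using rt[rule_format, OF a] edge_tri_unshared[OF assms(3-5)]
      affine_piece_eq[OF assms(1) assms(3) interior_nonempty[OF assms(3)]] normal_flux_eq[OF assms(1,3,4)] by simp
qed

text \<open>The outer normals weighted by the lengths are the edge vectors after a quarter turn, and
  these sum to zero around the triangle. So a constant vector has no net flux.\<close>

lemma flux_balance:
  assumes "u \<in> P0 T" "K \<in> T"
  shows "(\<Sum>\<sigma>\<in>edges K. edge_length \<sigma> * normal_flux u K \<sigma>) = 0"
proof -
  obtain a b c where t: "is_triangle a b c K" using triangle_exists[OF simplex[OF assms(2)]] .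
  note t' = is_triangle_rotate[OF t] and t'' = is_triangle_rotate[OF is_triangle_rotate[OF t]]
  define s where "s = sgn (cross2 (b - a) (c - a))"
  have s: "sgn (cross2 (c - b) (a - b)) = s" "sgn (cross2 (a - c) (b - c)) = s"
    by (simp_all add: s_def cross2_def algebra_simps)
  have d: "a \<noteq> b" "b \<noteq> c" "c \<noteq> a" using t by (auto simp: is_triangle_def)
  have E: "edges K = {closed_segment a b, closed_segment b c, closed_segment c a}" by (rule edges_triangle[OF t])
  have "(\<Sum>\<sigma>\<in>edges K. edge_length \<sigma> * normal_flux u K \<sigma>) = cell_value u K \<bullet> (\<Sum>\<sigma>\<in>edges K. edge_length \<sigma> *\<^sub>R outer_normal K \<sigma>)"
    unfolding inner_sum_right by (intro sum.cong refl) (simp add: normal_flux_eq[OF assms])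
  also have "(\<Sum>\<sigma>\<in>edges K. edge_length \<sigma> *\<^sub>R outer_normal K \<sigma>) = s *\<^sub>R rot (b - a) + (s *\<^sub>R rot (c - b) + s *\<^sub>R rot (a - c))"
    unfolding E using d outer_normal_triangle(1)[OF t] outer_normal_triangle(1)[OF t'] outer_normal_triangle(1)[OF t''] s
    by (simp add: doubleton_eq_iff flip: s_def)
  also have "\<dots> = s *\<^sub>R rot ((b - a) + ((c - b) + (a - c)))"
    by (simp only: rot_add scaleR_add_right)
  also have "\<dots> = 0" by (simp add: rot_def vec_eq_iff forall_2)
  finally show ?thesis by simp
qed

text \<open>Interior edges of \<open>K\<close> correspond to its neighbours by
  \<open>L \<mapsto> K \<inter> L\<close>, with inverse \<open>opposite_tri T K\<close>.\<close>

lemma sum_nbrs: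
  assumes "K \<in> T"
  shows "(\<Sum>\<sigma>\<in>edges K \<inter> int_edges \<Omega> T. g \<sigma> (opposite_tri T K \<sigma>)) = (\<Sum>L\<in>nbrs K. g (K \<inter> L) L)"
proof (rule sum.reindex_bij_witness[of _ "\<lambda>L. K \<inter> L" "opposite_tri T K"])
  have opp: "opposite_tri T K \<sigma> \<in> nbrs K \<and> K \<inter> opposite_tri T K \<sigma> = \<sigma>" if \<sigma>: "\<sigma> \<in> edges K \<inter> int_edges \<Omega> T" for \<sigma>
  proof -
    have "shared \<sigma>" using \<sigma> by (simp add: int_edge_iff)
    then obtain L where L: "L \<in> T" "L \<noteq> K" "\<sigma> \<in> edges L" unfolding shared_def by metis
    have "opposite_tri T K \<sigma> = L" using opposite_tri_eq[OF assms L(1)] L \<sigma> by auto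
    then show ?thesis using L \<sigma> shared_edge[OF assms L(1)] by (auto simp: nbrs_def)
  qed
  show "K \<inter> opposite_tri T K \<sigma> = \<sigma>" "opposite_tri T K \<sigma> \<in> nbrs K" if "\<sigma> \<in> edges K \<inter> int_edges \<Omega> T" for \<sigma>
    using opp[OF that] by auto
  show "g (K \<inter> opposite_tri T K \<sigma>) (opposite_tri T K \<sigma>) = g \<sigma> (opposite_tri T K \<sigma>)"
    if "\<sigma> \<in> edges K \<inter> int_edges \<Omega> T" for \<sigma>
    using opp[OF that] by simp
  have nb: "K \<inter> L \<in> edges K \<inter> int_edges \<Omega> T \<and> opposite_tri T K (K \<inter> L) = L" if L: "L \<in> nbrs K" for L
  proof -
    obtain \<sigma> where \<sigma>: "L \<in> T" "L \<noteq> K" "\<sigma> \<in> edges K" "\<sigma> \<in> edges L" using L by (auto simp: nbrs_def)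
    have eq: "K \<inter> L = \<sigma>" using shared_edge[OF assms \<sigma>(1) _ \<sigma>(3,4)] \<sigma>(2) by simp
    have "shared \<sigma>" using \<sigma> assms unfolding shared_def by metis
    then have "\<sigma> \<in> int_edges \<Omega> T" using assms \<sigma>(3) by (auto simp: int_edge_iff mesh_edges_def)
    moreover have "opposite_tri T K \<sigma> = L" using opposite_tri_eq[OF assms \<sigma>(1) _ \<sigma>(3,4)] \<sigma>(2) by simp
    ultimately show ?thesis using eq \<sigma>(3) by simp
  qed
  show "opposite_tri T K (K \<inter> L) = L" "K \<inter> L \<in> edges K \<inter> int_edges \<Omega> T" if "L \<in> nbrs K" for L
    using nb[OF that] by auto
qed

lemma card_edges_le:
  assumes "K \<in> T"
  shows "finite (edges K)" "card (edges K) \<le> 3"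
proof -
  obtain a b c where t: "is_triangle a b c K" using triangle_exists[OF simplex[OF assms]] .
  show "finite (edges K)" "card (edges K) \<le> 3"
    unfolding edges_triangle[OF t] by (simp_all add: card_insert_if)
qed

definition flow :: "(real^2 \<Rightarrow> real^2) \<Rightarrow> (real^2) set \<Rightarrow> (real^2) set \<Rightarrow> real" where
  "flow u K L = edge_length (K \<inter> L) * normal_flux u K (K \<inter> L)"

lemma nbrs_edge:
  assumes "K \<in> T" "L \<in> nbrs K"
  shows "L \<in> T" "L \<noteq> K" "K \<inter> L \<in> edges K" "K \<inter> L \<in> edges L"
proof -
  obtain \<sigma> where \<sigma>: "L \<in> T" "L \<noteq> K" "\<sigma> \<in> edges K" "\<sigma> \<in> edges L" using assms(2) by (auto simp: nbrs_def)
  moreover have "K \<inter> L = \<sigma>" using shared_edge[OF assms(1) \<sigma>(1) _ \<sigma>(3,4)] \<sigma>(2) by simp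
  ultimately show "L \<in> T" "L \<noteq> K" "K \<inter> L \<in> edges K" "K \<inter> L \<in> edges L" by auto
qed

lemma upwind_flow_mesh:
  assumes "u \<in> P0 T" "u \<in> RT0 \<Omega> T"
  shows "upwind_flow T nbrs (flow u) (\<lambda>K. h * norm (cell_value u K)) grid packing"
proof
  fix K L assume KL: "K \<in> T" "L \<in> nbrs K"
  note e = nbrs_edge[OF KL]
  show "K \<in> nbrs L" using e KL(1) by (auto simp: nbrs_def)
  show "flow u L K = - flow u K L"
    using flux_antisym[OF assms KL(1) e(1) e(2)[symmetric] e(3,4)] by (simp add: flow_def Int_commute)
  show "\<bar>flow u K L\<bar> \<le> h * norm (cell_value u K)"
    unfolding flow_def by (rule abs_normal_flux_le[OF assms(1) KL(1) e(3)])
  show "\<bar>fst (grid K) - fst (grid L)\<bar> \<le> 3" "\<bar>snd (grid K) - snd (grid L)\<bar> \<le> 3"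
    using grid_near[OF KL] by auto
next
  fix K assume K: "K \<in> T"
  show "nbrs K \<subseteq> T" by (auto simp: nbrs_def)
  show "0 \<le> h * norm (cell_value u K)" using h_pos by simp
  have "inj_on (\<lambda>L. K \<inter> L) (nbrs K)"
  proof (rule inj_onI)
    fix L M assume L: "L \<in> nbrs K" and M: "M \<in> nbrs K" and eq: "K \<inter> L = K \<inter> M"
    show "L = M"
      using third_triangle[OF K nbrs_edge(1)[OF K L] nbrs_edge(1)[OF K M] nbrs_edge(3)[OF K L] nbrs_edge(4)[OF K L]]
        nbrs_edge(2,4)[OF K M] nbrs_edge(2)[OF K L] eq by auto
  qed
  moreover have "(\<lambda>L. K \<inter> L) ` nbrs K \<subseteq> edges K" using nbrs_edge(3)[OF K] by auto
  ultimately show "card (nbrs K) \<le> 3"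
    using card_edges_le[OF K] card_inj_on_le[of "\<lambda>L. K \<inter> L" "nbrs K" "edges K"] by linarith
  have "(\<Sum>L\<in>nbrs K. flow u K L) = (\<Sum>\<sigma>\<in>edges K \<inter> int_edges \<Omega> T. edge_length \<sigma> * normal_flux u K \<sigma>)"
    using sum_nbrs[OF K, of "\<lambda>\<sigma> _. edge_length \<sigma> * normal_flux u K \<sigma>"] by (simp add: flow_def)
  \<comment> \<open>Boundary edges carry no flux, so the balance over all edges is one over the
    neighbours.\<close>
  also have "\<dots> = (\<Sum>\<sigma>\<in>edges K. edge_length \<sigma> * normal_flux u K \<sigma>)"
  proof (rule sum.mono_neutral_left)
    show "\<forall>\<sigma>\<in>edges K - edges K \<inter> int_edges \<Omega> T. edge_length \<sigma> * normal_flux u K \<sigma> = 0"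
    proof
      fix \<sigma> assume \<sigma>: "\<sigma> \<in> edges K - edges K \<inter> int_edges \<Omega> T"
      then have "\<not> shared \<sigma>" using K by (auto simp: int_edge_iff mesh_edges_def)
      then show "edge_length \<sigma> * normal_flux u K \<sigma> = 0" using flux_boundary[OF assms K] \<sigma> by simp
    qed
  qed (use card_edges_le[OF K] in auto)
  finally show "(\<Sum>L\<in>nbrs K. flow u K L) = 0" using flux_balance[OF assms(1) K] by simp
qed (use finite_T grid_fiber in auto)

lemma approx_sample:
  "upwind_flow.approx T nbrs grid f (sample f) (local_energy f)" if "u \<in> P0 T" "u \<in> RT0 \<Omega> T"
proof -
  interpret upwind_flow T nbrs "flow u" "\<lambda>K. h * norm (cell_value u K)" grid packing
    by (rule upwind_flow_mesh[OF that])
  have e0: "0 \<le> local_energy f z" for z by (simp add: local_energy_def sum_nonneg)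
  have half: "x \<le> local_energy f z" if "2 * x \<le> local_energy f z" for x z
    using that e0[of z] by linarith
  have cell: "node_value f K = f K" if "K \<in> T" for K using that by (simp add: node_value_def)
  show ?thesis
    unfolding approx_def
  proof (intro conjI ballI allI)
    fix K assume K: "K \<in> T"
    show "(f K - sample f (grid K))\<^sup>2 \<le> local_energy f (grid K)"
      by (rule half) (use sample_oscillation[OF self_node[OF K] cell_at_node[OF point_center], of f] in
        \<open>simp add: sample_def cell[OF K]\<close>)
    fix L assume L: "L \<in> nbrs K"
    show "(f L - f K)\<^sup>2 \<le> local_energy f (grid K)"
      by (rule half) (use sample_oscillation[OF nbr_node[OF K L] self_node[OF K], of f] nbrs_edge(1)[OF K L] in
        \<open>simp add: cell K\<close>)
  qed (rule gsq_sample)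
qed

text \<open>Every point of a cell is within its circumradius of the circumcenter, and passing
  through an end of the edge gives \<open>edge_dist \<Omega> T \<sigma> \<le> h\<close>, while the
  edge is at least \<open>c\<^sub>0 * h\<close> long.\<close>

lemma transmissivity_ge:
  assumes "\<sigma> \<in> mesh_edges T"
  shows "c\<^sub>0 \<le> transmissivity \<Omega> T \<sigma>"
proof -
  have R: "2 * circumradius K \<le> h" "0 \<le> circumradius K" if K: "K \<in> T" for K
  proof -
    show "2 * circumradius K \<le> h" using circumdiameter_le[OF K] by (simp add: circumdiameter_def)
    obtain a b c where "is_triangle a b c K" using triangle_exists[OF simplex[OF K]] .
    from circumcenter_exists(1)[OF this] show "0 \<le> circumradius K" by (metis zero_le_dist)
  qed
  have cc: "dist (circumcenter K) x \<le> circumradius K" if K: "K \<in> T" and x: "x \<in> K" for K x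
  proof -
    obtain a b c where "is_triangle a b c K" using triangle_exists[OF simplex[OF K]] .
    from triangle_subset_circumdisc[OF this] show ?thesis using x by auto
  qed
  note k = edge_tri_mem[OF assms]
  obtain a b c where t: "is_triangle a b c (edge_tri T \<sigma>)" "\<sigma> = closed_segment a b"
    using edge_ends[OF simplex[OF k(1)] k(2)] .
  have in1: "a \<in> edge_tri T \<sigma>" "midpoint a b \<in> edge_tri T \<sigma>"
    using edge_subset[OF k(2)] midpoint_edge(1)[OF t(1)] t(2) by auto
  have "edge_dist \<Omega> T \<sigma> \<le> h"
  proof (cases "\<sigma> \<in> int_edges \<Omega> T")
    case True
    then have "shared \<sigma>" by (simp add: int_edge_iff)
    then obtain K L where KL: "K \<in> T" "L \<in> T" "K \<noteq> L" "\<sigma> \<in> edges K" "\<sigma> \<in> edges L"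
      unfolding shared_def by metis
    have k2: "edge_tri2 T \<sigma> \<in> T" "\<sigma> \<in> edges (edge_tri2 T \<sigma>)"
      using edge_tris_shared[OF KL] KL by auto
    then have "a \<in> edge_tri2 T \<sigma>" using edge_subset[OF k2(2)] t(2) by auto
    then have "dist (circumcenter (edge_tri T \<sigma>)) a \<le> circumradius (edge_tri T \<sigma>)"
      "dist (circumcenter (edge_tri2 T \<sigma>)) a \<le> circumradius (edge_tri2 T \<sigma>)"
      using cc in1(1) k(1) k2(1) by auto
    then show ?thesis
      using True R(1)[OF k(1)] R(1)[OF k2(1)] dist_triangle2[of "circumcenter (edge_tri T \<sigma>)" "circumcenter (edge_tri2 T \<sigma>)" a]
      by (simp add: edge_dist_def)
  next
    case False
    then show ?thesis
      using cc[OF k(1) in1(2)] R[OF k(1)] t(2) by (simp add: edge_dist_def)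
  qed
  then have "c\<^sub>0 * edge_dist \<Omega> T \<sigma> \<le> c\<^sub>0 * h" using c0_pos by simp
  also have "\<dots> \<le> edge_length \<sigma>" by (rule length_ge[OF assms])
  finally have le: "c\<^sub>0 * edge_dist \<Omega> T \<sigma> \<le> edge_length \<sigma>" .
  \<comment> \<open>A zero distance would make the quotient 0 by the convention for
    division.\<close>
  have "0 < c\<^sub>0 * edge_length \<sigma>" using edge_length_bounds(1)[OF assms] c0_pos by simp
  then have "0 < edge_dist \<Omega> T \<sigma>" using dist_ge[OF assms] by linarith
  then show ?thesis using le by (simp add: transmissivity_def pos_le_divide_eq)
qed

section \<open>Energies and the norms of the mesh\<close>

lemma energy_le_h_norm:
  "c\<^sub>0 * (energy (\<lambda>K. cell_value v K $ 1) + energy (\<lambda>K. cell_value v K $ 2)) \<le> (h_norm \<Omega> T v)\<^sup>2"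
proof -
  define J where "J \<sigma> = (jump (\<lambda>K. cell_value v K $ 1) \<sigma>)\<^sup>2 + (jump (\<lambda>K. cell_value v K $ 2) \<sigma>)\<^sup>2" for \<sigma>
  define I X where "I = int_edges \<Omega> T" and "X = ext_edges \<Omega> T"
  have split: "I \<union> X = mesh_edges T" "I \<inter> X = {}"
    unfolding I_def X_def using int_edge_iff ext_edge_iff by auto
  then have fin: "finite I" "finite X" using finite_mesh_edges by (metis finite_Un)+
  have JI: "J \<sigma> = (norm (cell_value v (edge_tri2 T \<sigma>) - cell_value v (edge_tri T \<sigma>)))\<^sup>2" if "\<sigma> \<in> I" for \<sigma>
    using that by (simp add: I_def int_edge_iff J_def jump_def norm_sq_2)
  have JX: "J \<sigma> = (norm (cell_value v (edge_tri T \<sigma>)))\<^sup>2" if "\<sigma> \<in> X" for \<sigma>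
    using that by (simp add: X_def ext_edge_iff J_def jump_def norm_sq_2)
  have J0: "0 \<le> J \<sigma>" for \<sigma> by (simp add: J_def)
  have tr0: "0 \<le> transmissivity \<Omega> T \<sigma>" if "\<sigma> \<in> mesh_edges T" for \<sigma>
    using transmissivity_ge[OF that] c0_pos by linarith
  have "c\<^sub>0 * (energy (\<lambda>K. cell_value v K $ 1) + energy (\<lambda>K. cell_value v K $ 2)) = (\<Sum>\<sigma>\<in>mesh_edges T. c\<^sub>0 * J \<sigma>)"
    by (simp add: energy_def J_def sum_distrib_left sum.distrib distrib_left)
  also have "\<dots> \<le> (\<Sum>\<sigma>\<in>mesh_edges T. transmissivity \<Omega> T \<sigma> * J \<sigma>)"
    using transmissivity_ge J0 by (intro sum_mono mult_right_mono) auto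
  also have "\<dots> = (\<Sum>\<sigma>\<in>I. transmissivity \<Omega> T \<sigma> * J \<sigma>) + (\<Sum>\<sigma>\<in>X. transmissivity \<Omega> T \<sigma> * J \<sigma>)"
    unfolding split(1)[symmetric] by (rule sum.union_disjoint[OF fin split(2)])
  also have "\<dots> = (h_norm \<Omega> T v)\<^sup>2"
  proof -
    have "0 \<le> (\<Sum>\<sigma>\<in>I. transmissivity \<Omega> T \<sigma> * J \<sigma>) + (\<Sum>\<sigma>\<in>X. transmissivity \<Omega> T \<sigma> * J \<sigma>)"
      using tr0 J0 split(1) by (intro add_nonneg_nonneg sum_nonneg mult_nonneg_nonneg) auto
    moreover have "(\<Sum>\<sigma>\<in>I. transmissivity \<Omega> T \<sigma> * J \<sigma>) =
        (\<Sum>\<sigma>\<in>I. transmissivity \<Omega> T \<sigma> * (norm (cell_value v (edge_tri2 T \<sigma>) - cell_value v (edge_tri T \<sigma>)))\<^sup>2)"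
      by (intro sum.cong refl) (simp add: JI)
    moreover have "(\<Sum>\<sigma>\<in>X. transmissivity \<Omega> T \<sigma> * J \<sigma>) = (\<Sum>\<sigma>\<in>X. transmissivity \<Omega> T \<sigma> * (norm (cell_value v (edge_tri T \<sigma>)))\<^sup>2)"
      by (intro sum.cong refl) (simp add: JX)
    ultimately show ?thesis unfolding h_norm_def I_def[symmetric] X_def[symmetric] by simp
  qed
  finally show ?thesis .
qed

text \<open>The values of \<open>u\<close> on the edges are arbitrary, so integrability is also
  obtained from the step function \<open>w\<close>, which agrees with the integrand off the
  negligible set of cell boundaries.\<close>

lemma L2_norm_eq:
  assumes "u \<in> P0 T"
  shows "(L2_norm_on \<Omega> u)\<^sup>2 = (\<Sum>K\<in>T. area K * (norm (cell_value u K))\<^sup>2)"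
proof -
  define c where "c K = (norm (cell_value u K))\<^sup>2" for K
  define w where "w x = (\<Sum>K\<in>T. c K * indicat_real (interior K) x)" for x
  define Z where "Z = \<Union>(frontier ` T)"
  have convK: "convex K" "compact K" if "K \<in> T" for K
    using convex_simplex[OF simplex[OF that]] compact_simplex[OF simplex[OF that]] by auto
  have Z: "negligible Z" unfolding Z_def
    using finite_T convK negligible_convex_frontier by (intro negligible_Union) auto
  have sub: "interior K \<subseteq> \<Omega>" if "K \<in> T" for K
    unfolding interior_cover[symmetric] using that by (intro interior_mono) auto
  have mInt: "interior K \<inter> \<Omega> = interior K" "interior K \<in> lmeasurable" "measure lebesgue (interior K) = area K" if "K \<in> T" for K
  proof -
    show "interior K \<inter> \<Omega> = interior K" using sub[OF that] by (rule Int_absorb2)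
    have b: "bounded K" using convK[OF that] compact_imp_bounded by blast
    have nf: "negligible (frontier K)" using convK[OF that] negligible_convex_frontier by blast
    show "measure lebesgue (interior K) = area K" unfolding area_def by (rule measure_interior[OF b nf])
    show "interior K \<in> lmeasurable" by (rule lmeasurable_open[OF bounded_interior[OF b] open_interior])
  qed
  have uw: "(norm (u x))\<^sup>2 = w x" if "x \<in> \<Omega> - Z" for x
  proof -
    have "x \<in> \<Union>T" using that closure_subset[of \<Omega>] cover by auto
    then obtain K where K: "K \<in> T" "x \<in> K" by auto
    have "x \<notin> frontier K" using that K(1) by (auto simp: Z_def)
    then have xK: "x \<in> interior K" using K closed_simplex[OF simplex[OF K(1)]] by (simp add: frontier_def)
    have "x \<notin> interior L" if "L \<in> T" "L \<noteq> K" for L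
      using disjoint_interior[OF that(1) K(1) that(2)] K(2) by auto
    then have "w x = (\<Sum>L\<in>T. if L = K then c K else 0)"
      unfolding w_def using xK by (intro sum.cong refl) (auto simp: indicator_def)
    also have "\<dots> = c K" using finite_T K(1) by simp
    also have "c K = (norm (u x))\<^sup>2"
      using cell_value_eq[OF assms K(1) interior_nonempty[OF K(1)] xK] by (simp add: c_def)
    finally show ?thesis by simp
  qed
  have ik: "(\<lambda>x. c K * indicat_real (interior K) x) integrable_on \<Omega>" if "K \<in> T" for K
    using mInt[OF that] integrable_on_indicator[of "interior K" \<Omega>] by (intro integrable_on_mult_right) simp
  have iw: "w integrable_on \<Omega>" unfolding w_def by (rule integrable_sum[OF finite_T ik])
  have iu: "(\<lambda>x. (norm (u x))\<^sup>2) integrable_on \<Omega>"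
    by (rule integrable_spike[OF iw Z]) (use uw in auto)
  then have "(\<lambda>x. (norm (u x))\<^sup>2) absolutely_integrable_on \<Omega>"
    by (rule nonnegative_absolutely_integrable_1) simp
  then have "(LINT x:\<Omega>|lebesgue. (norm (u x))\<^sup>2) = integral \<Omega> (\<lambda>x. (norm (u x))\<^sup>2)"
    by (rule set_lebesgue_integral_eq_integral)
  also have "\<dots> = integral \<Omega> w" by (rule integral_spike[OF Z]) (use uw in auto)
  also have "\<dots> = (\<Sum>K\<in>T. integral \<Omega> (\<lambda>x. c K * indicat_real (interior K) x))"
    unfolding w_def by (rule integral_sum[OF finite_T ik])
  also have "\<dots> = (\<Sum>K\<in>T. area K * c K)"
    using mInt integral_indicator[of "interior _" \<Omega>] by (intro sum.cong refl) simp
  finally have eq: "(LINT x:\<Omega>|lebesgue. (norm (u x))\<^sup>2) = (\<Sum>K\<in>T. area K * c K)" .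
  have "0 \<le> (\<Sum>K\<in>T. area K * c K)" by (simp add: c_def area_def sum_nonneg)
  then show ?thesis unfolding L2_norm_on_def eq by (simp add: c_def)
qed

text \<open>The areas cancel, and the part of the upwind flux that carries \<open>V K\<close> with
  the full flux vanishes by \<open>q_sum\<close>. What is left is the form \<open>upw\<close> in
  each of the two components.\<close>

lemma b_form_eq:
  assumes "u \<in> P0 T" "u \<in> RT0 \<Omega> T"
  shows "b_form \<Omega> T u v w =
     upwind_flow.upw T nbrs (flow u) (\<lambda>K. cell_value v K $ 1) (\<lambda>K. cell_value w K $ 1) +
     upwind_flow.upw T nbrs (flow u) (\<lambda>K. cell_value v K $ 2) (\<lambda>K. cell_value w K $ 2)"
proof -
  interpret upwind_flow T nbrs "flow u" "\<lambda>K. h * norm (cell_value u K)" grid packing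
    by (rule upwind_flow_mesh[OF assms])
  define V W where "V = cell_value v" and "W = cell_value w"
  have cell: "area K * (W K \<bullet> b_tilde \<Omega> T u v K) =
      (\<Sum>L\<in>nbrs K. W K $ 1 * (min (flow u K L) 0 * (V L $ 1 - V K $ 1))) +
      (\<Sum>L\<in>nbrs K. W K $ 2 * (min (flow u K L) 0 * (V L $ 2 - V K $ 2)))" if K: "K \<in> T" for K
  proof -
    define g where "g \<sigma> L = edge_length \<sigma> *\<^sub>R (max (normal_flux u K \<sigma>) 0 *\<^sub>R V K + min (normal_flux u K \<sigma>) 0 *\<^sub>R V L)" for \<sigma> L
    have gf: "W K \<bullet> g (K \<inter> L) L = (W K \<bullet> V K) * flow u K L + min (flow u K L) 0 * (W K \<bullet> (V L - V K))" if L: "L \<in> nbrs K" for L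
    proof -
      define s F where "s = edge_length (K \<inter> L)" and "F = normal_flux u K (K \<inter> L)"
      have "0 \<le> s" using edge_length_le(1)[OF K nbrs_edge(3)[OF K L]] by (simp add: s_def)
      \<comment> \<open>The nonnegative length moves inside the positive and negative parts, and the
        positive part is written as the flux minus its negative part, so that the net flux can be
        split off.\<close>
      then have mm: "s * max F 0 = s * F - min (s * F) 0" "s * min F 0 = min (s * F) 0"
        by (auto simp: max_def min_def mult_le_0_iff not_le zero_le_mult_iff)
      have "W K \<bullet> g (K \<inter> L) L = (s * max F 0) * (W K \<bullet> V K) + (s * min F 0) * (W K \<bullet> V L)"
        by (simp add: g_def s_def F_def inner_add_right algebra_simps)
      also have "\<dots> = (W K \<bullet> V K) * (s * F) + min (s * F) 0 * (W K \<bullet> (V L - V K))"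
        unfolding mm by (simp add: inner_diff_right algebra_simps)
      finally show ?thesis by (simp add: flow_def s_def F_def)
    qed
    have "area K * (W K \<bullet> b_tilde \<Omega> T u v K) = W K \<bullet> (\<Sum>\<sigma>\<in>edges K \<inter> int_edges \<Omega> T. g \<sigma> (opposite_tri T K \<sigma>))"
      using area_ge(2)[OF K] by (simp add: b_tilde_def g_def V_def)
    also have "\<dots> = W K \<bullet> (\<Sum>L\<in>nbrs K. g (K \<inter> L) L)" by (simp only: sum_nbrs[OF K])
    also have "\<dots> = (\<Sum>L\<in>nbrs K. (W K \<bullet> V K) * flow u K L + min (flow u K L) 0 * (W K \<bullet> (V L - V K)))"
      unfolding inner_sum_right by (intro sum.cong refl gf)
    also have "\<dots> = (W K \<bullet> V K) * (\<Sum>L\<in>nbrs K. flow u K L) + (\<Sum>L\<in>nbrs K. min (flow u K L) 0 * (W K \<bullet> (V L - V K)))"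
      by (simp only: sum.distrib sum_distrib_left)
    also have "\<dots> = (\<Sum>L\<in>nbrs K. W K $ 1 * (min (flow u K L) 0 * (V L $ 1 - V K $ 1)) + W K $ 2 * (min (flow u K L) 0 * (V L $ 2 - V K $ 2)))"
      unfolding q_sum[OF K] by (simp add: inner_vec_def sum_2 algebra_simps)
    finally show ?thesis by (simp only: sum.distrib)
  qed
  have "b_form \<Omega> T u v w = (\<Sum>K\<in>T. area K * (W K \<bullet> b_tilde \<Omega> T u v K))" by (simp add: b_form_def W_def)
  also have "\<dots> = (\<Sum>K\<in>T. (\<Sum>L\<in>nbrs K. W K $ 1 * (min (flow u K L) 0 * (V L $ 1 - V K $ 1))) +
      (\<Sum>L\<in>nbrs K. W K $ 2 * (min (flow u K L) 0 * (V L $ 2 - V K $ 2))))"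
    by (intro sum.cong refl cell)
  finally show ?thesis by (simp only: upw_def V_def W_def sum.distrib)
qed

lemma energy_nonneg: "0 \<le> energy f"
  by (simp add: energy_def sum_nonneg)

lemma h_norm_nonneg: "0 \<le> h_norm \<Omega> T v"
proof -
  have "0 \<le> transmissivity \<Omega> T \<sigma>" if "\<sigma> \<in> int_edges \<Omega> T \<union> ext_edges \<Omega> T" for \<sigma>
    using transmissivity_ge[of \<sigma>] that c0_pos by (force simp: int_edges_def ext_edges_def)
  then show ?thesis
    unfolding h_norm_def by (intro real_sqrt_ge_zero add_nonneg_nonneg sum_nonneg mult_nonneg_nonneg) auto
qed

lemma sqrt_energy_le:
  assumes "0 \<le> M"
  shows "sqrt (M * energy (\<lambda>K. cell_value v K $ 1) + M * energy (\<lambda>K. cell_value v K $ 2)) \<le> sqrt (M / c\<^sub>0) * h_norm \<Omega> T v"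
proof -
  have "energy (\<lambda>K. cell_value v K $ 1) + energy (\<lambda>K. cell_value v K $ 2) \<le> (h_norm \<Omega> T v)\<^sup>2 / c\<^sub>0"
    using energy_le_h_norm[of v] c0_pos by (simp add: pos_le_divide_eq mult.commute)
  from mult_left_mono[OF this assms] have "M * energy (\<lambda>K. cell_value v K $ 1) + M * energy (\<lambda>K. cell_value v K $ 2) \<le> M / c\<^sub>0 * (h_norm \<Omega> T v)\<^sup>2"
    by (simp add: distrib_left)
  then have "sqrt (M * energy (\<lambda>K. cell_value v K $ 1) + M * energy (\<lambda>K. cell_value v K $ 2)) \<le> sqrt (M / c\<^sub>0 * (h_norm \<Omega> T v)\<^sup>2)"
    by simp
  then show ?thesis using h_norm_nonneg[of v] by (simp only: real_sqrt_mult real_sqrt_unique)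
qed

text \<open>By \<open>area_ge\<close>, \<open>h\<^sup>2\<close> is at most 2 /
  \<open>c\<^sub>0 ^ 3\<close> times the area of any cell, which turns the sum over cells into the
  integral.\<close>

lemma sqrt_flux_le:
  assumes "u \<in> P0 T"
  shows "sqrt (\<Sum>K\<in>T. (h * norm (cell_value u K))\<^sup>2) \<le> sqrt (2 / c\<^sub>0 ^ 3) * L2_norm_on \<Omega> u"
proof -
  have "(h * norm (cell_value u K))\<^sup>2 \<le> 2 / c\<^sub>0 ^ 3 * (area K * (norm (cell_value u K))\<^sup>2)" if "K \<in> T" for K
  proof -
    have "h\<^sup>2 \<le> 2 / c\<^sub>0 ^ 3 * area K" using area_ge(1)[OF that] c0_pos by (simp add: field_simps)
    from mult_right_mono[OF this, of "(norm (cell_value u K))\<^sup>2"] show ?thesis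
      by (simp add: power_mult_distrib mult.assoc)
  qed
  then have "(\<Sum>K\<in>T. (h * norm (cell_value u K))\<^sup>2) \<le> 2 / c\<^sub>0 ^ 3 * (L2_norm_on \<Omega> u)\<^sup>2"
    unfolding L2_norm_eq[OF assms] sum_distrib_left by (rule sum_mono)
  then have "sqrt (\<Sum>K\<in>T. (h * norm (cell_value u K))\<^sup>2) \<le> sqrt (2 / c\<^sub>0 ^ 3 * (L2_norm_on \<Omega> u)\<^sup>2)" by simp
  moreover have "0 \<le> L2_norm_on \<Omega> u"
    unfolding L2_norm_on_def set_lebesgue_integral_def by (intro real_sqrt_ge_zero integral_nonneg_AE) auto
  ultimately show ?thesis by (simp only: real_sqrt_mult real_sqrt_unique)
qed

end

theorem proposition4p3:
  fixes \<Omega> :: "(real^2) set" and c\<^sub>0 :: real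
  assumes "polygonal_domain \<Omega>" and "c\<^sub>0 > 0"
  shows "\<exists>C>0. \<forall>T. admissible_mesh \<Omega> c\<^sub>0 T \<longrightarrow>
           (\<forall>v\<in>P0 T. \<forall>w\<in>P0 T. \<forall>u\<in>P0 T \<inter> RT0 \<Omega> T. divergence_free T u \<longrightarrow>
              \<bar>b_form \<Omega> T u v w\<bar> \<le> C * L2_norm_on \<Omega> u * h_norm \<Omega> T v * h_norm \<Omega> T w)"
proof -
  from upwind_flow_bound obtain C where C0: "C > 0" and
    C: "\<And>T N q y \<gamma> n v vg e w wg e' E E'. upwind_flow T N q y \<gamma> n \<Longrightarrow> upwind_flow.approx T N \<gamma> v vg e \<Longrightarrow>
      upwind_flow.approx T N \<gamma> w wg e' \<Longrightarrow> finite {z. wg z \<noteq> 0} \<Longrightarrow> (\<And>F. finite F \<Longrightarrow> sum e F \<le> E) \<Longrightarrow>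
      (\<And>F. finite F \<Longrightarrow> sum e' F \<le> E') \<Longrightarrow>
      \<bar>upwind_flow.upw T N q v w\<bar> \<le> C * real n * sqrt (\<Sum>K\<in>(T::(real^2) set set). (y K)\<^sup>2) * sqrt E * sqrt E'"
    by blast
  \<comment> \<open>The value of \<open>packing\<close>, written out because the constant has to be
    chosen before the mesh.\<close>
  define n where "n = nat \<lceil>200 / c\<^sub>0 ^ 3\<rceil> + 1"
  define M where "M = 288 * (real n)\<^sup>2"
  \<comment> \<open>Flow bound with multiplicity \<open>n\<close>, then \<open>sqrt_flux_le\<close>
    for \<open>u\<close>, then \<open>sqrt_energy_le\<close> once for \<open>v\<close> and once for
    \<open>w\<close>.\<close>
  define A where "A = C * real n * sqrt (2 / c\<^sub>0 ^ 3) * (sqrt (M / c\<^sub>0) * sqrt (M / c\<^sub>0))"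
  have M0: "0 \<le> M" by (simp add: M_def)
  have bound: "\<bar>b_form \<Omega> T u v w\<bar> \<le> A * L2_norm_on \<Omega> u * h_norm \<Omega> T v * h_norm \<Omega> T w"
    if T: "admissible_mesh \<Omega> c\<^sub>0 T" and u: "u \<in> P0 T" "u \<in> RT0 \<Omega> T" for T u v w
  proof -
    interpret regular_mesh \<Omega> T c\<^sub>0
      using assms T by unfold_locales (auto simp: admissible_mesh_def)
    have n: "packing = n" by (simp add: packing_def n_def)
    define V where "V i v = energy (\<lambda>K. cell_value v K $ i)" for i :: 2 and v
    define Y where "Y = sqrt (\<Sum>K\<in>T. (h * norm (cell_value u K))\<^sup>2)"
    have V0: "0 \<le> M * V i v" for i v using M0 energy_nonneg by (simp add: V_def)
    have comp: "\<bar>upwind_flow.upw T nbrs (flow u) (\<lambda>K. cell_value v K $ i) (\<lambda>K. cell_value w K $ i)\<bar>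
        \<le> C * real n * Y * (sqrt (M * V i v) * sqrt (M * V i w))" for i
      using C[OF upwind_flow_mesh[OF u] approx_sample[OF u] approx_sample[OF u] finite_sample sum_local_energy sum_local_energy]
      by (simp only: n M_def V_def Y_def mult.assoc)
    have "\<bar>b_form \<Omega> T u v w\<bar> \<le> C * real n * Y * (sqrt (M * V 1 v) * sqrt (M * V 1 w)) + C * real n * Y * (sqrt (M * V 2 v) * sqrt (M * V 2 w))"
      unfolding b_form_eq[OF u] using comp[of 1] comp[of 2] by linarith
    also have "\<dots> = C * real n * Y * (sqrt (M * V 1 v) * sqrt (M * V 1 w) + sqrt (M * V 2 v) * sqrt (M * V 2 w))"
      by (simp only: distrib_left)
    also have "\<dots> \<le> C * real n * (sqrt (2 / c\<^sub>0 ^ 3) * L2_norm_on \<Omega> u) * ((sqrt (M / c\<^sub>0) * h_norm \<Omega> T v) * (sqrt (M / c\<^sub>0) * h_norm \<Omega> T w))"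
    proof (intro mult_mono)
      \<comment> \<open>Cauchy-Schwarz over the two components of the fields.\<close>
      have "sqrt (M * V 1 v) * sqrt (M * V 1 w) + sqrt (M * V 2 v) * sqrt (M * V 2 w)
          \<le> sqrt (M * V 1 v + M * V 2 v) * sqrt (M * V 1 w + M * V 2 w)"
        using cauchy_schwarz_2[of "sqrt (M * V 1 v)" "sqrt (M * V 1 w)" "sqrt (M * V 2 v)" "sqrt (M * V 2 w)"] V0
        by (simp only: real_sqrt_pow2)
      also have "\<dots> \<le> (sqrt (M / c\<^sub>0) * h_norm \<Omega> T v) * (sqrt (M / c\<^sub>0) * h_norm \<Omega> T w)"
        unfolding V_def using sqrt_energy_le[OF M0] h_norm_nonneg M0 c0_pos energy_nonneg by (intro mult_mono) auto
      finally show "sqrt (M * V 1 v) * sqrt (M * V 1 w) + sqrt (M * V 2 v) * sqrt (M * V 2 w)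
          \<le> (sqrt (M / c\<^sub>0) * h_norm \<Omega> T v) * (sqrt (M / c\<^sub>0) * h_norm \<Omega> T w)" .
      show Y: "Y \<le> sqrt (2 / c\<^sub>0 ^ 3) * L2_norm_on \<Omega> u" unfolding Y_def by (rule sqrt_flux_le[OF u(1)])
      have Y0: "0 \<le> Y" by (simp add: Y_def sum_nonneg)
      then show "0 \<le> Y" .
      show "0 \<le> C * real n * (sqrt (2 / c\<^sub>0 ^ 3) * L2_norm_on \<Omega> u)" by (rule mult_nonneg_nonneg[OF _ order_trans[OF Y0 Y]]) (use C0 in simp)
      show "0 \<le> sqrt (M * V 1 v) * sqrt (M * V 1 w) + sqrt (M * V 2 v) * sqrt (M * V 2 w)" using V0 by simp
    qed (use C0 in auto)
    also have "\<dots> = A * L2_norm_on \<Omega> u * h_norm \<Omega> T v * h_norm \<Omega> T w" by (simp only: A_def ac_simps)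
    finally show ?thesis .
  qed
  have "0 < real n" by (simp only: n_def of_nat_0_less_iff add_gr_0 zero_less_one simp_thms)
  then have "0 < A" using C0 assms(2) by (simp add: A_def M_def)
  with bound show ?thesis by (intro exI[of _ A]) auto
qed

end
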